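(* Let $u_{\mathrm{in}}\in L^\infty(\mathbb{R})\cap\mathrm{BV}(\mathbb{R})\cap L^2(\mathbb{R})$ and, for $\varepsilon\in(0,1)$, let $u^\varepsilon_{\mathrm{in}}\in H^2(\mathbb{R})\cap L^1(\mathbb{R})$ with $\lim_{|x|\to\infty}u^\varepsilon_{\mathrm{in}}(x)=0$. Assume that there are constants $c,C_1>0$ and $\underline u\leq\bar u$ such that for all $\varepsilon$: $\frac12\|u_{\mathrm{in}}^\varepsilon\|_{L^2(\mathbb{R})}^2\leq c$; $\underline u\leq u_{\mathrm{in}},u_{\mathrm{in}}^\varepsilon\leq\bar u$ a.e.; $\|u_{\mathrm{in}}^\varepsilon\|_{L^1(\mathbb{R})}+\|\partial_xu_{\mathrm{in}}^\varepsilon\|_{L^1(\mathbb{R})}\leq C_1$; and $$\Big\|\partial_x\Big(\frac{(u^\varepsilon_{\mathrm{in}})^2}{2}-\frac{\partial_xu^\varepsilon_{\mathrm{in}}}{\sqrt{|\partial_xu^\varepsilon_{\mathrm{in}}|^2+\varepsilon^2}}-\varepsilon\partial_xu^\varepsilon_{\mathrm{in}}\Big)\Big\|_{L^1(\mathbb{R})}\leq C_1 .$$ Assume moreover that $u_{\mathrm{in}}^\varepsilon\rightharpoonup u_{\mathrm{in}}$ weakly in $L^1(\mathbb{R})$ and $u_{\mathrm{in}}^\varepsilon\to u_{\mathrm{in}}$ strongly in $L^2(\mathbb{R})$ as $\varepsilon\to0$. Let $u^\varepsilon$ be solutions of the viscoplastic Cauchy problem with data $u^\varepsilon_{\mathrm{in}}$,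 $R^\varepsilon:=\partial_xu^\varepsilon/\sqrt{|\partial_xu^\varepsilon|^2+\varepsilon^2}$, and let $(u,R)$ be a limit pair of a subsequence (as described in the context). Let $T>0$, $X:=L^2(0,T;L^2(\mathbb{R}))$, $Y:=X\cap L^1(0,T;\mathrm{BV}(\mathbb{R}))$, and let $\Psi:X\to[0,\infty]$ be given by $\Psi(v):=\int_0^T|\mathrm{D}_xv|(\mathbb{R})\,\mathrm{d}t$ if $v\in Y$ and $\Psi(v):=\infty$ otherwise. Then $$-\partial_xR^\varepsilon\in\partial\Psi(0)\qquad\text{for all }\varepsilon,$$ and there are a subsequence and a limit $\zeta\in X^*$ such that $$-\partial_xR^\varepsilon\overset{*}{\rightharpoonup}\zeta\ \text{ in }Y^*,\qquad \zeta=-\mathrm{D}_xR\ \text{ in the sense of distributions on }(0,T)\times\mathbb{R},\qquad \zeta\in\partial\Psi(0) .$$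
   Context: Viscoplastic Cauchy problem, for $\varepsilon\in(0,1)$: $\partial_t u^\varepsilon + \partial_x((u^\varepsilon)^2/2) - \partial_x R^\varepsilon - \varepsilon\partial_{xx} u^\varepsilon = 0$ in $(0,\infty)\times\mathbb{R}$, where $R^\varepsilon:=\partial_x u^\varepsilon/\sqrt{|\partial_x u^\varepsilon|^2+\varepsilon^2}$, with $\lim_{|x|\to\infty}u^\varepsilon(t,x)=0$ for all $t\geq0$ and $u^\varepsilon(0,\cdot)=u^\varepsilon_{\mathrm{in}}$. A solution means a function $u^\varepsilon:[0,\infty)\times\mathbb{R}\to\mathbb{R}$ with, for all $T>0$, $u^\varepsilon\in L^\infty(0,T;H^2(\mathbb{R}))$, $\partial_tu^\varepsilon\in L^\infty(0,T;L^2(\mathbb{R}))\cap L^2(0,T;H^1(\mathbb{R}))$, satisfying $$\int_0^\infty\int_{\mathbb{R}}\Big(u^\varepsilon\partial_t\phi+\big(\tfrac{(u^\varepsilon)^2}{2}-\varepsilon\partial_xu^\varepsilon-R^\varepsilon\big)\partial_x\phi\Big)\,\mathrm{d}x\,\mathrm{d}t+\int_{\mathbb{R}}u^\varepsilon_{\mathrm{in}}\phi(0,\cdot)\,\mathrm{d}x=0$$ for all $\phi\in C^1_c([0,\infty)\times\mathbb{R})$, the far-field condition, and, for all $T>0$, $\int_0^T\frac13u^\varepsilon(t,\pm r)^3\,\mathrm{d}t\to0$, $\int_0^Tu^\varepsilon(t,\pm r)\,\varepsilon\partial_xu^\varepsilon(t,\pm r)\,\mathrm{d}t\to0$, $\int_0^Tu^\varepsilon(t,\pm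 r)R^\varepsilon(t,\pm r)\,\mathrm{d}t\to0$ as $r\to\infty$. Limit pair $(u,R)$: along a subsequence $\varepsilon\to0$, for all $T,r>0$ and $B_r=(-r,r)$: $u^\varepsilon\to u$ in $L^2((0,T)\times B_r)$; $u^\varepsilon\overset{*}{\rightharpoonup}u$ in $L^\infty(0,\infty;L^2(\mathbb{R}))$, $L^\infty(0,\infty;L^\infty(\mathbb{R}))$ and $L^\infty(0,\infty;\mathrm{BV}(\mathbb{R}))$; $\|u^\varepsilon(t)\|_{L^2(\mathbb{R})}\to\|u(t)\|_{L^2(\mathbb{R})}$ for a.a. $t>0$; $\varepsilon\|\partial_xu^\varepsilon\|_{L^2((0,T)\times\mathbb{R})}\to0$; $R^\varepsilon\overset{*}{\rightharpoonup}R$ in $L^\infty([0,T]\times B_r)$; $R^\varepsilon+\varepsilon\partial_xu^\varepsilon\overset{*}{\rightharpoonup}R$ in $L^\infty(0,T;\mathrm{BV}(B_r))$. Moreover $u\in L^\infty(0,\infty;L^\infty(\mathbb{R})\cap\mathrm{BV}(\mathbb{R}))\cap C([0,\infty);L^1(\mathbb{R}))\cap C([0,\infty);L^2(\mathbb{R}))$, $R\in L^\infty(0,\infty;\mathrm{BV}(\mathbb{R}))$, $|R|\leq1$ a.e., and $(u,R)$ satisfies $\int_0^\infty\int_{\mathbb{R}}(u\,\partial_t\phi+(\frac{u^2}{2}-R)\partial_x\phi)\,\mathrm{d}x\,\mathrm{d}t+\int_{\mathbb{R}}u_{\mathrm{in}}\phi(0,\cdot)\,\mathrm{d}x=0$ for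 all $\phi\in C^1_c([0,\infty)\times\mathbb{R})$. $\mathrm{D}_x$ is the distributional derivative in $x$ and $|\mathrm{D}_xv|(\mathbb{R})$ the total variation in $x$. $\partial\Psi(0):=\{\eta\in X^*:\langle\eta,w\rangle_X\leq\Psi(w)\ \forall w\in X\}$. Functions in $L^2((0,T)\times\mathbb{R})$ are identified with elements of $X^*$ via the $L^2$ pairing, and elements of $X^*$ with elements of $Y^*$ by restriction to $Y$ ($Y$ normed by the sum of the norms of $X$ and $L^1(0,T;\mathrm{BV}(\mathbb{R}))$). *)

theory Defs
  imports "HOL-Analysis.Analysis"
begin

text \<open>
  Elements of Lebesgue-type spaces are represented by Borel functions. A function of time and
  space has type \<open>real \<times> real \<Rightarrow> real\<close>, with time as first component; only its values on the set
  carrying the measure matter.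
\<close>

abbreviation lborel_on :: "'a::euclidean_space set \<Rightarrow> 'a measure" where
  "lborel_on S \<equiv> restrict_space lborel S"

section \<open>Test functions\<close>

text \<open>
  On an open \<open>S\<close> this is the usual class; on the closed half-plane it is \<open>C^k\<close> up to the boundary.
\<close>

primrec Ck_on :: "'a::real_normed_vector set \<Rightarrow> nat \<Rightarrow> ('a \<Rightarrow> real) \<Rightarrow> bool" where
  "Ck_on S 0 f \<longleftrightarrow> continuous_on S f"
| "Ck_on S (Suc k) f \<longleftrightarrow> f differentiable_on S \<and>
     (\<forall>v. Ck_on S k (\<lambda>p. frechet_derivative f (at p within S) v))"

definition compact_support_in :: "'a::real_normed_vector set \<Rightarrow> ('a \<Rightarrow> real) \<Rightarrow> bool" where
  "compact_support_in S f \<longleftrightarrow> (\<exists>K. compact K \<and> K \<subseteq> S \<and> (\<forall>p\<in>S - K. f p = 0))"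

definition C1c :: "'a::real_normed_vector set \<Rightarrow> ('a \<Rightarrow> real) set" where
  "C1c S = {f. Ck_on S 1 f \<and> compact_support_in S f}"

definition Cinfc :: "'a::real_normed_vector set \<Rightarrow> ('a \<Rightarrow> real) set" where
  "Cinfc S = {f. (\<forall>k. Ck_on S k f) \<and> compact_support_in S f}"

definition dt :: "(real \<times> real \<Rightarrow> real) \<Rightarrow> real \<times> real \<Rightarrow> real" where
  "dt f p = frechet_derivative f (at p) (1, 0)"

definition dx :: "(real \<times> real \<Rightarrow> real) \<Rightarrow> real \<times> real \<Rightarrow> real" where
  "dx f p = frechet_derivative f (at p) (0, 1)"

definition C0 :: "real set \<Rightarrow> (real \<Rightarrow> real) set" where
  "C0 S = {f. continuous_on S f \<and>
     (\<forall>e>0. \<exists>K. compact K \<and> K \<subseteq> S \<and> (\<forall>x\<in>S - K. \<bar>f x\<bar> < e))}"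

definition sup_norm :: "real set \<Rightarrow> (real \<Rightarrow> real) \<Rightarrow> real" where
  "sup_norm S f = (SUP x\<in>S. \<bar>f x\<bar>)"

section \<open>Lebesgue, Sobolev and BV spaces\<close>

definition L1 :: "'a measure \<Rightarrow> ('a \<Rightarrow> real) set" where
  "L1 M = {f. integrable M f}"

definition L1_norm :: "'a measure \<Rightarrow> ('a \<Rightarrow> real) \<Rightarrow> ennreal" where
  "L1_norm M f = (\<integral>\<^sup>+ x. ennreal \<bar>f x\<bar> \<partial>M)"

definition L2 :: "'a measure \<Rightarrow> ('a \<Rightarrow> real) set" where
  "L2 M = {f \<in> borel_measurable M. integrable M (\<lambda>x. (f x)\<^sup>2)}"

definition L2_norm :: "'a measure \<Rightarrow> ('a \<Rightarrow> real) \<Rightarrow> real" where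
  "L2_norm M f = sqrt (\<integral>x. (f x)\<^sup>2 \<partial>M)"

definition Linf :: "'a measure \<Rightarrow> ('a \<Rightarrow> real) set" where
  "Linf M = {f \<in> borel_measurable M. \<exists>C. AE x in M. \<bar>f x\<bar> \<le> C}"

definition loc_integrable :: "'a::euclidean_space set \<Rightarrow> ('a \<Rightarrow> real) \<Rightarrow> bool" where
  "loc_integrable S f \<longleftrightarrow> (\<forall>K. compact K \<and> K \<subseteq> S \<longrightarrow> set_integrable lborel K f)"

text \<open>
  Weak derivatives and total variations are tested with \<open>C^1\<close> functions of compact support;
  by mollification this is the same as testing with smooth ones.
\<close>

definition weak_deriv :: "(real \<Rightarrow> real) \<Rightarrow> (real \<Rightarrow> real) \<Rightarrow> bool" where
  "weak_deriv f g \<longleftrightarrow> loc_integrable UNIV f \<and> loc_integrable UNIV g \<and>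
     (\<forall>\<phi>\<in>C1c UNIV. (\<integral>x. f x * deriv \<phi> x \<partial>lborel) = - (\<integral>x. g x * \<phi> x \<partial>lborel))"

text \<open>Some representative of the weak derivative, which is unique up to null sets.\<close>

definition wderiv :: "(real \<Rightarrow> real) \<Rightarrow> real \<Rightarrow> real" where
  "wderiv f = (SOME g. weak_deriv f g)"

definition H1 :: "(real \<Rightarrow> real) set" where
  "H1 = {f \<in> L2 lborel. \<exists>g\<in>L2 lborel. weak_deriv f g}"

definition H1_norm :: "(real \<Rightarrow> real) \<Rightarrow> real" where
  "H1_norm f = sqrt ((L2_norm lborel f)\<^sup>2 + (L2_norm lborel (wderiv f))\<^sup>2)"

definition H2 :: "(real \<Rightarrow> real) set" where
  "H2 = {f \<in> L2 lborel. \<exists>g\<in>L2 lborel. \<exists>h\<in>L2 lborel. weak_deriv f g \<and> weak_deriv g h}"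

definition H2_norm :: "(real \<Rightarrow> real) \<Rightarrow> real" where
  "H2_norm f = sqrt ((L2_norm lborel f)\<^sup>2 + (L2_norm lborel (wderiv f))\<^sup>2
     + (L2_norm lborel (wderiv (wderiv f)))\<^sup>2)"

definition weak_dt :: "(real \<times> real) set \<Rightarrow> (real \<times> real \<Rightarrow> real) \<Rightarrow> (real \<times> real \<Rightarrow> real) \<Rightarrow> bool" where
  "weak_dt S v g \<longleftrightarrow> loc_integrable S v \<and> loc_integrable S g \<and>
     (\<forall>\<phi>\<in>C1c S. (\<integral>p. v p * dt \<phi> p \<partial>lborel_on S) = - (\<integral>p. g p * \<phi> p \<partial>lborel_on S))"

definition weak_dx :: "(real \<times> real) set \<Rightarrow> (real \<times> real \<Rightarrow> real) \<Rightarrow> (real \<times> real \<Rightarrow> real) \<Rightarrow> bool" where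
  "weak_dx S v g \<longleftrightarrow> loc_integrable S v \<and> loc_integrable S g \<and>
     (\<forall>\<phi>\<in>C1c S. (\<integral>p. v p * dx \<phi> p \<partial>lborel_on S) = - (\<integral>p. g p * \<phi> p \<partial>lborel_on S))"

definition Dx_distr :: "(real \<times> real) set \<Rightarrow> (real \<times> real \<Rightarrow> real) \<Rightarrow> (real \<times> real \<Rightarrow> real) \<Rightarrow> real" where
  "Dx_distr S v \<phi> = - (\<integral>p. v p * dx \<phi> p \<partial>lborel_on S)"

definition TV :: "real set \<Rightarrow> (real \<Rightarrow> real) \<Rightarrow> ennreal" where
  "TV S v = (if loc_integrable S v
     then (SUP \<phi>\<in>{\<phi>\<in>C1c S. \<forall>x\<in>S. \<bar>\<phi> x\<bar> \<le> 1}. ennreal (\<integral>x. v x * deriv \<phi> x \<partial>lborel_on S))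
     else \<infinity>)"

definition BV :: "real set \<Rightarrow> (real \<Rightarrow> real) set" where
  "BV S = {v \<in> L1 (lborel_on S). TV S v < \<infinity>}"

definition BV_norm :: "real set \<Rightarrow> (real \<Rightarrow> real) \<Rightarrow> real" where
  "BV_norm S v = enn2real (L1_norm (lborel_on S) v + TV S v)"

text \<open>
  The derivative of a BV function is the finite signed Borel measure \<open>\<mu> - \<nu>\<close> on \<open>S\<close>;
  \<open>D_pair S v \<psi>\<close> is the integral of \<open>\<psi>\<close> in \<open>C0 S\<close> against it, which does not depend on the
  decomposition.
\<close>

definition deriv_measures :: "real set \<Rightarrow> (real \<Rightarrow> real) \<Rightarrow> real measure \<Rightarrow> real measure \<Rightarrow> bool" where
  "deriv_measures S v \<mu> \<nu> \<longleftrightarrow>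
     finite_measure \<mu> \<and> finite_measure \<nu> \<and>
     sets \<mu> = sets (restrict_space borel S) \<and> sets \<nu> = sets (restrict_space borel S) \<and>
     (\<forall>\<phi>\<in>C1c S. (\<integral>x. v x * deriv \<phi> x \<partial>lborel_on S) = - ((\<integral>x. \<phi> x \<partial>\<mu>) - (\<integral>x. \<phi> x \<partial>\<nu>)))"

definition D_pair :: "real set \<Rightarrow> (real \<Rightarrow> real) \<Rightarrow> (real \<Rightarrow> real) \<Rightarrow> real" where
  "D_pair S v \<psi> = (THE c. \<exists>\<mu> \<nu>. deriv_measures S v \<mu> \<nu> \<and> c = (\<integral>x. \<psi> x \<partial>\<mu>) - (\<integral>x. \<psi> x \<partial>\<nu>))"

section \<open>Spaces of functions of time with values in a function space\<close>

text \<open>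
  \<open>L^p(I; V)\<close> for a space \<open>V\<close> of functions on \<open>S\<close> with norm \<open>N\<close>. Measurability of the map from
  time into \<open>V\<close> is expressed by joint measurability. For separable \<open>V\<close> this is the Bochner
  space; for \<open>BV\<close> it is the space of weakly-* measurable maps (a translating jump
  is not strongly measurable into \<open>BV\<close>).
\<close>

definition Linf_of :: "real set \<Rightarrow> real set \<Rightarrow> (real \<Rightarrow> real) set \<Rightarrow> ((real \<Rightarrow> real) \<Rightarrow> real)
    \<Rightarrow> (real \<times> real \<Rightarrow> real) set" where
  "Linf_of I S V N = {v \<in> borel_measurable (lborel_on (I \<times> S)).
     \<exists>C. AE t in lborel_on I. (\<lambda>x. v (t, x)) \<in> V \<and> N (\<lambda>x. v (t, x)) \<le> C}"

definition L1_of :: "real set \<Rightarrow> real set \<Rightarrow> (real \<Rightarrow> real) set \<Rightarrow> ((real \<Rightarrow> real) \<Rightarrow> real)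
    \<Rightarrow> (real \<times> real \<Rightarrow> real) set" where
  "L1_of I S V N = {v \<in> borel_measurable (lborel_on (I \<times> S)).
     (AE t in lborel_on I. (\<lambda>x. v (t, x)) \<in> V) \<and>
     (\<integral>\<^sup>+ t. ennreal (N (\<lambda>x. v (t, x))) \<partial>lborel_on I) < \<infinity>}"

definition L2_of :: "real set \<Rightarrow> real set \<Rightarrow> (real \<Rightarrow> real) set \<Rightarrow> ((real \<Rightarrow> real) \<Rightarrow> real)
    \<Rightarrow> (real \<times> real \<Rightarrow> real) set" where
  "L2_of I S V N = {v \<in> borel_measurable (lborel_on (I \<times> S)).
     (AE t in lborel_on I. (\<lambda>x. v (t, x)) \<in> V) \<and>
     (\<integral>\<^sup>+ t. ennreal ((N (\<lambda>x. v (t, x)))\<^sup>2) \<partial>lborel_on I) < \<infinity>}"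

abbreviation Linf_L2 :: "real set \<Rightarrow> (real \<times> real \<Rightarrow> real) set" where
  "Linf_L2 I \<equiv> Linf_of I UNIV (L2 lborel) (L2_norm lborel)"

abbreviation Linf_BV :: "real set \<Rightarrow> real set \<Rightarrow> (real \<times> real \<Rightarrow> real) set" where
  "Linf_BV I S \<equiv> Linf_of I S (BV S) (BV_norm S)"

definition continuous_in_time :: "(real \<Rightarrow> real) set \<Rightarrow> ((real \<Rightarrow> real) \<Rightarrow> real)
    \<Rightarrow> (real \<times> real \<Rightarrow> real) \<Rightarrow> bool" where
  "continuous_in_time V N v \<longleftrightarrow> (\<forall>t\<ge>0. (\<lambda>x. v (t, x)) \<in> V \<and>
     ((\<lambda>s. N (\<lambda>x. v (s, x) - v (t, x))) \<longlongrightarrow> 0) (at t within {0..}))"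

text \<open>Weak-* convergence in \<open>L^\<infinity>(M)\<close>, tested with \<open>L^1(M)\<close>.\<close>

definition wstar_Linf :: "'a measure \<Rightarrow> (nat \<Rightarrow> 'a \<Rightarrow> real) \<Rightarrow> ('a \<Rightarrow> real) \<Rightarrow> bool" where
  "wstar_Linf M v w \<longleftrightarrow> (\<forall>n. v n \<in> Linf M) \<and> w \<in> Linf M \<and>
     (\<forall>\<psi>\<in>L1 M. (\<lambda>n. \<integral>p. v n p * \<psi> p \<partial>M) \<longlonglongrightarrow> (\<integral>p. w p * \<psi> p \<partial>M))"

text \<open>Weak-* convergence in \<open>L^\<infinity>(I; L^2(R))\<close>, tested with \<open>L^1(I; L^2(R))\<close>.\<close>

definition wstar_Linf_L2 :: "real set \<Rightarrow> (nat \<Rightarrow> real \<times> real \<Rightarrow> real) \<Rightarrow> (real \<times> real \<Rightarrow> real) \<Rightarrow> bool" where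
  "wstar_Linf_L2 I v w \<longleftrightarrow> (\<forall>n. v n \<in> Linf_L2 I) \<and> w \<in> Linf_L2 I \<and>
     (\<forall>\<psi>\<in>L1_of I UNIV (L2 lborel) (L2_norm lborel).
        (\<lambda>n. \<integral>p. v n p * \<psi> p \<partial>lborel_on (I \<times> UNIV)) \<longlonglongrightarrow> (\<integral>p. w p * \<psi> p \<partial>lborel_on (I \<times> UNIV)))"

text \<open>
  Weak-* convergence in \<open>L^\<infinity>(I; BV(S))\<close>. The map \<open>v \<mapsto> (v, Dv)\<close> embeds \<open>BV(S)\<close> as a weakly-*
  closed subspace of pairs of finite measures, so its predual is a quotient of
  \<open>C0 S \<times> C0 S\<close>, and the test functions are pairs in \<open>L^1(I; C0 S)\<close>. The time integral uses
  the complete measure since \<open>D_pair\<close> is meaningful for almost every time only.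
\<close>

definition BV_pairing :: "real set \<Rightarrow> real set \<Rightarrow> (real \<times> real \<Rightarrow> real)
    \<Rightarrow> (real \<times> real \<Rightarrow> real) \<Rightarrow> (real \<times> real \<Rightarrow> real) \<Rightarrow> real" where
  "BV_pairing I S v \<psi>0 \<psi>1 = (\<integral>p. v p * \<psi>0 p \<partial>lborel_on (I \<times> S)) +
     (\<integral>t. D_pair S (\<lambda>x. v (t, x)) (\<lambda>x. \<psi>1 (t, x)) \<partial>lebesgue_on I)"

definition wstar_Linf_BV :: "real set \<Rightarrow> real set \<Rightarrow> (nat \<Rightarrow> real \<times> real \<Rightarrow> real)
    \<Rightarrow> (real \<times> real \<Rightarrow> real) \<Rightarrow> bool" where
  "wstar_Linf_BV I S v w \<longleftrightarrow> (\<forall>n. v n \<in> Linf_BV I S) \<and> w \<in> Linf_BV I S \<and>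
     (\<forall>\<psi>0\<in>L1_of I S (C0 S) (sup_norm S). \<forall>\<psi>1\<in>L1_of I S (C0 S) (sup_norm S).
        (\<lambda>n. BV_pairing I S (v n) \<psi>0 \<psi>1) \<longlonglongrightarrow> BV_pairing I S w \<psi>0 \<psi>1)"

section \<open>The viscoplastic Cauchy problem\<close>

definition plastic :: "real \<Rightarrow> real \<Rightarrow> real" where
  "plastic \<epsilon> s = s / sqrt (\<bar>s\<bar>\<^sup>2 + \<epsilon>\<^sup>2)"

text \<open>Weak form of \<open>dt v + dx f = 0\<close> with initial datum \<open>v0\<close>.\<close>

definition weak_conservation_law :: "(real \<Rightarrow> real) \<Rightarrow> (real \<times> real \<Rightarrow> real)
    \<Rightarrow> (real \<times> real \<Rightarrow> real) \<Rightarrow> bool" where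
  "weak_conservation_law v0 v f \<longleftrightarrow> (\<forall>\<phi>\<in>C1c ({0..} \<times> UNIV).
     (\<integral>p. v p * dt \<phi> p + f p * dx \<phi> p \<partial>lborel_on ({0<..} \<times> UNIV))
       + (\<integral>x. v0 x * \<phi> (0, x) \<partial>lborel) = 0)"

text \<open>
  \<open>u\<close> is the solution and \<open>p\<close> its spatial derivative. The regularity class embeds into the
  functions continuous on the closed half-plane, and \<open>H^2(R)\<close> into \<open>C^1(R)\<close>. As point values
  enter the definition, \<open>u\<close> denotes the continuous representative, and \<open>p(t, _)\<close> the continuous
  representative of the weak derivative for almost every \<open>t\<close>.
\<close>

definition viscoplastic_solution :: "real \<Rightarrow> (real \<Rightarrow> real) \<Rightarrow> (real \<times> real \<Rightarrow> real)
    \<Rightarrow> (real \<times> real \<Rightarrow> real) \<Rightarrow> bool" where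
  "viscoplastic_solution \<epsilon> u0 u p \<longleftrightarrow>
     continuous_on ({0..} \<times> UNIV) u \<and>
     p \<in> borel_measurable (lborel_on ({0<..} \<times> UNIV)) \<and>
     (AE t in lborel_on {0<..}. weak_deriv (\<lambda>x. u (t, x)) (\<lambda>x. p (t, x)) \<and>
        continuous_on UNIV (\<lambda>x. p (t, x))) \<and>
     (\<forall>T>0. u \<in> Linf_of {0<..<T} UNIV H2 H2_norm \<and>
        (\<exists>ut. weak_dt ({0<..<T} \<times> UNIV) u ut \<and> ut \<in> Linf_L2 {0<..<T} \<and>
              ut \<in> L2_of {0<..<T} UNIV H1 H1_norm)) \<and>
     weak_conservation_law u0 u (\<lambda>q. (u q)\<^sup>2 / 2 - \<epsilon> * p q - plastic \<epsilon> (p q)) \<and>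
     (\<forall>x. u (0, x) = u0 x) \<and>
     (\<forall>t\<ge>0. ((\<lambda>x. u (t, x)) \<longlongrightarrow> 0) at_infinity) \<and>
     (\<forall>T>0. \<forall>s\<in>{1, -1}.
        ((\<lambda>r. \<integral>t. 1/3 * (u (t, s * r))^3 \<partial>lborel_on {0<..<T}) \<longlongrightarrow> 0) at_top \<and>
        ((\<lambda>r. \<integral>t. u (t, s * r) * (\<epsilon> * p (t, s * r)) \<partial>lborel_on {0<..<T}) \<longlongrightarrow> 0) at_top \<and>
        ((\<lambda>r. \<integral>t. u (t, s * r) * plastic \<epsilon> (p (t, s * r)) \<partial>lborel_on {0<..<T}) \<longlongrightarrow> 0) at_top)"

text \<open>
  \<open>(u, R)\<close> is a limit pair of the solutions \<open>ue \<epsilon>\<close>, with spatial derivatives \<open>pe \<epsilon>\<close>, along the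
  sequence \<open>e\<close>. That \<open>R\<close> is essentially bounded in time with values in \<open>BV(R)\<close> is understood
  as boundedness of the total variation on the line: \<open>R\<close> is bounded but in general not
  integrable over the line (outside the support of \<open>u\<close> it may equal 1 or -1).
\<close>

definition limit_pair :: "(real \<Rightarrow> real) \<Rightarrow> (real \<Rightarrow> real \<times> real \<Rightarrow> real)
    \<Rightarrow> (real \<Rightarrow> real \<times> real \<Rightarrow> real) \<Rightarrow> (nat \<Rightarrow> real)
    \<Rightarrow> (real \<times> real \<Rightarrow> real) \<Rightarrow> (real \<times> real \<Rightarrow> real) \<Rightarrow> bool" where
  "limit_pair u0 ue pe e u R \<longleftrightarrow>
     (\<forall>n. e n \<in> {0<..<1}) \<and> e \<longlonglongrightarrow> 0 \<and>
     (\<forall>T>0. \<forall>r>0.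
        (\<forall>n. ue (e n) \<in> L2 (lborel_on ({0<..<T} \<times> {-r<..<r}))) \<and>
        u \<in> L2 (lborel_on ({0<..<T} \<times> {-r<..<r})) \<and>
        (\<lambda>n. L2_norm (lborel_on ({0<..<T} \<times> {-r<..<r})) (\<lambda>q. ue (e n) q - u q)) \<longlonglongrightarrow> 0) \<and>
     wstar_Linf_L2 {0<..} (\<lambda>n. ue (e n)) u \<and>
     wstar_Linf (lborel_on ({0<..} \<times> UNIV)) (\<lambda>n. ue (e n)) u \<and>
     wstar_Linf_BV {0<..} UNIV (\<lambda>n. ue (e n)) u \<and>
     (AE t in lborel_on {0<..}. (\<lambda>n. L2_norm lborel (\<lambda>x. ue (e n) (t, x)))
        \<longlonglongrightarrow> L2_norm lborel (\<lambda>x. u (t, x))) \<and>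
     (\<forall>T>0. (\<lambda>n. e n * L2_norm (lborel_on ({0<..<T} \<times> UNIV)) (pe (e n))) \<longlonglongrightarrow> 0) \<and>
     (\<forall>T>0. \<forall>r>0.
        wstar_Linf (lborel_on ({0<..<T} \<times> {-r<..<r})) (\<lambda>n q. plastic (e n) (pe (e n) q)) R \<and>
        wstar_Linf_BV {0<..<T} {-r<..<r}
          (\<lambda>n q. plastic (e n) (pe (e n) q) + e n * pe (e n) q) R) \<and>
     u \<in> Linf (lborel_on ({0<..} \<times> UNIV)) \<and> u \<in> Linf_BV {0<..} UNIV \<and>
     continuous_in_time (L1 lborel) (\<lambda>f. enn2real (L1_norm lborel f)) u \<and>
     continuous_in_time (L2 lborel) (L2_norm lborel) u \<and>
     R \<in> borel_measurable (lborel_on ({0<..} \<times> UNIV)) \<and>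
     (\<exists>C::real. AE t in lborel_on {0<..}. TV UNIV (\<lambda>x. R (t, x)) \<le> ennreal C) \<and>
     (AE q in lborel_on ({0<..} \<times> UNIV). \<bar>R q\<bar> \<le> 1) \<and>
     weak_conservation_law u0 u (\<lambda>q. (u q)\<^sup>2 / 2 - R q)"

section \<open>Duality\<close>

abbreviation strip :: "real \<Rightarrow> (real \<times> real) set" where
  "strip T \<equiv> {0<..<T} \<times> UNIV"

text \<open>
  The dual of a space \<open>V\<close> of functions with norm \<open>N\<close>. Values of functionals outside \<open>V\<close>
  are irrelevant, so restriction to a subspace is implicit.
\<close>

definition dual :: "('a \<Rightarrow> real) set \<Rightarrow> (('a \<Rightarrow> real) \<Rightarrow> real) \<Rightarrow> (('a \<Rightarrow> real) \<Rightarrow> real) set" where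
  "dual V N = {\<eta>. (\<forall>v\<in>V. \<forall>w\<in>V. \<forall>a b. \<eta> (\<lambda>q. a * v q + b * w q) = a * \<eta> v + b * \<eta> w) \<and>
     (\<exists>C. \<forall>w\<in>V. \<bar>\<eta> w\<bar> \<le> C * N w)}"

definition wstar_dual :: "('a \<Rightarrow> real) set \<Rightarrow> (('a \<Rightarrow> real) \<Rightarrow> real)
    \<Rightarrow> (nat \<Rightarrow> ('a \<Rightarrow> real) \<Rightarrow> real) \<Rightarrow> (('a \<Rightarrow> real) \<Rightarrow> real) \<Rightarrow> bool" where
  "wstar_dual V N \<eta> \<zeta> \<longleftrightarrow> (\<forall>n. \<eta> n \<in> dual V N) \<and> \<zeta> \<in> dual V N \<and>
     (\<forall>w\<in>V. (\<lambda>n. \<eta> n w) \<longlonglongrightarrow> \<zeta> w)"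

definition X_space :: "real \<Rightarrow> (real \<times> real \<Rightarrow> real) set" where
  "X_space T = L2 (lborel_on (strip T))"

definition X_norm :: "real \<Rightarrow> (real \<times> real \<Rightarrow> real) \<Rightarrow> real" where
  "X_norm T = L2_norm (lborel_on (strip T))"

definition Y_space :: "real \<Rightarrow> (real \<times> real \<Rightarrow> real) set" where
  "Y_space T = X_space T \<inter> L1_of {0<..<T} UNIV (BV UNIV) (BV_norm UNIV)"

definition Y_norm :: "real \<Rightarrow> (real \<times> real \<Rightarrow> real) \<Rightarrow> real" where
  "Y_norm T v = X_norm T v +
     enn2real (\<integral>\<^sup>+ t. ennreal (BV_norm UNIV (\<lambda>x. v (t, x))) \<partial>lborel_on {0<..<T})"

definition Psi :: "real \<Rightarrow> (real \<times> real \<Rightarrow> real) \<Rightarrow> ennreal" where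
  "Psi T v = (if v \<in> Y_space T
     then (\<integral>\<^sup>+ t. TV UNIV (\<lambda>x. v (t, x)) \<partial>lborel_on {0<..<T}) else \<infinity>)"

definition subdiff_zero :: "real \<Rightarrow> ((real \<times> real \<Rightarrow> real) \<Rightarrow> ennreal)
    \<Rightarrow> ((real \<times> real \<Rightarrow> real) \<Rightarrow> real) set" where
  "subdiff_zero T \<Psi> = {\<eta> \<in> dual (X_space T) (X_norm T).
     \<forall>w\<in>X_space T. ereal (\<eta> w) \<le> enn2ereal (\<Psi> w)}"

definition L2_functional :: "real \<Rightarrow> (real \<times> real \<Rightarrow> real) \<Rightarrow> (real \<times> real \<Rightarrow> real) \<Rightarrow> real" where
  "L2_functional T g w = (\<integral>q. g q * w q \<partial>lborel_on (strip T))"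

end

theory Submission
  imports Defs
begin

text \<open>
  Write \<open>R = plastic \<epsilon> p\<close>, \<open>p = \<partial>\<^sub>x u\<close>. By the equation the total stress \<open>R + \<epsilon> p\<close> has the spatial
  derivative \<open>G = \<partial>\<^sub>t u + u p\<close>, and \<open>R\<close> is a \<open>C\<^sup>1\<close> function of the total stress, so
  \<open>\<partial>\<^sub>x R = \<theta> G\<close> with \<open>0 < \<theta> < 1\<close> is square-integrable. Pairing a slice of \<open>- \<partial>\<^sub>x R\<close> with a function
  of bounded variation amounts to integrating \<open>R\<close>, \<open>|R| \<le> 1\<close>, against its derivative; this gives
  \<open>- \<partial>\<^sub>x R \<in> \<partial>\<Psi>(0)\<close>.

  The limit lies in \<open>X\<^sup>*\<close> because \<open>\<partial>\<^sub>x R\<close> is bounded in \<open>L\<^sup>2\<close> uniformly in \<open>\<epsilon>\<close>: pointwise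
  \<open>(\<partial>\<^sub>x R)\<^sup>2 \<le> \<partial>\<^sub>x R \<partial>\<^sub>t u + u\<^sup>2 / 4\<close>, the integral of \<open>u\<^sup>2\<close> is controlled by the energy, and the integral of
  \<open>\<partial>\<^sub>x R \<partial>\<^sub>t u\<close> is at most the decrease of the integral of \<open>sqrt (p\<^sup>2 + \<epsilon>\<^sup>2) - \<epsilon>\<close>, which is initially at most the
  \<open>L\<^sup>1\<close> norm of \<open>\<partial>\<^sub>x u\<close>. With this bound, weak-* convergence of \<open>R\<close> identifies the limit on test
  functions, which are dense.
\<close>

section \<open>Absolutely continuous functions on the line\<close>

text \<open>The subdifferential inequality controls pairings only through the variation of the
  partner, so it gives no continuity in the norm of \<open>X\<close>; this is why a separate bound
  in \<open>L^2\<close> is sought. Estimating \<open>\<theta> G\<close> by norms of its two summands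
  would bring in quantities that may blow up as \<open>\<epsilon>\<close> tends to 0. In the
  pointwise inequality the derivatives \<open>\<partial>\<^sub>t u\<close> and \<open>p\<close> have
  left the remainder, which contains \<open>u\<close> alone. The other obstacle is low regularity:
  \<open>\<partial>\<^sub>t u\<close> is a weak derivative, and \<open>p\<close> is not known to
  have a time derivative. The weak identities are therefore turned into identities between
  increments and integrals on almost every horizontal and vertical line. Chain rule, product rule
  and integration by parts are needed only in one variable, and limits of difference quotients only
  weakly in \<open>L^2\<close>.\<close>

lemma set_integral_Icc_combine:
  fixes g :: "real \<Rightarrow> real"
  assumes "a \<le> c" "c \<le> b" "set_integrable lborel {a..b} g"
  shows "(LBINT x:{a..b}. g x) = (LBINT x:{a..c}. g x) + (LBINT x:{c..b}. g x)"
proof -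
  have eq: "{a..b} = {a..c} \<union> {c..b}"
    using assms by auto
  have ae: "AE x in lborel. \<not> (x \<in> {a..c} \<and> x \<in> {c..b})"
    using AE_lborel_singleton[of c] by eventually_elim auto
  have 1: "set_integrable lborel {a..c} g" "set_integrable lborel {c..b} g"
    using assms by (auto intro: set_integrable_subset)
  show ?thesis
    unfolding eq by (rule set_integral_Un_AE[OF ae]) (use 1 in auto)
qed

text \<open>Local absolute continuity with density \<open>g\<close>, put as an identity between
  increments and integrals. No differentiability at any point is claimed and \<open>g\<close>
  matters only up to null sets, which fits slices of weak derivatives.\<close>

definition primitive_on :: "real set \<Rightarrow> (real \<Rightarrow> real) \<Rightarrow> (real \<Rightarrow> real) \<Rightarrow> bool" where
  "primitive_on I f g \<longleftrightarrow> (\<forall>a\<in>I. \<forall>b\<in>I. a \<le> b \<longrightarrow>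
     set_integrable lborel {a..b} g \<and> f b - f a = (LBINT x:{a..b}. g x))"

lemma primitive_onD:
  assumes "primitive_on I f g" "a \<in> I" "b \<in> I" "a \<le> b"
  shows "set_integrable lborel {a..b} g" "f b - f a = (LBINT x:{a..b}. g x)"
  using assms unfolding primitive_on_def by auto

lemma primitive_on_subset: "primitive_on I f g \<Longrightarrow> J \<subseteq> I \<Longrightarrow> primitive_on J f g"
  unfolding primitive_on_def by blast

text \<open>Lebesgue integrability is converted to gauge integrability, for which indefinite
  integrals are continuous.\<close>

lemma primitive_on_continuous:
  assumes f: "primitive_on I f g" and "is_interval I" "a \<in> I" "b \<in> I"
  shows "continuous_on {a..b} f"
proof (cases "a \<le> b")
  case True
  have sub: "{a..b} \<subseteq> I"
    using mem_is_interval_1_I[OF assms(2-4)] by auto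
  have "set_integrable lborel {a..b} g"
    using primitive_onD[OF f] assms True by blast
  then have i: "integrable lborel (\<lambda>x. indicator {a..b} x *\<^sub>R g x)"
    by (simp only: set_integrable_def)
  have abs: "g absolutely_integrable_on {a..b}"
    unfolding set_integrable_def
    using i integrable_completion[OF borel_measurable_integrable[OF i]] by (simp only:)
  then have int: "g integrable_on {a..b}"
    by (rule set_lebesgue_integral_eq_integral)
  have eq: "f x = f a + integral {a..x} g" if "x \<in> {a..b}" for x
  proof -
    have "set_integrable lborel {a..x} g"
      using primitive_onD[OF f, of a x] that sub assms by auto
    then have "(LBINT x:{a..x}. g x) = integral {a..x} g"
      by (rule set_borel_integral_eq_integral)
    then show ?thesis
      using primitive_onD(2)[OF f, of a x] that sub assms by auto
  qed
  have "continuous_on {a..b} (\<lambda>x. f a + integral {a..x} g)"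
    by (intro continuous_intros indefinite_integral_continuous_1 int)
  then show ?thesis
    by (rule continuous_on_eq) (rule eq[symmetric])
qed auto

lemma primitive_on_add:
  assumes "primitive_on I f g" "primitive_on I f' g'"
  shows "primitive_on I (\<lambda>x. f x + f' x) (\<lambda>x. g x + g' x)"
  unfolding primitive_on_def
proof (intro ballI impI)
  fix a b assume ab: "a \<in> I" "b \<in> I" "a \<le> b"
  note 1 = primitive_onD[OF assms(1) ab] primitive_onD[OF assms(2) ab]
  show "set_integrable lborel {a..b} (\<lambda>x. g x + g' x) \<and>
      f b + f' b - (f a + f' a) = (LBINT x:{a..b}. g x + g' x)"
    using 1 by (simp add: set_integral_add)
qed

lemma primitive_on_cmult:
  assumes "primitive_on I f g"
  shows "primitive_on I (\<lambda>x. c * f x) (\<lambda>x. c * g x)"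
  using assms unfolding primitive_on_def by (auto simp flip: right_diff_distrib)

lemma primitive_on_diff:
  assumes "primitive_on I f g" "primitive_on I f' g'"
  shows "primitive_on I (\<lambda>x. f x - f' x) (\<lambda>x. g x - g' x)"
  using primitive_on_add[OF assms(1) primitive_on_cmult[OF assms(2), of "-1"]] by simp

lemma primitive_on_C1:
  assumes "\<And>x. (f has_real_derivative f' x) (at x)" "continuous_on UNIV f'"
  shows "primitive_on I f f'"
  unfolding primitive_on_def
proof (intro ballI impI)
  fix a b :: real assume "a \<le> b"
  have "isCont f' x" for x
    using assms(2) by (simp add: continuous_on_eq_continuous_at)
  then have 1: "has_bochner_integral lborel (\<lambda>x. f' x * indicator {a..b} x) (f b - f a)"
    by (intro has_bochner_integral_FTC_Icc_real[OF \<open>a \<le> b\<close>] assms) auto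
  show "set_integrable lborel {a..b} f' \<and> f b - f a = (LBINT x:{a..b}. f' x)"
    using 1 by (simp add: set_integrable_def set_lebesgue_integral_def mult.commute has_bochner_integral_iff)
qed

text \<open>A local estimate replaces differentiation almost everywhere. On a short interval the
  mean value theorem gives \<open>F (f y) - F (f x) = F' \<xi> * (f y - f x)\<close>, and continuity
  of \<open>F'\<close> bounds the error against the integral of \<open>F' (f x) * g x\<close> by
  \<open>e\<close> times the integral of the absolute value of \<open>g\<close>. Such a bound adds
  up over adjacent intervals, so \<open>Bolzano\<close> makes it global; then \<open>e\<close> tends
  to 0.\<close>

lemma primitive_on_chain:
  assumes f: "primitive_on I f g" and I: "is_interval I"
    and F: "\<And>x. (F has_real_derivative F' x) (at x)" and F': "continuous_on UNIV F'"
  shows "primitive_on I (\<lambda>x. F (f x)) (\<lambda>x. F' (f x) * g x)"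
  unfolding primitive_on_def
proof (intro ballI impI)
  fix a b assume ab: "a \<in> I" "b \<in> I" "a \<le> b"
  have sub: "{a..b} \<subseteq> I"
    using mem_is_interval_1_I[OF I ab(1,2)] by auto
  have cf: "continuous_on {a..b} f"
    by (rule primitive_on_continuous[OF f I ab(1,2)])
  have g: "set_integrable lborel {x..y} g" if "a \<le> x" "y \<le> b" for x y
    using primitive_onD(1)[OF f ab] that by (auto intro: set_integrable_subset)
  have cFf: "continuous_on {a..b} (\<lambda>x. F' (f x))"
    by (rule continuous_on_compose2[OF F' cf]) simp
  have bdd: "set_integrable lborel {a..b} (\<lambda>x. k x * g x)" if k: "continuous_on {a..b} k" for k
  proof -
    have "bounded (k ` {a..b})"
      using k by (intro compact_imp_bounded compact_continuous_image) auto
    then obtain M where "\<forall>y\<in>k ` {a..b}. norm y \<le> M"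
      unfolding bounded_iff by blast
    then have M: "\<bar>k x\<bar> \<le> M" if "x \<in> {a..b}" for x
      using that by simp
    have 1: "(\<lambda>x. indicator {a..b} x * k x) \<in> borel_measurable borel"
      using borel_measurable_continuous_on_indicator[OF _ k] by auto
    have 2: "(\<lambda>x. indicator {a..b} x * g x) \<in> borel_measurable borel"
      using g[of a b] by (auto simp: set_integrable_def)
    have "integrable lborel (\<lambda>x. M * (indicator {a..b} x * g x))"
      using g[of a b] by (auto simp: set_integrable_def)
    then have "integrable lborel (\<lambda>x. (indicator {a..b} x * k x) * (indicator {a..b} x * g x))"
    proof (rule Bochner_Integration.integrable_bound)
      show "(\<lambda>x. (indicator {a..b} x * k x) * (indicator {a..b} x * g x)) \<in> borel_measurable lborel"
        using 1 2 by simp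
      show "AE x in lborel. norm ((indicator {a..b} x * k x) * (indicator {a..b} x * g x))
          \<le> norm (M * (indicator {a..b} x * g x))"
      proof (rule AE_I2)
        fix x
        have "\<bar>k x * g x\<bar> \<le> \<bar>M * g x\<bar>" if "x \<in> {a..b}"
          using M[OF that] by (auto simp: abs_mult intro!: mult_right_mono)
        then show "norm ((indicator {a..b} x * k x) * (indicator {a..b} x * g x))
          \<le> norm (M * (indicator {a..b} x * g x))"
          by (auto simp: indicator_def)
      qed
    qed
    then show ?thesis
      unfolding set_integrable_def
      by (rule Bochner_Integration.integrable_cong[THEN iffD1, rotated -1]) (auto simp: indicator_def)
  qed
  define k where "k x = F' (f x) * g x" for x
  have k: "set_integrable lborel {x..y} k" if "a \<le> x" "y \<le> b" for x y
    using bdd[OF cFf] that unfolding k_def by (auto intro: set_integrable_subset)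
  have absg: "set_integrable lborel {x..y} (\<lambda>x. \<bar>g x\<bar>)" if "a \<le> x" "y \<le> b" for x y
    using g[OF that] set_integrable_abs by blast
  \<comment> \<open>The inclusion in [a, b] is part of the claim because the induction runs over an
    arbitrary interval; around a point outside [a, b] the premise fails.\<close>
  have key: "a \<le> x \<and> y \<le> b \<longrightarrow>
      \<bar>F (f y) - F (f x) - (LBINT x:{x..y}. k x)\<bar> \<le> e * (LBINT x:{x..y}. \<bar>g x\<bar>)"
    if "e > 0" "x \<le> y" for e x y
    using \<open>x \<le> y\<close>
  proof (induction x y rule: Bolzano)
    case (trans x y z)
    show ?case
    proof
      assume A: "a \<le> x \<and> z \<le> b"
      have 1: "(LBINT x:{x..z}. k x) = (LBINT x:{x..y}. k x) + (LBINT x:{y..z}. k x)"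
        by (intro set_integral_Icc_combine k) (use A trans in auto)
      have 2: "(LBINT x:{x..z}. \<bar>g x\<bar>) = (LBINT x:{x..y}. \<bar>g x\<bar>) + (LBINT x:{y..z}. \<bar>g x\<bar>)"
        by (intro set_integral_Icc_combine absg) (use A trans in auto)
      show "\<bar>F (f z) - F (f x) - (LBINT x:{x..z}. k x)\<bar> \<le> e * (LBINT x:{x..z}. \<bar>g x\<bar>)"
        using trans A unfolding 1 2 by (auto simp: distrib_left)
    qed
  next
    case (local z)
    show ?case
    proof (cases "z \<in> {a..b}")
      case False
      then consider "z < a" | "z > b" by force
      then show ?thesis
      proof cases
        case 1
        then show ?thesis by (intro exI[of _ "a - z"]) auto
      next
        case 2
        then show ?thesis by (intro exI[of _ "z - b"]) auto
      qed
    next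
      case True
      have "isCont F' (f z)"
        using F' by (simp add: continuous_on_eq_continuous_at)
      then obtain \<eta> where \<eta>: "\<eta> > 0" "\<And>s. \<bar>s - f z\<bar> < \<eta> \<Longrightarrow> \<bar>F' s - F' (f z)\<bar> < e / 2"
        using \<open>e > 0\<close> unfolding continuous_at_real_range real_norm_def by (metis half_gt_zero)
      obtain d where d: "d > 0" "\<And>x. x \<in> {a..b} \<Longrightarrow> \<bar>x - z\<bar> < d \<Longrightarrow> \<bar>f x - f z\<bar> < \<eta>"
        using cf True \<eta>(1) unfolding continuous_on_iff dist_real_def by blast
      show ?thesis
      proof (intro exI[of _ d] conjI d(1) allI impI)
        fix x y assume A: "x \<le> z \<and> z \<le> y \<and> y - x < d" and B: "a \<le> x \<and> y \<le> b"
        have fx: "\<bar>f s - f z\<bar> < \<eta>" if "s \<in> {x..y}" for s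
          by (rule d(2)) (use that A B in auto)
        \<comment> \<open>\<open>\<xi>\<close> lies between \<open>f x\<close> and
          \<open>f y\<close>, hence is as close to \<open>f z\<close> as they are. The order of the
          two values is unknown, which makes three cases.\<close>
        obtain \<xi> where \<xi>: "\<bar>\<xi> - f z\<bar> < \<eta>" "F (f y) - F (f x) = F' \<xi> * (f y - f x)"
        proof -
          consider "f x < f y" | "f x = f y" | "f y < f x" by linarith
          then show ?thesis
          proof cases
            case 1
            obtain s where "s > f x" "s < f y" "F (f y) - F (f x) = (f y - f x) * F' s"
              using MVT2[OF 1 F] by blast
            then show ?thesis
              using fx[of x] fx[of y] A by (intro that[of s]) auto
          next
            case 2
            then show ?thesis using fx[of x] A by (intro that[of "f x"]) auto
          next
            case 3
            obtain s where "s > f y" "s < f x" "F (f x) - F (f y) = (f x - f y) * F' s"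
              using MVT2[OF 3 F] by blast
            then show ?thesis
              using fx[of x] fx[of y] A by (intro that[of s]) (auto simp: algebra_simps)
          qed
        qed
        have fg: "f y - f x = (LBINT s:{x..y}. g s)"
          by (rule primitive_onD(2)[OF f]) (use A B sub in auto)
        have "F (f y) - F (f x) - (LBINT s:{x..y}. k s) = (LBINT s:{x..y}. F' \<xi> * g s - k s)"
          unfolding \<xi>(2) fg using g[of x y] k[of x y] B by (subst set_integral_diff) auto
        also have "\<bar>\<dots>\<bar> \<le> (LBINT s:{x..y}. \<bar>F' \<xi> * g s - k s\<bar>)"
          unfolding real_norm_def[symmetric]
          by (rule set_integral_norm_bound) (use g[of x y] k[of x y] B in \<open>auto intro!: set_integral_diff\<close>)
        also have "\<dots> \<le> (LBINT s:{x..y}. e * \<bar>g s\<bar>)"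
        proof (rule set_integral_mono)
          show "set_integrable lborel {x..y} (\<lambda>s. \<bar>F' \<xi> * g s - k s\<bar>)"
            using g[of x y] k[of x y] B by (auto intro!: set_integrable_abs set_integral_diff)
          show "set_integrable lborel {x..y} (\<lambda>s. e * \<bar>g s\<bar>)"
            using absg[of x y] B by auto
          fix s assume s: "s \<in> {x..y}"
          have "\<bar>F' \<xi> - F' (f s)\<bar> \<le> e"
            using \<eta>(2)[OF \<xi>(1)] \<eta>(2)[OF fx[OF s]] by linarith
          then show "\<bar>F' \<xi> * g s - k s\<bar> \<le> e * \<bar>g s\<bar>"
            unfolding k_def left_diff_distrib[symmetric] abs_mult by (rule mult_right_mono) auto
        qed
        finally show "\<bar>F (f y) - F (f x) - (LBINT x:{x..y}. k x)\<bar> \<le> e * (LBINT x:{x..y}. \<bar>g x\<bar>)"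
          by simp
      qed
    qed
  qed
  define m where "m = (LBINT x:{a..b}. \<bar>g x\<bar>)"
  have "\<bar>F (f b) - F (f a) - (LBINT x:{a..b}. k x)\<bar> \<le> 0 + e" if "e > 0" for e
  proof -
    have m0: "m \<ge> 0"
      unfolding m_def set_lebesgue_integral_def by (rule Bochner_Integration.integral_nonneg) auto
    have "\<bar>F (f b) - F (f a) - (LBINT x:{a..b}. k x)\<bar> \<le> e / (m + 1) * m"
      using key[of "e / (m + 1)" a b] that ab m0 unfolding m_def by auto
    also have "\<dots> \<le> e"
      using m0 that by (simp add: field_simps)
    finally show ?thesis by simp
  qed
  then have "\<bar>F (f b) - F (f a) - (LBINT x:{a..b}. k x)\<bar> \<le> 0"
    by (rule field_le_epsilon)
  then show "set_integrable lborel {a..b} (\<lambda>x. F' (f x) * g x) \<and>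
      F (f b) - F (f a) = (LBINT x:{a..b}. F' (f x) * g x)"
    using k[of a b] unfolding k_def by auto
qed

text \<open>Polarization: a product is a difference of two squares, so the chain rule for the square
  suffices.\<close>

lemma primitive_on_mult:
  assumes f: "primitive_on I f g" and k: "primitive_on I k l" and I: "is_interval I"
  shows "primitive_on I (\<lambda>x. f x * k x) (\<lambda>x. g x * k x + f x * l x)"
proof -
  have sq: "primitive_on I (\<lambda>x. (h x)\<^sup>2 / 4) (\<lambda>x. h x / 2 * h' x)" if "primitive_on I h h'" for h h'
    by (rule primitive_on_chain[OF that I])
       (auto intro!: derivative_eq_intros continuous_intros)
  have eq: "(\<lambda>x. f x * k x) = (\<lambda>x. (f x + k x)\<^sup>2 / 4 - (f x - k x)\<^sup>2 / 4)"
    "(\<lambda>x. g x * k x + f x * l x) =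
      (\<lambda>x. (f x + k x) / 2 * (g x + l x) - (f x - k x) / 2 * (g x - l x))"
    by (auto simp: fun_eq_iff field_simps power2_eq_square)
  show ?thesis
    unfolding eq
    by (rule primitive_on_diff[OF sq[OF primitive_on_add[OF f k]] sq[OF primitive_on_diff[OF f k]]])
qed

text \<open>The positive and negative parts of \<open>h\<close> are densities of two measures with
  equal finite values on all half-lines. Such measures coincide, and then so do their
  densities.\<close>

lemma AE_zero_of_half_line_integrals:
  fixes h :: "real \<Rightarrow> real"
  assumes h: "integrable lborel h" and 0: "\<And>c. (\<integral>x. h x * indicator {c<..} x \<partial>lborel) = 0"
  shows "AE x in lborel. h x = 0"
proof -
  have [measurable]: "h \<in> borel_measurable borel"
    using h by auto
  \<comment> \<open>\<open>ennreal\<close> sends negative reals to 0, so these are already the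
    positive and negative parts.\<close>
  let ?p = "\<lambda>x. ennreal (h x)" and ?m = "\<lambda>x. ennreal (- h x)"
  have int: "integrable lborel (\<lambda>x. max 0 (h x) * indicator {c<..} x)"
    "integrable lborel (\<lambda>x. max 0 (- h x) * indicator {c<..} x)" for c
    by (rule Bochner_Integration.integrable_bound[OF h]; force simp: indicator_def)+
  have *: "emeasure (density lborel ?p) {c<..} = emeasure (density lborel ?m) {c<..}
     \<and> emeasure (density lborel ?p) {c<..} < \<infinity>" for c
  proof -
    have "(\<integral>x. max 0 (h x) * indicator {c<..} x \<partial>lborel) - (\<integral>x. max 0 (- h x) * indicator {c<..} x \<partial>lborel)
      = (\<integral>x. h x * indicator {c<..} x \<partial>lborel)"
      unfolding Bochner_Integration.integral_diff[OF int, symmetric]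
      by (rule Bochner_Integration.integral_cong) (auto simp: max_def)
    then have eq: "(\<integral>x. max 0 (h x) * indicator {c<..} x \<partial>lborel) = (\<integral>x. max 0 (- h x) * indicator {c<..} x \<partial>lborel)"
      using 0[of c] by simp
    have "emeasure (density lborel ?p) {c<..} = (\<integral>\<^sup>+x. ennreal (max 0 (h x) * indicator {c<..} x) \<partial>lborel)"
      by (subst emeasure_density) (auto intro!: nn_integral_cong simp: indicator_def max_def ennreal_neg)
    also have "\<dots> = ennreal (\<integral>x. max 0 (h x) * indicator {c<..} x \<partial>lborel)"
      by (rule nn_integral_eq_integral[OF int(1)]) auto
    finally have 1: "emeasure (density lborel ?p) {c<..} = ennreal (\<integral>x. max 0 (h x) * indicator {c<..} x \<partial>lborel)" .
    have "emeasure (density lborel ?m) {c<..} = (\<integral>\<^sup>+x. ennreal (max 0 (- h x) * indicator {c<..} x) \<partial>lborel)"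
      by (subst emeasure_density) (auto intro!: nn_integral_cong simp: indicator_def max_def ennreal_neg)
    also have "\<dots> = ennreal (\<integral>x. max 0 (- h x) * indicator {c<..} x \<partial>lborel)"
      by (rule nn_integral_eq_integral[OF int(2)]) auto
    finally show ?thesis
      using 1 eq by simp
  qed
  have "density lborel ?p = density lborel ?m"
  proof (rule measure_eqI_lessThan)
    show "emeasure (density lborel ?p) {c<..} < \<infinity>" for c
      using * by blast
    show "emeasure (density lborel ?p) {c<..} = emeasure (density lborel ?m) {c<..}" for c
      using * by blast
  qed auto
  then have "AE x in lborel. ?p x = ?m x"
    by (intro sigma_finite_measure.density_unique[OF sigma_finite_lborel]) auto
  then show ?thesis
  proof eventually_elim
    case (elim x)
    then show ?case
      by (cases "h x \<ge> 0") (auto simp: ennreal_neg ennreal_eq_0_iff dest!: sym[of 0])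
  qed
qed

text \<open>The difference of the densities has integral 0 over every compact subinterval, hence
  vanishes almost everywhere there. Intervals with rational ends give one null set for all of them,
  and since \<open>I\<close> is open each of its points lies inside such an interval.\<close>

lemma primitive_on_unique:
  assumes f: "primitive_on I f g" and f': "primitive_on I f g'" and I: "is_interval I" "open I"
  shows "AE x in lborel. x \<in> I \<longrightarrow> g x = g' x"
proof -
  have d: "primitive_on I (\<lambda>x. 0) (\<lambda>x. g x - g' x)"
    using primitive_on_diff[OF f f'] by simp
  have 1: "AE x in lborel. x \<in> {a..b} \<longrightarrow> g x = g' x" if ab: "a \<in> I" "b \<in> I" "a \<le> b" for a b
  proof -
    define h where "h x = indicator {a..b} x * (g x - g' x)" for x
    have sub: "{a..b} \<subseteq> I"
      using mem_is_interval_1_I[OF I(1) ab(1,2)] by auto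
    have "integrable lborel h"
      using primitive_onD(1)[OF d ab] unfolding h_def set_integrable_def by simp
    moreover have "(\<integral>x. h x * indicator {c<..} x \<partial>lborel) = 0" for c
    proof (cases "c \<ge> b")
      case True
      then have "(\<lambda>x. h x * indicator {c<..} x) = (\<lambda>x. 0)"
        by (auto simp: fun_eq_iff h_def indicator_def)
      then show ?thesis by simp
    next
      case False
      have "(\<integral>x. h x * indicator {c<..} x \<partial>lborel) = (LBINT x:{max a c..b}. g x - g' x)"
        unfolding set_lebesgue_integral_def
      proof (rule integral_cong_AE)
        show "AE x in lborel. h x * indicator {c<..} x = indicator {max a c..b} x *\<^sub>R (g x - g' x)"
          using AE_lborel_singleton[of c]
          by eventually_elim (auto simp: h_def indicator_def)
        have "set_integrable lborel {max a c..b} (\<lambda>x. g x - g' x)"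
          by (rule primitive_onD(1)[OF d]) (use ab sub False in auto)
        then show "(\<lambda>x. indicator {max a c..b} x *\<^sub>R (g x - g' x)) \<in> borel_measurable lborel"
          unfolding set_integrable_def by (rule borel_measurable_integrable)
        show "(\<lambda>x. h x * indicator {c<..} x) \<in> borel_measurable lborel"
          using \<open>integrable lborel h\<close> by measurable
      qed
      also have "\<dots> = 0"
        using primitive_onD(2)[OF d, of "max a c" b] subsetD[OF sub, of "max a c"] ab False by auto
      finally show ?thesis .
    qed
    ultimately have "AE x in lborel. h x = 0"
      by (rule AE_zero_of_half_line_integrals)
    then show ?thesis
      by eventually_elim (auto simp: h_def)
  qed
  have "AE x in lborel. \<forall>p\<in>\<rat> \<times> \<rat>. fst p \<in> I \<and> snd p \<in> I \<and> fst p \<le> snd p \<longrightarrow>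
      x \<in> {fst p..snd p} \<longrightarrow> g x = g' x"
  proof (subst AE_ball_countable)
    show "countable (\<rat> \<times> (\<rat> :: real set))"
      by (intro countable_SIGMA countable_rat)
    show "\<forall>p\<in>\<rat> \<times> \<rat>. AE x in lborel. fst p \<in> I \<and> snd p \<in> I \<and> fst p \<le> snd p \<longrightarrow>
      x \<in> {fst p..snd p} \<longrightarrow> g x = g' x"
      using 1 by auto
  qed
  then show ?thesis
  proof (eventually_elim, intro impI)
    fix x assume A: "\<forall>p\<in>\<rat> \<times> \<rat>. fst p \<in> I \<and> snd p \<in> I \<and> fst p \<le> snd p \<longrightarrow>
      x \<in> {fst p..snd p} \<longrightarrow> g x = g' x" and x: "x \<in> I"
    obtain e where e: "e > 0" "\<And>y. dist y x < e \<Longrightarrow> y \<in> I"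
      using I(2) x unfolding open_dist by blast
    obtain p where p: "p \<in> \<rat>" "x - e < p" "p < x"
      using Rats_dense_in_real[of "x - e" x] e by auto
    obtain q where q: "q \<in> \<rat>" "x < q" "q < x + e"
      using Rats_dense_in_real[of x "x + e"] e by auto
    show "g x = g' x"
      using A[rule_format, of "(p, q)"] p q e(2)[of p] e(2)[of q] by (auto simp: dist_real_def)
  qed
qed

lemma integral_Icc_shift:
  fixes k :: "real \<Rightarrow> real"
  shows "(LBINT y:{x..x+h}. k y) = (\<integral>s. indicator {0..h} s * k (x + s) \<partial>lborel)"
  unfolding set_lebesgue_integral_def
  by (subst lborel_integral_real_affine[of 1 _ x])
     (auto intro!: Bochner_Integration.integral_cong simp: indicator_def)

text \<open>Translation invariance: the integral of \<open>x \<mapsto> k (x + 1) - k x\<close> vanishes, and it is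
  the average over \<open>s \<in> [0, 1]\<close> of the integrals of \<open>x \<mapsto> k' (x + s)\<close>.\<close>

lemma integral_derivative_zero:
  assumes k: "primitive_on UNIV k k'" and ik: "integrable lborel k" and ik': "integrable lborel k'"
  shows "(\<integral>x. k' x \<partial>lborel) = 0"
proof -
  have [measurable]: "k \<in> borel_measurable borel" "k' \<in> borel_measurable borel"
    using ik ik' by auto
  have sh: "integrable lborel (\<lambda>x. f (x + s))" "(\<integral>x. f (x + s) \<partial>lborel) = (\<integral>x. f x \<partial>lborel)"
    if "integrable lborel f" for f :: "real \<Rightarrow> real" and s
    using lborel_integrable_real_affine[OF that, of 1 s] lborel_integral_real_affine[of 1 f s]
    by (simp_all add: add.commute)
  let ?f = "\<lambda>s x. indicator {0..1} s * k' (x + s)"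
  have int: "integrable (lborel \<Otimes>\<^sub>M lborel) (\<lambda>(s, x). ?f s x)"
  proof (rule lborel_pair.Fubini_integrable)
    show "(\<lambda>(s, x). ?f s x) \<in> borel_measurable (lborel \<Otimes>\<^sub>M lborel)"
      by measurable
    have "(\<integral>x. norm (?f s x) \<partial>lborel) = indicator {0..1} s * (\<integral>x. norm (k' x) \<partial>lborel)" for s
      using sh(2)[OF integrable_norm[OF ik'], of s] by (simp add: abs_mult)
    moreover have "integrable lborel (\<lambda>s. indicator {0..1::real} s * (\<integral>x. norm (k' x) \<partial>lborel))"
      by (intro integrable_mult_left) (auto simp: integrable_indicator_iff)
    ultimately show "integrable lborel (\<lambda>s. \<integral>x. norm (case (s, x) of (s, x) \<Rightarrow> ?f s x) \<partial>lborel)"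
      by simp
    show "AE s in lborel. integrable lborel (\<lambda>x. case (s, x) of (s, x) \<Rightarrow> ?f s x)"
      using sh(1)[OF ik'] by auto
  qed
  have "0 = (\<integral>x. k (x + 1) - k x \<partial>lborel)"
    using sh[OF ik, of 1] ik by simp
  also have "\<dots> = (\<integral>x. (\<integral>s. ?f s x \<partial>lborel) \<partial>lborel)"
    by (intro Bochner_Integration.integral_cong)
       (auto simp: primitive_onD(2)[OF k] integral_Icc_shift)
  also have "\<dots> = (\<integral>s. (\<integral>x. ?f s x \<partial>lborel) \<partial>lborel)"
    by (rule lborel_pair.Fubini_integral[OF int])
  also have "\<dots> = (\<integral>s. indicator {0..1::real} s * (\<integral>x. k' x \<partial>lborel) \<partial>lborel)"
    by (simp add: sh(2)[OF ik'])
  also have "\<dots> = (\<integral>x. k' x \<partial>lborel)"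
    by simp
  finally show ?thesis by simp
qed

text \<open>Integrability of the product takes the place of boundary terms at infinity.\<close>

lemma integration_by_parts_line:
  assumes f: "primitive_on UNIV f f'" and g: "primitive_on UNIV g g'"
    and "integrable lborel (\<lambda>x. f x * g x)"
    and i: "integrable lborel (\<lambda>x. f' x * g x)" "integrable lborel (\<lambda>x. f x * g' x)"
  shows "(\<integral>x. f x * g' x \<partial>lborel) = - (\<integral>x. f' x * g x \<partial>lborel)"
proof -
  have "(\<integral>x. f' x * g x + f x * g' x \<partial>lborel) = 0"
    by (rule integral_derivative_zero[OF primitive_on_mult[OF f g]]) (use assms in auto)
  then show ?thesis
    using i by simp
qed

section \<open>Smooth steps and bump functions\<close>

text \<open>A piecewise quadratic \<open>C^1\<close> step from 0 to 1 across [0, 1]. Test functions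
  need only be \<open>C^1\<close>, so it can do the work of a mollifier; its derivative
  \<open>tent\<close> is the hat of height 2 and integral 1.\<close>

definition smooth_step :: "real \<Rightarrow> real" where
  "smooth_step x = 2 * (max 0 x)\<^sup>2 - 4 * (max 0 (x - 1/2))\<^sup>2 + 2 * (max 0 (x - 1))\<^sup>2"

definition tent :: "real \<Rightarrow> real" where
  "tent x = 4 * max 0 x - 8 * max 0 (x - 1/2) + 4 * max 0 (x - 1)"

lemma DERIV_max_0_square: "((\<lambda>x. (max 0 x)\<^sup>2) has_real_derivative 2 * max 0 x) (at x)" for x :: real
proof -
  consider "x < 0" | "x = 0" | "x > 0" by linarith
  then show ?thesis
  proof cases
    case 1
    have "((\<lambda>_. 0) has_real_derivative 0) (at x)" by simp
    then have "((\<lambda>x. (max 0 x)\<^sup>2) has_real_derivative 0) (at x)"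
      by (rule has_field_derivative_transform_within_open[of _ _ _ "{..<0}"]) (use 1 in auto)
    then show ?thesis using 1 by simp
  next
    case 2
    have "((\<lambda>h. (max 0 h)\<^sup>2 / h) \<longlongrightarrow> 0) (at (0::real))"
    proof (rule Lim_null_comparison)
      show "\<forall>\<^sub>F h in at (0::real). norm ((max 0 h)\<^sup>2 / h) \<le> \<bar>h\<bar>"
        by (auto simp: eventually_at_filter power2_eq_square max_def)
      show "((\<lambda>h::real. \<bar>h\<bar>) \<longlongrightarrow> 0) (at 0)"
        by (rule tendsto_rabs_zero) simp
    qed
    then show ?thesis
      using 2 by (simp add: DERIV_def)
  next
    case 3
    have "((\<lambda>x. x\<^sup>2) has_real_derivative 2 * x) (at x)"
      by (auto intro!: derivative_eq_intros)
    then have "((\<lambda>x. (max 0 x)\<^sup>2) has_real_derivative 2 * x) (at x)"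
      by (rule has_field_derivative_transform_within_open[of _ _ _ "{0<..}"]) (use 3 in auto)
    then show ?thesis using 3 by simp
  qed
qed

lemma DERIV_smooth_step: "(smooth_step has_real_derivative tent x) (at x)"
proof -
  have 1: "((\<lambda>x. (max 0 (x - c))\<^sup>2) has_real_derivative 2 * max 0 (x - c)) (at x)" for c
    using DERIV_shift[of "\<lambda>x. (max 0 x)\<^sup>2" _ x "- c"] DERIV_max_0_square[of "x - c"] by simp
  have "(smooth_step has_real_derivative
     2 * (2 * max 0 x) - 4 * (2 * max 0 (x - 1/2)) + 2 * (2 * max 0 (x - 1))) (at x)"
    unfolding smooth_step_def[abs_def]
    by (intro DERIV_add DERIV_diff DERIV_cmult 1 DERIV_max_0_square)
  then show ?thesis
    by (simp add: tent_def)
qed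

lemma smooth_step_eq_0: "x \<le> 0 \<Longrightarrow> smooth_step x = 0"
  by (simp add: smooth_step_def)

lemma smooth_step_eq_1: "1 \<le> x \<Longrightarrow> smooth_step x = 1"
  by (simp add: smooth_step_def max_def power2_eq_square algebra_simps)

lemma tent_nonneg: "0 \<le> tent x"
  by (auto simp: tent_def max_def)

lemma tent_eq_0: "x \<notin> {0..1} \<Longrightarrow> tent x = 0"
  by (auto simp: tent_def max_def)

lemma tent_le: "tent x \<le> 2"
  by (auto simp: tent_def max_def)

lemma continuous_tent: "continuous_on A tent"
  unfolding tent_def by (intro continuous_intros)

lemma smooth_step_mono: "x \<le> y \<Longrightarrow> smooth_step x \<le> smooth_step y"
  by (rule DERIV_nonneg_imp_nondecreasing[of x y smooth_step])
    (use DERIV_smooth_step tent_nonneg in blast)+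

lemma smooth_step_range: "0 \<le> smooth_step x" "smooth_step x \<le> 1"
  using smooth_step_mono[of "min x 0" x] smooth_step_mono[of x "max x 1"]
  by (auto simp: smooth_step_eq_0 smooth_step_eq_1)

definition tent_kernel :: "real \<Rightarrow> real \<Rightarrow> real \<Rightarrow> real" where
  "tent_kernel n a x = n * tent (n * (x - a))"

text \<open>A \<open>C^1\<close> approximation of the indicator of (a, b], supported in
  [a, b + 1/n]. Its derivative is a difference of two kernels that concentrate at \<open>a\<close>
  and \<open>b\<close>.\<close>

definition bump :: "real \<Rightarrow> real \<Rightarrow> real \<Rightarrow> real \<Rightarrow> real" where
  "bump n a b x = smooth_step (n * (x - a)) - smooth_step (n * (x - b))"

lemma DERIV_step_scaled: "((\<lambda>x. smooth_step (n * (x - a))) has_real_derivative tent_kernel n a x) (at x)"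
proof -
  have "((\<lambda>x. n * (x - a)) has_real_derivative n) (at x)"
    by (auto intro!: derivative_eq_intros)
  from DERIV_chain2[OF DERIV_smooth_step this] show ?thesis
    by (simp add: tent_kernel_def mult.commute)
qed

lemma DERIV_bump: "(bump n a b has_real_derivative tent_kernel n a x - tent_kernel n b x) (at x)"
  unfolding bump_def[abs_def] by (intro DERIV_diff DERIV_step_scaled)

lemma continuous_tent_kernel: "continuous_on A (tent_kernel n a)"
  unfolding tent_kernel_def
  by (intro continuous_intros continuous_on_compose2[OF continuous_tent[of UNIV]]) auto

lemma continuous_bump: "continuous_on A (bump n a b)"
  by (rule continuous_at_imp_continuous_on) (blast intro: DERIV_isCont DERIV_bump)

lemma borel_measurable_bump [measurable]: "bump n a b \<in> borel_measurable borel"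
  by (rule borel_measurable_continuous_onI continuous_bump)+

lemma borel_measurable_tent_kernel [measurable]: "tent_kernel n a \<in> borel_measurable borel"
  by (rule borel_measurable_continuous_onI continuous_tent_kernel)+

lemma tent_kernel_nonneg: "n \<ge> 0 \<Longrightarrow> 0 \<le> tent_kernel n a x"
  by (simp add: tent_kernel_def tent_nonneg)

lemma tent_kernel_eq_0: "n > 0 \<Longrightarrow> x \<notin> {a..a + 1/n} \<Longrightarrow> tent_kernel n a x = 0"
  by (auto simp: tent_kernel_def field_simps intro!: tent_eq_0)

lemma bump_eq_0:
  assumes "n > 0" "a \<le> b" "x \<notin> {a..b + 1/n}"
  shows "bump n a b x = 0"
proof (cases "x < a")
  case True
  then show ?thesis
    using assms by (simp add: bump_def smooth_step_eq_0 mult_nonneg_nonpos)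
next
  case False
  then have "n * (x - b) \<ge> 1"
    using assms by (auto simp: field_simps)
  moreover have "n * (x - a) \<ge> n * (x - b)"
    using assms by simp
  ultimately show ?thesis
    by (simp add: bump_def smooth_step_eq_1)
qed

lemma bump_range:
  assumes "n > 0" "a \<le> b"
  shows "0 \<le> bump n a b x" "bump n a b x \<le> 1"
  using smooth_step_mono[of "n * (x - b)" "n * (x - a)"] smooth_step_range[of "n * (x - a)"]
    smooth_step_range[of "n * (x - b)"] assms
  by (auto simp: bump_def)

lemma tent_kernel_diff_eq_0:
  assumes "n > 0" "a \<le> b" "x \<notin> {a..b + 1/n}"
  shows "tent_kernel n a x - tent_kernel n b x = 0"
  using assms tent_kernel_eq_0[of n x a] tent_kernel_eq_0[of n x b] by auto

lemma abs_tent_kernel_diff_le: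
  assumes "n \<ge> 0"
  shows "\<bar>tent_kernel n a x - tent_kernel n b x\<bar> \<le> 4 * n"
proof -
  have "0 \<le> tent_kernel n c x \<and> tent_kernel n c x \<le> 2 * n" for c
    using assms tent_le[of "n * (x - c)"] tent_nonneg[of "n * (x - c)"]
    by (simp add: tent_kernel_def mult.commute mult_left_mono)
  from this[of a] this[of b] show ?thesis by auto
qed

lemma bump_limit:
  assumes "a \<le> b"
  shows "(\<lambda>n. bump (real n) a b x) \<longlonglongrightarrow> indicator {a<..b} x"
proof -
  have 1: "(\<lambda>n. smooth_step (real n * (x - c))) \<longlonglongrightarrow> indicator {c<..} x" for c
  proof (cases "x \<le> c")
    case True
    then have "smooth_step (real n * (x - c)) = 0" for n
      by (intro smooth_step_eq_0) (simp add: mult_nonneg_nonpos)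
    then show ?thesis using True by simp
  next
    case False
    obtain N :: nat where N: "real N \<ge> 1 / (x - c)"
      using real_arch_simple by blast
    have "\<forall>\<^sub>F n in sequentially. smooth_step (real n * (x - c)) = 1"
      using eventually_ge_at_top[of N]
    proof eventually_elim
      case (elim n)
      then have "real n \<ge> 1 / (x - c)" using N by linarith
      then show ?case using False by (intro smooth_step_eq_1) (simp add: field_simps)
    qed
    then show ?thesis using False by (simp add: tendsto_eventually)
  qed
  have "(\<lambda>n. bump (real n) a b x) \<longlonglongrightarrow> indicator {a<..} x - indicator {b<..} x"
    unfolding bump_def by (intro tendsto_diff 1)
  also have "indicator {a<..} x - indicator {b<..} x = (indicator {a<..b} x :: real)"
    using assms by (auto simp: indicator_def)
  finally show ?thesis .
qed

lemma tent_kernel_has_integral_1: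
  assumes "n > 0"
  shows "has_bochner_integral lborel (tent_kernel n a) 1"
proof -
  have "has_bochner_integral lborel (\<lambda>x. tent_kernel n a x * indicator {a..a+1/n} x)
     (smooth_step (n * (a + 1/n - a)) - smooth_step (n * (a - a)))"
    using assms continuous_tent_kernel[of UNIV n a]
    by (intro has_bochner_integral_FTC_Icc_real DERIV_step_scaled)
       (auto simp: continuous_on_eq_continuous_at)
  also have "(\<lambda>x. tent_kernel n a x * indicator {a..a+1/n} x) = tent_kernel n a"
    using tent_kernel_eq_0[OF assms] by (force simp: indicator_def)
  finally show ?thesis
    using assms by (simp add: smooth_step_eq_0 smooth_step_eq_1)
qed

lemma tent_kernel_integrable_mult:
  assumes f: "continuous_on {a..a + 1/n} f" and n: "n > 0"
  shows "integrable lborel (\<lambda>x. f x * tent_kernel n a x)"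
proof -
  have "continuous_on {a..a + 1/n} (\<lambda>x. f x * tent_kernel n a x)"
    by (intro continuous_intros f continuous_tent_kernel)
  then have "set_integrable lborel {a..a+1/n} (\<lambda>x. f x * tent_kernel n a x)"
    by (rule borel_integrable_atLeastAtMost')
  moreover have "(\<lambda>x. indicator {a..a+1/n} x *\<^sub>R (f x * tent_kernel n a x)) = (\<lambda>x. f x * tent_kernel n a x)"
    using tent_kernel_eq_0[OF n] by (force simp: indicator_def)
  ultimately show ?thesis
    by (simp add: set_integrable_def)
qed

text \<open>A one-sided approximate identity: the kernel lives on [a, a + 1/n], so only values of
  \<open>f\<close> to the right of \<open>a\<close> enter.\<close>

lemma tent_kernel_limit:
  assumes f: "continuous_on {a..a + 1/real N} f" and N: "N > 0"
  shows "(\<lambda>n. \<integral>x. f x * tent_kernel (real n) a x \<partial>lborel) \<longlonglongrightarrow> f a"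
proof (rule LIMSEQ_I)
  fix e :: real assume "e > 0"
  then obtain d where d: "d > 0" "\<And>x. x \<in> {a..a + 1/real N} \<Longrightarrow> dist x a < d \<Longrightarrow> dist (f x) (f a) < e / 2"
    using f N unfolding continuous_on_iff by (metis atLeastAtMost_iff half_gt_zero le_add_same_cancel1 of_nat_0_le_iff order_refl zero_le_divide_1_iff)
  obtain M :: nat where M: "real M > 1/d"
    using reals_Archimedean2 by blast
  show "\<exists>no. \<forall>n\<ge>no. norm ((\<integral>x. f x * tent_kernel (real n) a x \<partial>lborel) - f a) < e"
  proof (intro exI[of _ "max N M"] allI impI)
    fix n assume n: "n \<ge> max N M"
    then have n0: "real n > 0" and nN: "1/real n \<le> 1/real N"
      using N by (auto simp: frac_le)
    have "1/d < real n" using n M by auto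
    then have nd: "1/real n < d"
      using d(1) n0 by (simp add: field_simps)
    note K = tent_kernel_has_integral_1[OF n0, of a]
    have i1: "integrable lborel (\<lambda>x. f x * tent_kernel (real n) a x)"
      by (rule tent_kernel_integrable_mult[OF _ n0]) (rule continuous_on_subset[OF f], use nN in auto)
    have i2: "integrable lborel (\<lambda>x. c * tent_kernel (real n) a x)" for c
      using K by (auto simp: has_bochner_integral_iff)
    have "(\<integral>x. f x * tent_kernel (real n) a x \<partial>lborel) - f a
      = (\<integral>x. f x * tent_kernel (real n) a x - f a * tent_kernel (real n) a x \<partial>lborel)"
      using i1 i2[of "f a"] K by (simp add: has_bochner_integral_iff)
    also have "norm \<dots> \<le> (\<integral>x. norm (f x * tent_kernel (real n) a x - f a * tent_kernel (real n) a x) \<partial>lborel)"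
      by (rule integral_norm_bound)
    also have "\<dots> \<le> (\<integral>x. e/2 * tent_kernel (real n) a x \<partial>lborel)"
    proof (rule integral_mono)
      show "integrable lborel (\<lambda>x. norm (f x * tent_kernel (real n) a x - f a * tent_kernel (real n) a x))"
        using i1 i2[of "f a"] by auto
      show "integrable lborel (\<lambda>x. e/2 * tent_kernel (real n) a x)" by (rule i2)
      fix x
      show "norm (f x * tent_kernel (real n) a x - f a * tent_kernel (real n) a x) \<le> e/2 * tent_kernel (real n) a x"
      proof (cases "x \<in> {a..a+1/real n}")
        case True
        then have "\<bar>f x - f a\<bar> \<le> e/2"
          using d(2)[of x] nd nN by (auto simp: dist_real_def)
        then show ?thesis
          unfolding left_diff_distrib[symmetric] real_norm_def abs_mult
            abs_of_nonneg[OF tent_kernel_nonneg[OF less_imp_le[OF n0]]]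
          by (intro mult_right_mono tent_kernel_nonneg) (use n0 in auto)
      next
        case False
        then show ?thesis using tent_kernel_eq_0[OF n0] by auto
      qed
    qed
    also have "\<dots> = e/2"
      using K by (simp add: has_bochner_integral_iff)
    finally show "norm ((\<integral>x. f x * tent_kernel (real n) a x \<partial>lborel) - f a) < e"
      using \<open>e > 0\<close> by simp
  qed
qed

section \<open>Recognizing primitives by bump tests\<close>

lemma primitive_on_exists:
  assumes I: "is_interval I"
    and g: "\<And>a b. a \<in> I \<Longrightarrow> b \<in> I \<Longrightarrow> a \<le> b \<Longrightarrow> set_integrable lborel {a..b} g"
  shows "\<exists>G. primitive_on I G g"
proof (cases "I = {}")
  case True
  then show ?thesis by (auto simp: primitive_on_def)
next
  case False
  then obtain c where c: "c \<in> I" by blast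
  define G where "G x = (if c \<le> x then (LBINT s:{c..x}. g s) else - (LBINT s:{x..c}. g s))" for x
  have "primitive_on I G g"
    unfolding primitive_on_def
  proof (intro ballI impI conjI)
    fix a b assume ab: "a \<in> I" "b \<in> I" "a \<le> b"
    show "set_integrable lborel {a..b} g" using g ab by blast
    consider "c \<le> a" | "a < c" "c \<le> b" | "b < c" by linarith
    then show "G b - G a = (LBINT x:{a..b}. g x)"
    proof cases
      case 1
      then show ?thesis
        using set_integral_Icc_combine[of c a b g] g[of c b] c ab by (simp add: G_def)
    next
      case 2
      then show ?thesis
        using set_integral_Icc_combine[of a c b g] g[of a b] c ab by (simp add: G_def)
    next
      case 3
      then show ?thesis
        using set_integral_Icc_combine[of a b c g] g[of a c] c ab by (simp add: G_def)
    qed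
  qed
  then show ?thesis by blast
qed

lemma primitive_on_continuous_open:
  assumes "primitive_on I f g" "is_interval I" "open I"
  shows "continuous_on I f"
proof (rule continuous_at_imp_continuous_on, rule ballI)
  fix x assume "x \<in> I"
  then obtain e where e: "e > 0" "\<And>y. dist y x < e \<Longrightarrow> y \<in> I"
    using assms(3) unfolding open_dist by blast
  have "continuous_on {x - e/2..x + e/2} f"
    by (rule primitive_on_continuous[OF assms(1,2)]) (use e in \<open>auto simp: dist_real_def\<close>)
  then have "continuous_on {x - e/2<..<x + e/2} f"
    by (rule continuous_on_subset) auto
  then show "isCont f x"
    using e(1) by (subst (asm) continuous_on_eq_continuous_at) auto
qed

text \<open>As \<open>n\<close> grows, the kernels evaluate \<open>f\<close> at the ends and the
  bumps become the indicator of (a, b], which yields the increment formula for rational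
  \<open>a\<close> and \<open>b\<close>. So \<open>f\<close> minus any primitive of \<open>g\<close>
  is continuous and constant on rationals, hence constant. Rational ends keep the family of tests
  countable, so that for slices a single null set serves all tests.\<close>

lemma primitive_on_bump_test:
  fixes f g :: "real \<Rightarrow> real"
  assumes I: "is_interval I" "open I" and f: "continuous_on I f"
    and g: "\<And>a b. a \<in> I \<Longrightarrow> b \<in> I \<Longrightarrow> a \<le> b \<Longrightarrow> set_integrable lborel {a..b} g"
    and test: "\<And>a b n. a \<in> \<rat> \<Longrightarrow> b \<in> \<rat> \<Longrightarrow> a \<in> I \<Longrightarrow> a \<le> b \<Longrightarrow> n > 0 \<Longrightarrow> b + 1 / real n \<in> I \<Longrightarrow>
      (\<integral>x. f x * (tent_kernel (real n) a x - tent_kernel (real n) b x) \<partial>lborel)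
        = - (\<integral>x. g x * bump (real n) a b x \<partial>lborel)"
  shows "primitive_on I f g"
proof -
  have rat: "f b - f a = (LBINT x:{a..b}. g x)"
    if ab: "a \<in> \<rat>" "b \<in> \<rat>" "a \<in> I" "b \<in> I" "a \<le> b" for a b
  proof -
    obtain e where e: "e > 0" "\<And>y. dist y b < e \<Longrightarrow> y \<in> I"
      using I(2) ab unfolding open_dist by blast
    obtain N where N: "inverse (real (Suc N)) < e"
      using reals_Archimedean[OF e(1)] by blast
    \<comment> \<open>From index \<open>M\<close> on, the supports [a, b + 1/n] stay inside the open
      interval \<open>I\<close>.\<close>
    define M where "M = Suc N"
    have M0: "real M > 0" "M > 0" and bM: "b + 1 / real M \<in> I"
      using N e(2)[of "b + 1 / real M"] by (auto simp: M_def dist_real_def inverse_eq_divide)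
    have memI: "x \<in> I" if "a \<le> x" "x \<le> b + 1 / real M" for x
      using mem_is_interval_1_I[OF I(1) ab(3) bM] that by blast
    have nM: "1 / real n \<le> 1 / real M" if "n \<ge> M" for n
      using that M0 by (auto simp: frac_le)
    have lim: "(\<lambda>n. \<integral>x. f x * tent_kernel (real n) c x \<partial>lborel) \<longlonglongrightarrow> f c" if c: "c = a \<or> c = b" for c
      by (rule tent_kernel_limit[OF _ M0(2)], rule continuous_on_subset[OF f])
         (use c memI ab in auto)
    have int: "integrable lborel (\<lambda>x. f x * tent_kernel (real n) c x)"
      if c: "c = a \<or> c = b" and n: "n \<ge> M" for n c
    proof (rule tent_kernel_integrable_mult)
      show "continuous_on {c..c + 1 / real n} f"
        by (rule continuous_on_subset[OF f]) (use c ab nM[OF n] in \<open>auto intro!: memI\<close>)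
    qed (use n M0 in auto)
    have "(\<lambda>n. (\<integral>x. f x * tent_kernel (real n) a x \<partial>lborel) - (\<integral>x. f x * tent_kernel (real n) b x \<partial>lborel))
        \<longlonglongrightarrow> f a - f b"
      by (intro tendsto_diff lim) auto
    moreover have "\<forall>\<^sub>F n in sequentially. (\<integral>x. f x * tent_kernel (real n) a x \<partial>lborel)
        - (\<integral>x. f x * tent_kernel (real n) b x \<partial>lborel) = - (\<integral>x. g x * bump (real n) a b x \<partial>lborel)"
      using eventually_ge_at_top[of M]
    proof eventually_elim
      case (elim n)
      have "0 \<le> 1 / real n" by simp
      then have "b + 1 / real n \<in> I"
        using nM[OF elim] ab by (intro memI) linarith+
      then have "- (\<integral>x. g x * bump (real n) a b x \<partial>lborel)
        = (\<integral>x. f x * tent_kernel (real n) a x - f x * tent_kernel (real n) b x \<partial>lborel)"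
        using test[of a b n] ab elim M0 by (simp add: right_diff_distrib)
      then show ?case
        using int[OF _ elim] by simp
    qed
    ultimately have 1: "(\<lambda>n. - (\<integral>x. g x * bump (real n) a b x \<partial>lborel)) \<longlonglongrightarrow> f a - f b"
      by (rule Lim_transform_eventually)
    let ?J = "{a..b + 1 / real M}"
    have gJ: "integrable lborel (\<lambda>x. indicator ?J x * g x)"
      using g[OF ab(3) bM] ab(5) by (simp add: set_integrable_def add_increasing2)
    have "(\<lambda>n. \<integral>x. indicator ?J x * g x * bump (real n) a b x \<partial>lborel)
       \<longlonglongrightarrow> (\<integral>x. indicator ?J x * g x * indicator {a<..b} x \<partial>lborel)"
    proof (rule integral_dominated_convergence[where w = "\<lambda>x. norm (indicator ?J x * g x)"])
      show "integrable lborel (\<lambda>x. norm (indicator ?J x * g x))"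
        using gJ by (rule integrable_norm)
      show "(\<lambda>x. indicator ?J x * g x * indicator {a<..b} x) \<in> borel_measurable lborel"
        using borel_measurable_integrable[OF gJ] by measurable
      show "(\<lambda>x. indicator ?J x * g x * bump (real n) a b x) \<in> borel_measurable lborel" for n
        using borel_measurable_integrable[OF gJ] by measurable
      show "AE x in lborel. (\<lambda>n. indicator ?J x * g x * bump (real n) a b x)
          \<longlonglongrightarrow> indicator ?J x * g x * indicator {a<..b} x"
        by (intro AE_I2 tendsto_mult tendsto_const bump_limit ab)
      show "AE x in lborel. norm (indicator ?J x * g x * bump (real n) a b x) \<le> norm (indicator ?J x * g x)" for n
      proof (rule AE_I2)
        fix x
        have "\<bar>bump (real n) a b x\<bar> \<le> 1"
          using bump_range[of "real n" a b x] ab by (cases "n = 0") (auto simp: bump_def)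
        then show "norm (indicator ?J x * g x * bump (real n) a b x) \<le> norm (indicator ?J x * g x)"
          unfolding norm_mult by (intro mult_left_le) auto
      qed
    qed
    also have "(\<integral>x. indicator ?J x * g x * indicator {a<..b} x \<partial>lborel) = (LBINT x:{a..b}. g x)"
      unfolding set_lebesgue_integral_def
    proof (rule integral_cong_AE)
      show "(\<lambda>x. indicator ?J x * g x * indicator {a<..b} x) \<in> borel_measurable lborel"
        using borel_measurable_integrable[OF gJ] by measurable
      show "(\<lambda>x. indicator {a..b} x *\<^sub>R g x) \<in> borel_measurable lborel"
        using g[OF ab(3,4,5)] by (auto simp: set_integrable_def)
      show "AE x in lborel. indicator ?J x * g x * indicator {a<..b} x = indicator {a..b} x *\<^sub>R g x"
        using AE_lborel_singleton[of a] by eventually_elim (auto simp: indicator_def add_increasing2)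
    qed
    finally have "(\<lambda>n. \<integral>x. indicator ?J x * g x * bump (real n) a b x \<partial>lborel)
       \<longlonglongrightarrow> (LBINT x:{a..b}. g x)" .
    moreover have "\<forall>\<^sub>F n in sequentially. (\<integral>x. indicator ?J x * g x * bump (real n) a b x \<partial>lborel)
       = (\<integral>x. g x * bump (real n) a b x \<partial>lborel)"
      using eventually_ge_at_top[of M]
    proof eventually_elim
      case (elim n)
      have "indicator ?J x * g x * bump (real n) a b x = g x * bump (real n) a b x" for x
      proof (cases "x \<in> ?J")
        case False
        then have "bump (real n) a b x = 0"
          using nM[OF elim] elim M0 ab by (intro bump_eq_0) auto
        then show ?thesis by simp
      qed simp
      then show ?case by (simp only:)
    qed
    ultimately have "(\<lambda>n. \<integral>x. g x * bump (real n) a b x \<partial>lborel) \<longlonglongrightarrow> (LBINT x:{a..b}. g x)"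
      by (rule Lim_transform_eventually)
    from tendsto_minus[OF this] have "f a - f b = - (LBINT x:{a..b}. g x)"
      using LIMSEQ_unique[OF 1] by blast
    then show ?thesis by simp
  qed
  obtain G where G: "primitive_on I G g"
    using primitive_on_exists[OF I(1) g] by blast
  define h where "h x = f x - G x" for x
  have ch: "continuous_on I h"
    unfolding h_def by (intro continuous_on_diff f primitive_on_continuous_open[OF G I])
  have hrat: "h a = h b" if "a \<in> \<rat>" "b \<in> \<rat>" "a \<in> I" "b \<in> I" for a b
    using rat[of a b] rat[of b a] primitive_onD(2)[OF G, of a b] primitive_onD(2)[OF G, of b a] that
    by (cases "a \<le> b") (auto simp: h_def)
  have near: "\<exists>r\<in>\<rat> \<inter> I. \<bar>h r - h x\<bar> < e" if x: "x \<in> I" and e: "e > 0" for x e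
  proof -
    have "isCont h x"
      using ch I(2) x by (simp add: continuous_on_eq_continuous_at)
    then obtain d where d: "d > 0" "\<And>y. \<bar>y - x\<bar> < d \<Longrightarrow> \<bar>h y - h x\<bar> < e"
      using e unfolding continuous_at_real_range real_norm_def by blast
    obtain d' where d': "d' > 0" "\<And>y. dist y x < d' \<Longrightarrow> y \<in> I"
      using I(2) x unfolding open_dist by blast
    obtain r where "r \<in> \<rat>" "x < r" "r < x + min d d'"
      using Rats_dense_in_real[of x "x + min d d'"] d d' by auto
    then show ?thesis
      using d(2)[of r] d'(2)[of r] by (intro bexI[of _ r]) (auto simp: dist_real_def)
  qed
  have h: "h x = h y" if xy: "x \<in> I" "y \<in> I" for x y
  proof (rule ccontr)
    assume "h x \<noteq> h y"
    then have e: "\<bar>h x - h y\<bar> / 2 > 0" by simp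
    obtain r s where "r \<in> \<rat> \<inter> I" "s \<in> \<rat> \<inter> I" "\<bar>h r - h x\<bar> < \<bar>h x - h y\<bar> / 2" "\<bar>h s - h y\<bar> < \<bar>h x - h y\<bar> / 2"
      using near[OF xy(1) e] near[OF xy(2) e] by blast
    moreover from this have "h r = h s" using hrat by blast
    ultimately show False
      using abs_triangle_ineq4[of "h s - h y" "h r - h x"] by simp
  qed
  show ?thesis
    unfolding primitive_on_def
  proof (intro ballI impI conjI)
    fix a b assume ab: "a \<in> I" "b \<in> I" "a \<le> b"
    show "set_integrable lborel {a..b} g" using g ab by blast
    show "f b - f a = (LBINT x:{a..b}. g x)"
      using primitive_onD(2)[OF G ab] h[OF ab(1,2)] by (simp add: h_def)
  qed
qed

lemma Ck_on_1I:
  assumes D: "\<And>x. (\<phi> has_real_derivative \<phi>' x) (at x)" and c: "continuous_on UNIV \<phi>'"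
  shows "Ck_on UNIV 1 \<phi>"
proof -
  have fd: "frechet_derivative \<phi> (at x) v = \<phi>' x * v" for x v
    using frechet_derivative_at[OF D[of x, unfolded has_field_derivative_def]] by metis
  show ?thesis
    unfolding One_nat_def Ck_on.simps
  proof (intro conjI allI)
    show "\<phi> differentiable_on UNIV"
      using D unfolding differentiable_on_def has_field_derivative_def
      by (blast intro: differentiableI differentiable_at_withinI)
    show "continuous_on UNIV (\<lambda>p. frechet_derivative \<phi> (at p within UNIV) v)" for v
      by (simp add: fd c continuous_intros)
  qed
qed

lemma bump_C1c:
  assumes "n > 0" "a \<le> b"
  shows "bump n a b \<in> C1c UNIV"
  unfolding C1c_def compact_support_in_def
proof (intro CollectI conjI exI[of _ "{a..b+1/n}"])
  show "Ck_on UNIV 1 (bump n a b)"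
    by (rule Ck_on_1I[OF DERIV_bump]) (intro continuous_intros continuous_tent_kernel)
qed (use bump_eq_0[OF assms] in auto)

lemma weak_deriv_primitive:
  assumes w: "weak_deriv f g" and f: "continuous_on UNIV f"
  shows "primitive_on UNIV f g"
proof (rule primitive_on_bump_test[OF is_interval_univ open_UNIV f])
  show "set_integrable lborel {a..b} g" for a b
    using w compact_Icc by (auto simp: weak_deriv_def loc_integrable_def)
  fix a b :: real and n :: nat assume ab: "a \<le> b" "n > 0"
  have d: "deriv (bump (real n) a b) x = tent_kernel (real n) a x - tent_kernel (real n) b x" for x
    by (rule DERIV_imp_deriv[OF DERIV_bump])
  have "(\<integral>x. f x * deriv (bump (real n) a b) x \<partial>lborel) = - (\<integral>x. g x * bump (real n) a b x \<partial>lborel)"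
    using w bump_C1c[of "real n" a b] ab unfolding weak_deriv_def by simp
  then show "(\<integral>x. f x * (tent_kernel (real n) a x - tent_kernel (real n) b x) \<partial>lborel)
        = - (\<integral>x. g x * bump (real n) a b x \<partial>lborel)"
    by (simp only: d)
qed

section \<open>Slices of weak derivatives\<close>

lemma integrable_mult_bounded:
  fixes f h :: "'a \<Rightarrow> real"
  assumes "integrable M f" "h \<in> borel_measurable M" "\<And>x. \<bar>h x\<bar> \<le> C"
  shows "integrable M (\<lambda>x. f x * h x)"
proof (rule Bochner_Integration.integrable_bound)
  show "integrable M (\<lambda>x. C * f x)" using assms by simp
  show "(\<lambda>x. f x * h x) \<in> borel_measurable M" using assms by auto
  have "\<bar>f x * h x\<bar> \<le> \<bar>C * f x\<bar>" for x
  proof -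
    have "\<bar>h x\<bar> \<le> \<bar>C\<bar>" using assms(3)[of x] by linarith
    from mult_right_mono[OF this, of "\<bar>f x\<bar>"] show ?thesis
      by (simp add: abs_mult mult.commute)
  qed
  then show "AE x in M. norm (f x * h x) \<le> norm (C * f x)" by simp
qed

text \<open>Tensor products of bumps separate the variables. For a fixed bump in \<open>x\<close>
  the defect of the slice test is a function of \<open>t\<close> that is orthogonal to all bumps in
  \<open>t\<close>, hence 0 almost everywhere. Countably many bumps in \<open>x\<close> share one
  null set, and outside it the slice passes the one-dimensional test.\<close>

lemma primitive_on_slices:
  fixes f g :: "real \<times> real \<Rightarrow> real"
  assumes I: "is_interval I" "open I" and J: "is_interval J" "open J"
    and f: "\<And>m::nat. integrable lborel (\<lambda>p. indicator ((I \<inter> {-m..m}) \<times> (J \<inter> {-m..m})) p * f p)"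
    and g: "\<And>m::nat. integrable lborel (\<lambda>p. indicator ((I \<inter> {-m..m}) \<times> (J \<inter> {-m..m})) p * g p)"
    and cont: "AE t in lborel. t \<in> I \<longrightarrow> continuous_on J (\<lambda>x. f (t, x))"
    and test: "\<And>a b n a' b' n'. a \<in> I \<Longrightarrow> a \<le> b \<Longrightarrow> n > 0 \<Longrightarrow> b + 1 / real n \<in> I \<Longrightarrow>
      a' \<in> J \<Longrightarrow> a' \<le> b' \<Longrightarrow> n' > 0 \<Longrightarrow> b' + 1 / real n' \<in> J \<Longrightarrow>
      (\<integral>p. f p * (bump (real n) a b (fst p) *
          (tent_kernel (real n') a' (snd p) - tent_kernel (real n') b' (snd p))) \<partial>lborel)
        = - (\<integral>p. g p * (bump (real n) a b (fst p) * bump (real n') a' b' (snd p)) \<partial>lborel)"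
  shows "AE t in lborel. t \<in> I \<longrightarrow> primitive_on J (\<lambda>x. f (t, x)) (\<lambda>x. g (t, x))"
proof -
  \<comment> \<open>Integrability is available on bounded boxes only; each argument picks an
    \<open>m\<close> whose box contains the supports in use.\<close>
  define Im where "Im m = I \<inter> {- real m..real m}" for m
  define Jm where "Jm m = J \<inter> {- real m..real m}" for m
  have [measurable]: "I \<in> sets borel" "J \<in> sets borel" "Im m \<in> sets borel" "Jm m \<in> sets borel" for m
    using I J unfolding Im_def Jm_def by auto
  note f = f[folded Im_def Jm_def] and g = g[folded Im_def Jm_def]
  have exm: "\<exists>m::nat. {c..d} \<subseteq> {- real m..real m}" for c d
  proof -
    obtain m :: nat where "max \<bar>c\<bar> \<bar>d\<bar> \<le> real m"
      using real_arch_simple by blast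
    then show ?thesis by (intro exI[of _ m]) auto
  qed
  have sub: "{c..d} \<subseteq> K" if "is_interval K" "c \<in> K" "d \<in> K" for K and c d :: real
    using mem_is_interval_1_I[OF that] by auto
  \<comment> \<open>Both sides of the slice test collected on one side: slice \<open>t\<close>
    passes the test exactly when \<open>F\<close> vanishes at \<open>t\<close>, once both integrands
    are integrable.\<close>
  define S where "S a' b' n' p = f p * (tent_kernel n' a' (snd p) - tent_kernel n' b' (snd p))
      + g p * bump n' a' b' (snd p)" for a' b' n' p
  define F where "F a' b' n' t = (\<integral>x. S a' b' n' (t, x) \<partial>lborel)" for a' b' n' t
  have F0: "AE t in lborel. t \<in> I \<longrightarrow> F a' b' (real n') t = 0"
    if J': "a' \<in> J" "a' \<le> b'" "n' > 0" "b' + 1 / real n' \<in> J" for a' b' and n' :: nat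
  proof -
    let ?k = "\<lambda>x. tent_kernel n' a' x - tent_kernel n' b' x" and ?b = "bump n' a' b'"
    have S0: "?k x = 0" "?b x = 0" if "x \<notin> {a'..b' + 1 / real n'}" for x
      using that J' tent_kernel_diff_eq_0[of n' a' b' x] bump_eq_0[of n' a' b' x] by auto
    have kb: "\<bar>?k x\<bar> \<le> 4 * real n'" for x
      by (rule abs_tent_kernel_diff_le) simp
    have bb: "\<bar>?b x\<bar> \<le> 1" for x
      using bump_range[of n' a' b' x] J' by auto
    obtain m0 where m0: "{a'..b' + 1 / real n'} \<subseteq> {- real m0..real m0}"
      using exm by blast
    have mS: "integrable lborel (\<lambda>p. indicator (Im m) (fst p) * S a' b' n' p)" if "m \<ge> m0" for m
    proof -
      have Jm: "{a'..b' + 1 / real n'} \<subseteq> Jm m"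
      proof -
        have "{- real m0..real m0} \<subseteq> {- real m..real m}" using that by auto
        then show ?thesis using sub[OF J(1) J'(1,4)] m0 unfolding Jm_def by blast
      qed
      have "integrable lborel (\<lambda>p. indicator (Im m \<times> Jm m) p * f p * ?k (snd p))"
        by (rule integrable_mult_bounded[OF f _ kb]) (unfold lborel_prod[symmetric], measurable)
      moreover have "integrable lborel (\<lambda>p. indicator (Im m \<times> Jm m) p * g p * ?b (snd p))"
        by (rule integrable_mult_bounded[OF g _ bb]) (unfold lborel_prod[symmetric], measurable)
      ultimately have "integrable lborel (\<lambda>p. indicator (Im m \<times> Jm m) p * f p * ?k (snd p)
          + indicator (Im m \<times> Jm m) p * g p * ?b (snd p))"
        by (rule Bochner_Integration.integrable_add)
      moreover have "indicator (Im m \<times> Jm m) p * f p * ?k (snd p)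
          + indicator (Im m \<times> Jm m) p * g p * ?b (snd p) = indicator (Im m) (fst p) * S a' b' n' p" for p
      proof (cases "snd p \<in> Jm m")
        case True
        then show ?thesis by (simp add: S_def indicator_times algebra_simps)
      next
        case False
        then have "snd p \<notin> {a'..b' + 1 / real n'}" using Jm by blast
        from S0[OF this] False show ?thesis by (simp add: S_def indicator_times)
      qed
      ultimately show ?thesis by simp
    qed
    \<comment> \<open>Orthogonality to all bumps in \<open>t\<close> says that \<open>F\<close> is a
      density of the constant 0, and densities are unique.\<close>
    have "primitive_on I (\<lambda>_. 0) (F a' b' n')"
    proof (rule primitive_on_bump_test[OF I continuous_on_const])
      fix a b assume ab: "a \<in> I" "b \<in> I" "a \<le> b"
      obtain m1 where m1: "{a..b} \<subseteq> {- real m1..real m1}" using exm by blast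
      define m where "m = max m0 m1"
      have "{- real m1..real m1} \<subseteq> {- real m..real m}"
        by (auto simp: m_def)
      then have m2: "{a..b} \<subseteq> Im m"
        using m1 sub[OF I(1) ab(1,2)] unfolding Im_def by blast
      have m1: "m \<ge> m0" by (simp add: m_def)
      note m = m1 m2
      have "integrable (lborel \<Otimes>\<^sub>M lborel) (\<lambda>(t, x). indicator (Im m) t * S a' b' n' (t, x))"
        using mS[OF m(1)] by (simp add: lborel_prod split_beta')
      from lborel_pair.integrable_fst[OF this]
      have "integrable lborel (\<lambda>t. indicator (Im m) t * F a' b' n' t)"
        by (simp add: F_def)
      then have "set_integrable lborel (Im m) (F a' b' n')"
        by (simp add: set_integrable_def)
      then show "set_integrable lborel {a..b} (F a' b' n')"
        by (rule set_integrable_subset[OF _ _ m(2)]) simp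
    next
      fix a b :: real and n :: nat assume ab: "a \<in> I" "a \<le> b" "n > 0" "b + 1 / real n \<in> I"
      obtain m1 where m1: "{a..b + 1 / real n} \<subseteq> {- real m1..real m1}" using exm by blast
      define m where "m = max m0 m1"
      have "{- real m1..real m1} \<subseteq> {- real m..real m}"
        by (auto simp: m_def)
      then have m2: "{a..b + 1 / real n} \<subseteq> Im m"
        using m1 sub[OF I(1) ab(1,4)] unfolding Im_def by blast
      have m1: "m \<ge> m0" by (simp add: m_def)
      note m = m1 m2
      have Im: "indicator (Im m) t * bump n a b t = bump n a b t" for t
      proof (cases "t \<in> Im m")
        case False
        then have "t \<notin> {a..b + 1 / real n}" using m(2) by blast
        then show ?thesis using bump_eq_0[of n a b t] ab by simp
      qed simp
      have bb2: "\<bar>bump n a b (fst p)\<bar> \<le> 1" for p :: "real \<times> real"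
        using bump_range[of n a b "fst p"] ab by auto
      have Jm: "{a'..b' + 1 / real n'} \<subseteq> Jm m"
      proof -
        have "{- real m0..real m0} \<subseteq> {- real m..real m}" using m(1) by auto
        then show ?thesis using sub[OF J(1) J'(1,4)] m0 unfolding Jm_def by blast
      qed
      have int: "integrable lborel (\<lambda>p. indicator (Im m) (fst p) * S a' b' n' p * bump n a b (fst p))"
        by (intro integrable_mult_bounded[OF mS[OF m(1)] _ bb2])
           (unfold lborel_prod[symmetric], measurable)
      have "indicator (Im m) (fst p) * S a' b' n' p * bump n a b (fst p) = S a' b' n' p * bump n a b (fst p)" for p
        using Im[of "fst p"] by (metis mult.assoc mult.commute)
      with int have int': "integrable lborel (\<lambda>p. S a' b' n' p * bump n a b (fst p))"
        by (simp only:)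
      have i1: "integrable lborel (\<lambda>p. indicator (Im m \<times> Jm m) p * f p * (?k (snd p) * bump n a b (fst p)))"
      proof (rule integrable_mult_bounded[OF f])
        show "\<bar>?k (snd p) * bump n a b (fst p)\<bar> \<le> 4 * real n' * 1" for p :: "real \<times> real"
          unfolding abs_mult by (intro mult_mono kb bb2) auto
      qed (unfold lborel_prod[symmetric], measurable)
      have i2: "integrable lborel (\<lambda>p. indicator (Im m \<times> Jm m) p * g p * (?b (snd p) * bump n a b (fst p)))"
      proof (rule integrable_mult_bounded[OF g])
        show "\<bar>?b (snd p) * bump n a b (fst p)\<bar> \<le> 1 * 1" for p :: "real \<times> real"
          unfolding abs_mult by (intro mult_mono bb bb2) auto
      qed (unfold lborel_prod[symmetric], measurable)
      have S0': "?k x = 0" "?b x = 0" if "x \<notin> Jm m" for x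
      proof -
        have "x \<notin> {a'..b' + 1 / real n'}" using that Jm by blast
        from S0[OF this] show "?k x = 0" "?b x = 0" by auto
      qed
      have e1: "indicator (Im m \<times> Jm m) p * f p * (?k (snd p) * bump n a b (fst p))
          = f p * (bump n a b (fst p) * ?k (snd p))" for p
        using S0'[of "snd p"] Im[of "fst p"]
        by (cases "snd p \<in> Jm m"; cases "fst p \<in> Im m") (auto simp: indicator_times)
      have e2: "indicator (Im m \<times> Jm m) p * g p * (?b (snd p) * bump n a b (fst p))
          = g p * (bump n a b (fst p) * ?b (snd p))" for p
        using S0'[of "snd p"] Im[of "fst p"]
        by (cases "snd p \<in> Jm m"; cases "fst p \<in> Im m") (auto simp: indicator_times)
      have "(\<integral>p. S a' b' n' p * bump n a b (fst p) \<partial>lborel) =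
          (\<integral>p. f p * (bump n a b (fst p) * ?k (snd p)) + g p * (bump n a b (fst p) * ?b (snd p)) \<partial>lborel)"
        by (rule Bochner_Integration.integral_cong) (auto simp: S_def algebra_simps)
      also have "\<dots> = 0"
        using i1 i2 test[OF ab J'] by (simp only: e1 e2 Bochner_Integration.integral_add)
      finally have 0: "(\<integral>p. S a' b' n' p * bump n a b (fst p) \<partial>lborel) = 0" .
      have "(\<integral>t. F a' b' n' t * bump n a b t \<partial>lborel) = (\<integral>t. (\<integral>x. S a' b' n' (t, x) * bump n a b t \<partial>lborel) \<partial>lborel)"
        by (simp add: F_def)
      also have "\<dots> = (\<integral>p. S a' b' n' p * bump n a b (fst p) \<partial>(lborel \<Otimes>\<^sub>M lborel))"
        using lborel_pair.integral_fst[of "\<lambda>t x. S a' b' n' (t, x) * bump n a b t"] int'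
        by (simp add: lborel_prod split_beta')
      finally show "(\<integral>t. 0 * (tent_kernel n a t - tent_kernel n b t) \<partial>lborel) = - (\<integral>t. F a' b' n' t * bump n a b t \<partial>lborel)"
        using 0 by (simp add: lborel_prod)
    qed
    moreover have "primitive_on I (\<lambda>_. 0) (\<lambda>_. 0)"
      using primitive_on_C1[of "\<lambda>_. 0" "\<lambda>_. 0"] primitive_on_subset by auto
    ultimately show ?thesis
      by (rule primitive_on_unique[OF _ _ I])
  qed
  have F0': "AE t in lborel. \<forall>q\<in>\<rat> \<times> \<rat> \<times> (UNIV :: nat set).
      fst q \<in> J \<longrightarrow> fst q \<le> fst (snd q) \<longrightarrow> snd (snd q) > 0 \<longrightarrow> fst (snd q) + 1 / real (snd (snd q)) \<in> J \<longrightarrow>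
      t \<in> I \<longrightarrow> F (fst q) (fst (snd q)) (real (snd (snd q))) t = 0"
  proof (subst AE_ball_countable)
    show "countable (\<rat> \<times> \<rat> \<times> (UNIV :: nat set))"
      by (intro countable_SIGMA countable_rat) auto
    show "\<forall>q\<in>\<rat> \<times> \<rat> \<times> (UNIV :: nat set). AE t in lborel.
      fst q \<in> J \<longrightarrow> fst q \<le> fst (snd q) \<longrightarrow> snd (snd q) > 0 \<longrightarrow> fst (snd q) + 1 / real (snd (snd q)) \<in> J \<longrightarrow>
      t \<in> I \<longrightarrow> F (fst q) (fst (snd q)) (real (snd (snd q))) t = 0"
      using F0 by (auto simp: AE_conj_iff intro: AE_I2) 
  qed
  have slice: "AE t in lborel. \<forall>m. integrable lborel (\<lambda>x. indicator (Im m \<times> Jm m) (t, x) * h (t, x))"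
    if h: "\<And>m. integrable lborel (\<lambda>p. indicator (Im m \<times> Jm m) p * h p)" for h :: "real \<times> real \<Rightarrow> real"
    unfolding AE_all_countable
  proof
    fix m
    show "AE t in lborel. integrable lborel (\<lambda>x. indicator (Im m \<times> Jm m) (t, x) * h (t, x))"
      using lborel_pair.AE_integrable_fst'[of "\<lambda>p. indicator (Im m \<times> Jm m) p * h p"] h[of m]
      by (simp add: lborel_prod)
  qed
  have seti: "set_integrable lborel {c..d} (\<lambda>x. h (t, x))"
    if t: "t \<in> I" and h: "\<forall>m. integrable lborel (\<lambda>x. indicator (Im m \<times> Jm m) (t, x) * h (t, x))"
      and cd: "c \<in> J" "d \<in> J" for t c d and h :: "real \<times> real \<Rightarrow> real"
  proof -
    obtain m1 where m1: "{c..d} \<subseteq> {- real m1..real m1}" using exm by blast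
    obtain m2 where m2: "{t..t} \<subseteq> {- real m2..real m2}" using exm by blast
    define m where "m = max m1 m2"
    have "{- real m1..real m1} \<subseteq> {- real m..real m}" "{- real m2..real m2} \<subseteq> {- real m..real m}"
      by (auto simp: m_def)
    then have m: "{c..d} \<subseteq> Jm m" "t \<in> Im m"
      using m1 m2 sub[OF J(1) cd] t unfolding Im_def Jm_def by (blast, force)
    have "set_integrable lborel (Jm m) (\<lambda>x. h (t, x))"
      using h[rule_format, of m] m(2) unfolding set_integrable_def by (simp add: indicator_times)
    then show ?thesis
      by (rule set_integrable_subset) (use m in auto)
  qed
  show ?thesis
    using F0' slice[OF f] slice[OF g] cont
  proof (eventually_elim, intro impI)
    fix t
    assume F: "\<forall>q\<in>\<rat> \<times> \<rat> \<times> (UNIV :: nat set).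
      fst q \<in> J \<longrightarrow> fst q \<le> fst (snd q) \<longrightarrow> snd (snd q) > 0 \<longrightarrow> fst (snd q) + 1 / real (snd (snd q)) \<in> J \<longrightarrow>
      t \<in> I \<longrightarrow> F (fst q) (fst (snd q)) (real (snd (snd q))) t = 0"
      and ft: "\<forall>m. integrable lborel (\<lambda>x. indicator (Im m \<times> Jm m) (t, x) * f (t, x))"
      and gt: "\<forall>m. integrable lborel (\<lambda>x. indicator (Im m \<times> Jm m) (t, x) * g (t, x))"
      and ct: "t \<in> I \<longrightarrow> continuous_on J (\<lambda>x. f (t, x))"
      and t: "t \<in> I"
    show "primitive_on J (\<lambda>x. f (t, x)) (\<lambda>x. g (t, x))"
    proof (rule primitive_on_bump_test[OF J ct[rule_format, OF t] seti[OF t gt]])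
      fix a b :: real and n :: nat
      assume ab: "a \<in> \<rat>" "b \<in> \<rat>" "a \<in> J" "a \<le> b" "n > 0" "b + 1 / real n \<in> J"
      let ?U = "{a..b + 1 / real n}"
      let ?k = "\<lambda>x. tent_kernel n a x - tent_kernel n b x"
      have S0: "?k x = 0" "bump n a b x = 0" if "x \<notin> ?U" for x
        using that ab tent_kernel_diff_eq_0[of n a b x] bump_eq_0[of n a b x] by auto
      have kb: "\<bar>?k x\<bar> \<le> 4 * real n" for x
        by (rule abs_tent_kernel_diff_le) simp
      have bb: "\<bar>bump n a b x\<bar> \<le> 1" for x
        using bump_range[of n a b x] ab by auto
      have "integrable lborel (\<lambda>x. indicator ?U x * f (t, x) * ?k x)"
        by (intro integrable_mult_bounded[OF _ _ kb])
           (use seti[OF t ft ab(3,6)] in \<open>auto simp: set_integrable_def\<close>)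
      moreover have "indicator ?U x * f (t, x) * ?k x = f (t, x) * ?k x" for x
        using S0(1)[of x] by (cases "x \<in> ?U") auto
      ultimately have i1: "integrable lborel (\<lambda>x. f (t, x) * ?k x)" by simp
      have "integrable lborel (\<lambda>x. indicator ?U x * g (t, x) * bump n a b x)"
        by (intro integrable_mult_bounded[OF _ _ bb])
           (use seti[OF t gt ab(3,6)] in \<open>auto simp: set_integrable_def\<close>)
      moreover have "indicator ?U x * g (t, x) * bump n a b x = g (t, x) * bump n a b x" for x
        using S0(2)[of x] by (cases "x \<in> ?U") auto
      ultimately have i2: "integrable lborel (\<lambda>x. g (t, x) * bump n a b x)" by simp
      have "F a b n t = 0"
        using F[rule_format, of "(a, b, n)"] ab t by simp
      then show "(\<integral>x. f (t, x) * ?k x \<partial>lborel) = - (\<integral>x. g (t, x) * bump n a b x \<partial>lborel)"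
        using i1 i2 by (simp add: F_def S_def)
    qed
  qed
qed

section \<open>Density and translations in the space of square-integrable functions\<close>

lemma integrable_mult_L2:
  fixes f g :: "'a \<Rightarrow> real"
  assumes [measurable]: "f \<in> borel_measurable M" "g \<in> borel_measurable M"
    and "integrable M (\<lambda>x. (f x)\<^sup>2)" "integrable M (\<lambda>x. (g x)\<^sup>2)"
  shows "integrable M (\<lambda>x. f x * g x)"
proof (rule Bochner_Integration.integrable_bound)
  show "integrable M (\<lambda>x. (f x)\<^sup>2 + (g x)\<^sup>2)" using assms by simp
  have "\<bar>f x * g x\<bar> \<le> (f x)\<^sup>2 + (g x)\<^sup>2" for x
  proof -
    have "2 * \<bar>f x * g x\<bar> \<le> (f x)\<^sup>2 + (g x)\<^sup>2"
      using sum_squares_bound[of "\<bar>f x\<bar>" "\<bar>g x\<bar>"] by (simp add: abs_mult)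
    then show ?thesis using abs_ge_zero[of "f x * g x"] by linarith
  qed
  then show "AE x in M. norm (f x * g x) \<le> norm ((f x)\<^sup>2 + (g x)\<^sup>2)" by simp
qed measurable

lemma Cauchy_Schwarz_integral:
  fixes f g :: "'a \<Rightarrow> real"
  assumes m: "f \<in> borel_measurable M" "g \<in> borel_measurable M"
    and i: "integrable M (\<lambda>x. (f x)\<^sup>2)" "integrable M (\<lambda>x. (g x)\<^sup>2)"
  shows "\<bar>\<integral>x. f x * g x \<partial>M\<bar> \<le> sqrt (\<integral>x. (f x)\<^sup>2 \<partial>M) * sqrt (\<integral>x. (g x)\<^sup>2 \<partial>M)"
proof -
  note fg = integrable_mult_L2[OF m i]
  let ?a = "\<integral>x. (f x)\<^sup>2 \<partial>M" and ?b = "\<integral>x. f x * g x \<partial>M" and ?c = "\<integral>x. (g x)\<^sup>2 \<partial>M"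
  have q: "0 \<le> ?a - 2 * s * ?b + s\<^sup>2 * ?c" for s
  proof -
    have "0 \<le> (\<integral>x. (f x - s * g x)\<^sup>2 \<partial>M)" by simp
    also have "\<dots> = (\<integral>x. (f x)\<^sup>2 - 2 * s * (f x * g x) + s\<^sup>2 * (g x)\<^sup>2 \<partial>M)"
      by (rule Bochner_Integration.integral_cong) (auto simp: power2_eq_square algebra_simps)
    finally show ?thesis using i fg by simp
  qed
  have "?b\<^sup>2 \<le> ?a * ?c"
  proof (cases "?c = 0")
    case True
    then have "AE x in M. (g x)\<^sup>2 = 0"
      using integral_nonneg_eq_0_iff_AE[OF i(2)] by auto
    then have "?b = (\<integral>x. 0 \<partial>M)"
      using m by (intro integral_cong_AE) (auto elim!: eventually_mono)
    then show ?thesis using True by simp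
  next
    case False
    then have c: "?c > 0" by (simp add: less_le)
    have "0 \<le> ?a - 2 * (?b / ?c) * ?b + (?b / ?c)\<^sup>2 * ?c" by (rule q)
    also have "\<dots> = ?a - ?b\<^sup>2 / ?c" using c by (simp add: field_simps power2_eq_square)
    finally show ?thesis using c by (simp add: field_simps)
  qed
  then have "sqrt (?b\<^sup>2) \<le> sqrt (?a * ?c)" by (rule real_sqrt_le_mono)
  then show ?thesis by (simp add: real_sqrt_mult)
qed

lemma power2_diff_le: "(a - c)\<^sup>2 \<le> 2 * (a - b)\<^sup>2 + 2 * (b - c)\<^sup>2" for a b c :: real
proof -
  have "2 * (a - b)\<^sup>2 + 2 * (b - c)\<^sup>2 - (a - c)\<^sup>2 = (a - 2 * b + c)\<^sup>2"
    by (simp add: power2_eq_square algebra_simps)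
  then show ?thesis using zero_le_power2[of "a - 2 * b + c"] by linarith
qed

lemma square_integrable_diff:
  fixes f g :: "'a \<Rightarrow> real"
  assumes m: "f \<in> borel_measurable M" "g \<in> borel_measurable M"
    and i: "integrable M (\<lambda>x. (f x)\<^sup>2)" "integrable M (\<lambda>x. (g x)\<^sup>2)"
  shows "integrable M (\<lambda>x. (f x - g x)\<^sup>2)"
proof -
  have "integrable M (\<lambda>x. (f x)\<^sup>2 - 2 * (f x * g x) + (g x)\<^sup>2)"
    using i integrable_mult_L2[OF m i] by simp
  then show ?thesis
    by (rule back_subst[of "integrable M"]) (auto simp: power2_eq_square algebra_simps)
qed

text \<open>First \<open>f\<close> is truncated in size and in space. Measurability then provides
  continuous functions converging to the truncation off a negligible set; clipping them at the same
  height and cutting them off by \<open>\<eta>\<close> supplies the dominating function that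
  pointwise convergence lacks.\<close>

lemma L2_dense_continuous_compact_support:
  fixes f :: "'a::euclidean_space \<Rightarrow> real"
  assumes f[measurable]: "f \<in> borel_measurable borel"
    and f2: "integrable lborel (\<lambda>x. (f x)\<^sup>2)" and e: "e > 0"
  shows "\<exists>\<phi> r. continuous_on UNIV \<phi> \<and> (\<forall>x. r < norm x \<longrightarrow> \<phi> x = 0) \<and>
    integrable lborel (\<lambda>x. (\<phi> x)\<^sup>2) \<and> (\<integral>x. (f x - \<phi> x)\<^sup>2 \<partial>lborel) < e"
proof -
  define cl where "cl c y = max (- c) (min c y)" for c y :: real
  define fn where "fn n x = cl (real n) (f x) * indicator (cball 0 (real n)) x" for n x
  have [measurable]: "fn n \<in> borel_measurable borel" for n
    unfolding fn_def cl_def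
    by (intro borel_measurable_times borel_measurable_indicator borel_measurable_max
        borel_measurable_min borel_measurable_const f) auto
  have fnf: "\<bar>f x - fn n x\<bar> \<le> \<bar>f x\<bar>" for n x
    by (auto simp: fn_def cl_def indicator_def max_def min_def)
  have "(\<lambda>n. \<integral>x. (f x - fn n x)\<^sup>2 \<partial>lborel) \<longlonglongrightarrow> (\<integral>x. 0 \<partial>(lborel :: 'a measure))"
  proof (rule integral_dominated_convergence[where w = "\<lambda>x. (f x)\<^sup>2"])
    show "AE x in lborel. (\<lambda>n. (f x - fn n x)\<^sup>2) \<longlonglongrightarrow> 0"
    proof (rule AE_I2, rule tendsto_eventually)
      fix x
      obtain N :: nat where "max \<bar>f x\<bar> (norm x) \<le> real N"
        using real_arch_simple by blast
      then have N: "\<bar>f x\<bar> \<le> real N" "norm x \<le> real N" by auto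
      show "\<forall>\<^sub>F n in sequentially. (f x - fn n x)\<^sup>2 = 0"
        using eventually_ge_at_top[of N]
      proof eventually_elim
        case (elim n)
        then have "\<bar>f x\<bar> \<le> real n" "norm x \<le> real n" using N by linarith+
        then show ?case by (auto simp: fn_def cl_def)
      qed
    qed
    show "AE x in lborel. norm ((f x - fn n x)\<^sup>2) \<le> (f x)\<^sup>2" for n
      using fnf by (simp add: abs_le_square_iff)
  qed (use f2 in auto)
  then have "\<forall>\<^sub>F n in sequentially. (\<integral>x. (f x - fn n x)\<^sup>2 \<partial>lborel) < e / 4"
    using e by (intro order_tendstoD(2)) auto
  then obtain n where n: "(\<integral>x. (f x - fn n x)\<^sup>2 \<partial>lborel) < e / 4"
    by (auto simp: eventually_sequentially)
  have "fn n \<in> borel_measurable lebesgue"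
    by (intro measurable_completion) simp
  then have "fn n \<in> borel_measurable (lebesgue_on UNIV)"
    by (rule measurable_restrict_space1)
  then have "fn n measurable_on UNIV"
    by (simp add: measurable_on_iff_borel_measurable)
  then obtain N g where N: "negligible N" "\<And>k. continuous_on UNIV (g k)"
    "\<And>x. x \<notin> N \<Longrightarrow> (\<lambda>k. g k x) \<longlonglongrightarrow> fn n x"
    unfolding measurable_on_def by auto
  have AEN: "AE x in lborel. x \<notin> N"
  proof -
    have "N \<in> null_sets lebesgue" using N(1) by (simp add: negligible_iff_null_sets)
    then have "AE x in lebesgue. x \<notin> N" by (rule AE_not_in)
    then show ?thesis by (simp add: AE_completion_iff)
  qed
  \<comment> \<open>\<open>\<eta>\<close> is 1 on the ball of radius \<open>n\<close> that carries
    \<open>fn n\<close>, and 0 beyond radius \<open>n + 1\<close>.\<close>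
  define \<eta> where "\<eta> x = max 0 (min 1 (real n + 1 - norm x))" for x :: 'a
  define \<phi> where "\<phi> k x = cl (real n) (g k x) * \<eta> x" for k x
  have c\<phi>: "continuous_on UNIV (\<phi> k)" for k
    unfolding \<phi>_def \<eta>_def cl_def by (intro continuous_intros N(2))
  have [measurable]: "\<phi> k \<in> borel_measurable borel" for k
    by (rule borel_measurable_continuous_onI c\<phi>)+
  have \<phi>0: "\<phi> k x = 0" if "real n + 1 < norm x" for k x
    using that by (auto simp: \<phi>_def \<eta>_def)
  have clb: "\<bar>cl (real n) y\<bar> \<le> real n" for y
    by (auto simp: cl_def)
  have \<eta>b: "\<bar>\<eta> x\<bar> \<le> 1" for x
    by (auto simp: \<eta>_def)
  have \<phi>b: "\<bar>\<phi> k x\<bar> \<le> real n" for k x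
    using mult_mono[OF clb[of "g k x"] \<eta>b[of x]] by (simp add: \<phi>_def abs_mult)
  have icb: "integrable lborel (\<lambda>x. C * indicator (cball (0 :: 'a) r) x)" for C r :: real
    using emeasure_lborel_cball_finite[of "0 :: 'a" r]
    by (intro integrable_mult_right) (auto simp: integrable_indicator_iff)
  have sq: "integrable lborel (\<lambda>x. (\<phi> k x)\<^sup>2)" for k
  proof (rule Bochner_Integration.integrable_bound[OF icb])
    show "AE x in lborel. norm ((\<phi> k x)\<^sup>2) \<le> norm ((real n)\<^sup>2 * indicator (cball 0 (real n + 1)) x)"
    proof (rule AE_I2)
      fix x show "norm ((\<phi> k x)\<^sup>2) \<le> norm ((real n)\<^sup>2 * indicator (cball 0 (real n + 1)) x)"
        using \<phi>b[of k x] \<phi>0[of x k] abs_le_square_iff[of "\<phi> k x" "real n"]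
        by (cases "norm x \<le> real n + 1") auto
    qed
  qed measurable
  have "(\<lambda>k. \<integral>x. (fn n x - \<phi> k x)\<^sup>2 \<partial>lborel) \<longlonglongrightarrow> (\<integral>x. 0 \<partial>(lborel :: 'a measure))"
  proof (rule integral_dominated_convergence)
    show "integrable lborel (\<lambda>x. (2 * real n)\<^sup>2 * indicator (cball (0 :: 'a) (real n + 1)) x)"
      by (rule icb)
    show "AE x in lborel. (\<lambda>k. (fn n x - \<phi> k x)\<^sup>2) \<longlonglongrightarrow> 0"
      using AEN
    proof eventually_elim
      case (elim x)
      have "(\<lambda>k. (fn n x - cl (real n) (g k x) * \<eta> x)\<^sup>2) \<longlonglongrightarrow> (fn n x - cl (real n) (fn n x) * \<eta> x)\<^sup>2"
        unfolding cl_def by (intro tendsto_intros N(3) elim)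
      moreover have "cl (real n) (fn n x) * \<eta> x = fn n x"
        by (auto simp: fn_def \<eta>_def cl_def indicator_def max_def min_def)
      ultimately show ?case by (simp add: \<phi>_def)
    qed
    show "AE x in lborel. norm ((fn n x - \<phi> k x)\<^sup>2) \<le> (2 * real n)\<^sup>2 * indicator (cball 0 (real n + 1)) x" for k
    proof (rule AE_I2)
      fix x
      show "norm ((fn n x - \<phi> k x)\<^sup>2) \<le> (2 * real n)\<^sup>2 * indicator (cball 0 (real n + 1)) x"
      proof (cases "norm x \<le> real n + 1")
        case True
        have "\<bar>fn n x\<bar> \<le> real n"
          using clb[of "f x"] by (auto simp: fn_def indicator_def)
        then have "\<bar>fn n x - \<phi> k x\<bar> \<le> \<bar>2 * real n\<bar>"
          using \<phi>b[of k x] by linarith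
        then show ?thesis using True unfolding abs_le_square_iff by simp
      next
        case False
        then show ?thesis using \<phi>0[of x k] by (auto simp: fn_def indicator_def)
      qed
    qed
  qed auto
  then have "\<forall>\<^sub>F k in sequentially. (\<integral>x. (fn n x - \<phi> k x)\<^sup>2 \<partial>lborel) < e / 4"
    using e by (intro order_tendstoD(2)) auto
  then obtain k where k: "(\<integral>x. (fn n x - \<phi> k x)\<^sup>2 \<partial>lborel) < e / 4"
    by (auto simp: eventually_sequentially)
  have fn2: "integrable lborel (\<lambda>x. (fn n x)\<^sup>2)"
  proof (rule Bochner_Integration.integrable_bound[OF f2])
    have "\<bar>fn n x\<bar> \<le> \<bar>f x\<bar>" for x
      by (auto simp: fn_def cl_def indicator_def max_def min_def)
    then show "AE x in lborel. norm ((fn n x)\<^sup>2) \<le> norm ((f x)\<^sup>2)"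
      by (simp add: abs_le_square_iff)
  qed measurable
  have d1: "integrable lborel (\<lambda>x. (f x - fn n x)\<^sup>2)" and d2: "integrable lborel (\<lambda>x. (fn n x - \<phi> k x)\<^sup>2)"
    and d3: "integrable lborel (\<lambda>x. (f x - \<phi> k x)\<^sup>2)"
    using f2 fn2 sq by (auto intro!: square_integrable_diff)
  have "(\<integral>x. (f x - \<phi> k x)\<^sup>2 \<partial>lborel) \<le> (\<integral>x. 2 * (f x - fn n x)\<^sup>2 + 2 * (fn n x - \<phi> k x)\<^sup>2 \<partial>lborel)"
    by (rule integral_mono) (use d1 d2 d3 power2_diff_le in auto)
  also have "\<dots> < e"
    using n k d1 d2 by simp
  finally show ?thesis
    using c\<phi> \<phi>0 sq by blast
qed

lemma
  fixes g :: "'a::euclidean_space \<Rightarrow> real"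
  assumes g: "integrable lborel g"
  shows integrable_translate: "integrable lborel (\<lambda>z. g (z + v))"
    and integral_translate: "(\<integral>z. g (z + v) \<partial>lborel) = (\<integral>z. g z \<partial>lborel)"
proof -
  have [measurable]: "g \<in> borel_measurable borel" using g by auto
  have "integrable (distr lborel borel ((+) v)) g"
    using g by (simp add: lborel_distr_plus)
  then show "integrable lborel (\<lambda>z. g (z + v))"
    by (subst (asm) integrable_distr_eq) (auto simp: add.commute)
  have "(\<integral>z. g z \<partial>lborel) = (\<integral>z. g z \<partial>distr lborel borel ((+) v))"
    by (simp add: lborel_distr_plus)
  also have "\<dots> = (\<integral>z. g (z + v) \<partial>lborel)"
    by (subst integral_distr) (auto simp: add.commute)
  finally show "(\<integral>z. g (z + v) \<partial>lborel) = (\<integral>z. g z \<partial>lborel)" by simp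
qed

text \<open>Replacing \<open>f\<close> by a continuous compactly supported \<open>\<phi>\<close>
  costs the same for every shift of \<open>g\<close>, since shifts keep the norm. By translation
  invariance the shift then moves onto \<open>\<phi>\<close>, where uniform continuity
  applies.\<close>

lemma L2_translation_weakly_continuous:
  fixes f g :: "'a::euclidean_space \<Rightarrow> real"
  assumes f[measurable]: "f \<in> borel_measurable borel" and f2: "integrable lborel (\<lambda>x. (f x)\<^sup>2)"
    and g[measurable]: "g \<in> borel_measurable borel" and g2: "integrable lborel (\<lambda>x. (g x)\<^sup>2)"
    and e: "e > 0"
  shows "\<exists>d>0. \<forall>v. norm v < d \<longrightarrow> \<bar>(\<integral>z. f z * g (z + v) \<partial>lborel) - (\<integral>z. f z * g z \<partial>lborel)\<bar> < e"
proof -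
  define G where "G = sqrt (\<integral>x. (g x)\<^sup>2 \<partial>lborel)"
  have G0: "G \<ge> 0" by (simp add: G_def)
  \<comment> \<open>By Cauchy-Schwarz this accuracy makes the replacement of \<open>f\<close> by
    \<open>\<phi>\<close> cost at most \<open>e / 4\<close>; the added 1 avoids division by
    0.\<close>
  define \<delta> where "\<delta> = (e / (4 * (G + 1)))\<^sup>2"
  have \<delta>: "\<delta> > 0" using e G0 by (simp add: \<delta>_def)
  obtain \<phi> r where \<phi>: "continuous_on UNIV \<phi>" "\<And>x. r < norm x \<Longrightarrow> \<phi> x = 0"
    "integrable lborel (\<lambda>x. (\<phi> x)\<^sup>2)" "(\<integral>x. (f x - \<phi> x)\<^sup>2 \<partial>lborel) < \<delta>"
    using L2_dense_continuous_compact_support[OF f f2 \<delta>] by blast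
  have [measurable]: "\<phi> \<in> borel_measurable borel"
    by (rule borel_measurable_continuous_onI \<phi>)+
  have gv2: "integrable lborel (\<lambda>x. (g (x + v))\<^sup>2)" and Gv: "sqrt (\<integral>x. (g (x + v))\<^sup>2 \<partial>lborel) = G" for v
    using integrable_translate[OF g2, of v] integral_translate[OF g2, of v] by (auto simp: G_def)
  have ab: "\<bar>\<integral>z. (f z - \<phi> z) * g (z + v) \<partial>lborel\<bar> \<le> e / 4" for v
  proof -
    have "\<bar>\<integral>z. (f z - \<phi> z) * g (z + v) \<partial>lborel\<bar> \<le> sqrt (\<integral>x. (f x - \<phi> x)\<^sup>2 \<partial>lborel) * sqrt (\<integral>x. (g (x + v))\<^sup>2 \<partial>lborel)"
      by (rule Cauchy_Schwarz_integral) (use gv2 f2 \<phi>(3) in \<open>auto intro!: square_integrable_diff\<close>)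
    also have "\<dots> \<le> (e / (4 * (G + 1))) * G"
      unfolding Gv using \<phi>(4) e G0
      by (intro mult_right_mono real_le_lsqrt) (auto simp: \<delta>_def)
    also have "\<dots> \<le> e / 4"
      using e G0 by (simp add: field_simps)
    finally show ?thesis .
  qed
  define A where "A = (\<integral>z. indicator (cball 0 (r + 1)) z * \<bar>g z\<bar> \<partial>lborel)"
  have "integrable lborel (indicator (cball 0 (r + 1)) :: 'a \<Rightarrow> real)"
    using emeasure_lborel_cball_finite[of "0 :: 'a" "r + 1"] by (auto simp: integrable_indicator_iff)
  moreover have "(indicator (cball 0 (r + 1)) z)\<^sup>2 = (indicator (cball 0 (r + 1)) z :: real)" for z :: 'a
    by (simp add: indicator_def)
  ultimately have ig: "integrable lborel (\<lambda>z. indicator (cball 0 (r + 1)) z * \<bar>g z\<bar>)"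
    using g2 by (intro integrable_mult_L2) (auto intro!: borel_measurable_indicator)
  have A0: "A \<ge> 0" unfolding A_def by (rule Bochner_Integration.integral_nonneg) auto
  \<comment> \<open>Shifts will have length below 1: outside radius \<open>r + 1\<close> both values
    of \<open>\<phi>\<close> vanish, and inside it both arguments have norm at most
    \<open>r + 2\<close>.\<close>
  have "uniformly_continuous_on (cball 0 (r + 2)) \<phi>"
    by (rule compact_uniformly_continuous) (use \<phi>(1) continuous_on_subset in auto)
  then obtain d where d: "d > 0" "\<And>x y. x \<in> cball 0 (r + 2) \<Longrightarrow> y \<in> cball 0 (r + 2) \<Longrightarrow> dist y x < d \<Longrightarrow>
     dist (\<phi> y) (\<phi> x) < e / (4 * (A + 1))"
    using e A0 unfolding uniformly_continuous_on_def by (metis add_nonneg_pos divide_pos_pos mult_pos_pos zero_less_numeral zero_less_one)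
  show ?thesis
  proof (intro exI[of _ "min d 1"] conjI allI impI)
    show "min d 1 > 0" using d by simp
    fix v :: 'a assume v: "norm v < min d 1"
    have i1: "integrable lborel (\<lambda>z. f z * g (z + v))" "integrable lborel (\<lambda>z. f z * g z)"
      "integrable lborel (\<lambda>z. \<phi> z * g (z + v))" "integrable lborel (\<lambda>z. \<phi> z * g z)"
      using gv2[of v] f2 g2 \<phi>(3) by (auto intro!: integrable_mult_L2)
    have i2: "integrable lborel (\<lambda>z. \<phi> (z - v) * g z)"
      using integrable_translate[OF i1(3), of "- v"] by simp
    have sh: "(\<integral>z. \<phi> z * g (z + v) \<partial>lborel) = (\<integral>z. \<phi> (z - v) * g z \<partial>lborel)"
      using integral_translate[OF i1(3), of "- v"] by simp
    have "\<bar>(\<integral>z. \<phi> (z - v) * g z \<partial>lborel) - (\<integral>z. \<phi> z * g z \<partial>lborel)\<bar>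
      = \<bar>\<integral>z. \<phi> (z - v) * g z - \<phi> z * g z \<partial>lborel\<bar>"
      using i1 i2 by simp
    also have "\<dots> \<le> (\<integral>z. \<bar>\<phi> (z - v) * g z - \<phi> z * g z\<bar> \<partial>lborel)"
      by (rule integral_abs_bound)
    also have "\<dots> \<le> (\<integral>z. e / (4 * (A + 1)) * (indicator (cball 0 (r + 1)) z * \<bar>g z\<bar>) \<partial>lborel)"
    proof (rule integral_mono)
      show "integrable lborel (\<lambda>z. \<bar>\<phi> (z - v) * g z - \<phi> z * g z\<bar>)" using i1 i2 by auto
      show "integrable lborel (\<lambda>z. e / (4 * (A + 1)) * (indicator (cball 0 (r + 1)) z * \<bar>g z\<bar>))"
        using ig by auto
      fix z
      have nz: "norm z \<le> norm (z - v) + norm v" "norm (z - v) \<le> norm z + norm v"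
        using norm_triangle_ineq[of "z - v" v] norm_triangle_ineq4[of z v] by auto
      show "\<bar>\<phi> (z - v) * g z - \<phi> z * g z\<bar> \<le> e / (4 * (A + 1)) * (indicator (cball 0 (r + 1)) z * \<bar>g z\<bar>)"
      proof (cases "norm z \<le> r + 1")
        case True
        have "dist (\<phi> (z - v)) (\<phi> z) < e / (4 * (A + 1))"
          by (rule d(2)) (use True nz v in \<open>auto simp: dist_norm norm_minus_commute\<close>)
        then have "\<bar>\<phi> (z - v) - \<phi> z\<bar> * \<bar>g z\<bar> \<le> e / (4 * (A + 1)) * \<bar>g z\<bar>"
          by (intro mult_right_mono) (auto simp: dist_real_def)
        moreover have "indicator (cball 0 (r + 1)) z = (1 :: real)"
          using True by simp
        ultimately show ?thesis
          by (simp only: left_diff_distrib[symmetric] abs_mult mult_1)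
      next
        case False
        then have "\<phi> z = 0" "\<phi> (z - v) = 0"
          using nz v by (auto intro!: \<phi>(2))
        then show ?thesis using False by simp
      qed
    qed
    also have "\<dots> = e / (4 * (A + 1)) * A" by (simp add: A_def)
    also have "\<dots> \<le> e / 4" using e A0 by (simp add: field_simps)
    finally have 1: "\<bar>(\<integral>z. \<phi> z * g (z + v) \<partial>lborel) - (\<integral>z. \<phi> z * g z \<partial>lborel)\<bar> \<le> e / 4"
      unfolding sh .
    have 2: "(\<integral>z. (f z - \<phi> z) * g (z + v) \<partial>lborel) = (\<integral>z. f z * g (z + v) \<partial>lborel) - (\<integral>z. \<phi> z * g (z + v) \<partial>lborel)"
      "(\<integral>z. (f z - \<phi> z) * g z \<partial>lborel) = (\<integral>z. f z * g z \<partial>lborel) - (\<integral>z. \<phi> z * g z \<partial>lborel)"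
      using i1 by (simp_all add: left_diff_distrib)
    have abs3: "\<bar>p - s\<bar> < e" if "\<bar>p - q\<bar> \<le> e / 4" "\<bar>q - t\<bar> \<le> e / 4" "\<bar>s - t\<bar> \<le> e / 4" for p q s t
      using that e unfolding abs_le_iff abs_less_iff by linarith
    have "\<bar>(\<integral>z. f z * g z \<partial>lborel) - (\<integral>z. \<phi> z * g z \<partial>lborel)\<bar> \<le> e / 4"
      using ab[of 0] by (simp only: 2 add_0_right)
    from abs3[OF ab[of v, unfolded 2] 1 this]
    show "\<bar>(\<integral>z. f z * g (z + v) \<partial>lborel) - (\<integral>z. f z * g z \<partial>lborel)\<bar> < e" .
  qed
qed

text \<open>The hypothesis of Fubini for averages of shifts: Cauchy-Schwarz bounds the inner
  integral by the same \<open>A * B\<close> for all shifts.\<close>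

lemma L2_shift_product_integrable:
  fixes a b :: "'a::euclidean_space \<Rightarrow> real"
  assumes a[measurable]: "a \<in> borel_measurable borel" and a2: "integrable lborel (\<lambda>x. (a x)\<^sup>2)"
    and b[measurable]: "b \<in> borel_measurable borel" and b2: "integrable lborel (\<lambda>x. (b x)\<^sup>2)"
  shows "integrable (lborel \<Otimes>\<^sub>M lborel) (\<lambda>(s, z). indicator {0..h::real} s * (a z * b (z + s *\<^sub>R v)))"
proof -
  have bs2: "integrable lborel (\<lambda>z. (b (z + w))\<^sup>2)" for w
    by (rule integrable_translate[OF b2])
  define A where "A = sqrt (\<integral>x. (a x)\<^sup>2 \<partial>lborel)"
  define B where "B = sqrt (\<integral>x. (b x)\<^sup>2 \<partial>lborel)"
  have abs_bound: "(\<integral>z. \<bar>a z * b (z + w)\<bar> \<partial>lborel) \<le> A * B" for w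
  proof -
    have "(\<integral>z. \<bar>a z * b (z + w)\<bar> \<partial>lborel) = (\<integral>z. \<bar>a z\<bar> * \<bar>b (z + w)\<bar> \<partial>lborel)"
      by (simp add: abs_mult)
    also have "\<dots> \<le> \<bar>\<integral>z. \<bar>a z\<bar> * \<bar>b (z + w)\<bar> \<partial>lborel\<bar>" by simp
    also have "\<dots> \<le> sqrt (\<integral>z. \<bar>a z\<bar>\<^sup>2 \<partial>lborel) * sqrt (\<integral>z. \<bar>b (z + w)\<bar>\<^sup>2 \<partial>lborel)"
      by (rule Cauchy_Schwarz_integral) (use a2 bs2 in auto)
    also have "\<dots> = A * B"
      using integral_translate[OF b2, of w] by (simp add: A_def B_def)
    finally show ?thesis .
  qed
  show ?thesis
  proof (rule lborel_pair.Fubini_integrable)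
    show "(\<lambda>(s, z). indicator {0..h} s * (a z * b (z + s *\<^sub>R v))) \<in> borel_measurable (lborel \<Otimes>\<^sub>M lborel)"
      by measurable
    have "(\<lambda>s. \<integral>z. norm (indicator {0..h} s * (a z * b (z + s *\<^sub>R v))) \<partial>lborel) \<in> borel_measurable lborel"
      by measurable
    moreover have "AE s in lborel. norm (\<integral>z. norm (indicator {0..h} s * (a z * b (z + s *\<^sub>R v))) \<partial>lborel)
        \<le> norm (A * B * indicator {0..h} s)"
      using order_trans[OF abs_bound abs_ge_self] by (intro AE_I2) (auto simp: indicator_def)
    moreover have "integrable lborel (\<lambda>s. A * B * indicator {0..h} s)"
      by (intro integrable_mult_right) (auto simp: integrable_indicator_iff emeasure_lborel_Icc_eq)
    ultimately show "integrable lborel (\<lambda>s. \<integral>z. norm (case (s, z) of (s, z) \<Rightarrow> indicator {0..h} s * (a z * b (z + s *\<^sub>R v))) \<partial>lborel)"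
      by (simp only: prod.case) (rule Bochner_Integration.integrable_bound)
    show "AE s in lborel. integrable lborel (\<lambda>z. case (s, z) of (s, z) \<Rightarrow> indicator {0..h} s * (a z * b (z + s *\<^sub>R v)))"
      using a2 bs2 by (intro AE_I2) (auto intro!: integrable_mult_right integrable_mult_L2)
  qed
qed

text \<open>By Fubini the pairing with a Steklov average is the average of the pairings with small
  shifts, and these are near the unshifted pairing. The direction \<open>v\<close> is general
  because averages are taken forward in space and backward in time.\<close>

lemma L2_average_limit:
  fixes a b :: "'a::euclidean_space \<Rightarrow> real"
  assumes a[measurable]: "a \<in> borel_measurable borel" and a2: "integrable lborel (\<lambda>x. (a x)\<^sup>2)"
    and b[measurable]: "b \<in> borel_measurable borel" and b2: "integrable lborel (\<lambda>x. (b x)\<^sup>2)"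
  shows "(\<lambda>n. \<integral>z. a z * (real (Suc n) * (\<integral>s. indicator {0..1 / real (Suc n)} s * b (z + s *\<^sub>R v) \<partial>lborel)) \<partial>lborel)
    \<longlonglongrightarrow> (\<integral>z. a z * b z \<partial>lborel)"
proof (rule LIMSEQ_I)
  fix e :: real assume e: "e > 0"
  define c where "c s = (\<integral>z. a z * b (z + s *\<^sub>R v) \<partial>lborel)" for s
  obtain d where d: "d > 0" "\<And>w. norm w < d \<Longrightarrow> \<bar>(\<integral>z. a z * b (z + w) \<partial>lborel) - (\<integral>z. a z * b z \<partial>lborel)\<bar> < e / 2"
    using L2_translation_weakly_continuous[OF a a2 b b2, of "e / 2"] e by auto
  have int: "integrable (lborel \<Otimes>\<^sub>M lborel) (\<lambda>(s, z). indicator {0..h} s * (a z * b (z + s *\<^sub>R v)))"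
    for h :: real
    by (rule L2_shift_product_integrable[OF a a2 b b2])
  obtain N :: nat where N: "norm v / d < real N"
    using reals_Archimedean2 by blast
  show "\<exists>no. \<forall>n\<ge>no. norm ((\<integral>z. a z * (real (Suc n) * (\<integral>s. indicator {0..1 / real (Suc n)} s * b (z + s *\<^sub>R v) \<partial>lborel)) \<partial>lborel)
      - (\<integral>z. a z * b z \<partial>lborel)) < e"
  proof (intro exI[of _ N] allI impI)
    fix n assume "n \<ge> N"
    define h where "h = 1 / real (Suc n)"
    have h: "h > 0" "real (Suc n) * h = 1" by (auto simp: h_def)
    have close: "\<bar>c s - (\<integral>z. a z * b z \<partial>lborel)\<bar> \<le> e / 2" if "s \<in> {0..h}" for s
    proof -
      have "norm v < d * real (Suc n)"
        using N \<open>n \<ge> N\<close> d(1) by (simp add: field_simps) (smt (verit) of_nat_le_iff mult_left_mono)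
      then have "h * norm v < d"
        by (simp add: h_def field_simps)
      moreover have "norm (s *\<^sub>R v) \<le> h * norm v"
        using that by (auto intro: mult_right_mono)
      ultimately have "norm (s *\<^sub>R v) < d" by linarith
      from d(2)[OF this] show ?thesis by (simp add: c_def)
    qed
    have "(\<integral>z. a z * (real (Suc n) * (\<integral>s. indicator {0..h} s * b (z + s *\<^sub>R v) \<partial>lborel)) \<partial>lborel)
       = real (Suc n) * (\<integral>z. (\<integral>s. indicator {0..h} s * (a z * b (z + s *\<^sub>R v)) \<partial>lborel) \<partial>lborel)"
      by (subst integral_mult_right_zero[symmetric]) (simp add: ac_simps del: integral_mult_right_zero flip: integral_mult_right_zero)
    also have "(\<integral>z. (\<integral>s. indicator {0..h} s * (a z * b (z + s *\<^sub>R v)) \<partial>lborel) \<partial>lborel)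
       = (\<integral>s. (\<integral>z. indicator {0..h} s * (a z * b (z + s *\<^sub>R v)) \<partial>lborel) \<partial>lborel)"
      by (rule lborel_pair.Fubini_integral[OF int])
    also have "\<dots> = (\<integral>s. indicator {0..h} s * c s \<partial>lborel)"
      by (simp add: c_def)
    finally have eq: "(\<integral>z. a z * (real (Suc n) * (\<integral>s. indicator {0..h} s * b (z + s *\<^sub>R v) \<partial>lborel)) \<partial>lborel)
      = real (Suc n) * (\<integral>s. indicator {0..h} s * c s \<partial>lborel)" .
    define c0 where "c0 = (\<integral>z. a z * b z \<partial>lborel)"
    have i0: "integrable lborel (\<lambda>s. indicator {0..h} s * k)" for k :: real
      by (intro integrable_mult_left) (auto simp: integrable_indicator_iff emeasure_lborel_Icc_eq)
    have ic: "integrable lborel (\<lambda>s. indicator {0..h} s * c s)"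
      using lborel_pair.integrable_fst[OF int[of h]] by (simp add: c_def)
    have "c0 = real (Suc n) * (\<integral>s. indicator {0..h} s * c0 \<partial>lborel)"
      using h by simp
    then have "\<bar>real (Suc n) * (\<integral>s. indicator {0..h} s * c s \<partial>lborel) - c0\<bar>
       = \<bar>real (Suc n) * (\<integral>s. indicator {0..h} s * c s - indicator {0..h} s * c0 \<partial>lborel)\<bar>"
      using ic i0[of c0] by (simp only: Bochner_Integration.integral_diff right_diff_distrib)
    also have "\<dots> \<le> real (Suc n) * (\<integral>s. \<bar>indicator {0..h} s * c s - indicator {0..h} s * c0\<bar> \<partial>lborel)"
      unfolding abs_mult abs_of_nat by (intro mult_left_mono integral_abs_bound) auto
    also have "\<dots> \<le> real (Suc n) * (\<integral>s. indicator {0..h} s * (e / 2) \<partial>lborel)"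
    proof (intro mult_left_mono integral_mono i0)
      show "integrable lborel (\<lambda>s. \<bar>indicator {0..h} s * c s - indicator {0..h} s * c0\<bar>)"
        using ic i0[of c0] by auto
      show "\<bar>indicator {0..h} s * c s - indicator {0..h} s * c0\<bar> \<le> indicator {0..h} s * (e / 2)" for s
        using close[of s] by (auto simp: indicator_def c0_def)
    qed auto
    also have "\<dots> = e / 2" using h by simp
    finally show "norm ((\<integral>z. a z * (real (Suc n) * (\<integral>s. indicator {0..1 / real (Suc n)} s * b (z + s *\<^sub>R v) \<partial>lborel)) \<partial>lborel)
      - (\<integral>z. a z * b z \<partial>lborel)) < e"
      using e unfolding h_def[symmetric] eq c0_def[symmetric] by simp
  qed
qed

section \<open>Pairing with functions of bounded variation\<close>

lemma lborel_on_UNIV: "lborel_on (UNIV :: 'a::euclidean_space set) = lborel"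
  by (rule measure_eqI) (auto simp: sets_restrict_space emeasure_restrict_space)

lemma antiderivative_exists:
  fixes f :: "real \<Rightarrow> real"
  assumes "continuous_on UNIV f"
  shows "\<exists>F. \<forall>x. (F has_real_derivative f x) (at x)"
  using einterval_antiderivative[of "-\<infinity>" "\<infinity>" f] assms
  by (auto simp: continuous_on_eq_continuous_at has_real_derivative_iff_has_vector_derivative)

text \<open>The test functions are cut-off Steklov averages of \<open>- f\<close>: these are \<open>C^1\<close>, bounded by 1,
  and their derivatives are averages of \<open>- g\<close>, which converge weakly in \<open>L^2\<close>.\<close>

lemma TV_dual_bound:
  assumes w: "w \<in> BV UNIV" and w2: "integrable lborel (\<lambda>x. (w x)\<^sup>2)"
    and f: "primitive_on UNIV f g" and f1: "\<And>x. \<bar>f x\<bar> \<le> 1"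
    and g[measurable]: "g \<in> borel_measurable borel" and g2: "integrable lborel (\<lambda>x. (g x)\<^sup>2)"
  shows "ennreal (- (\<integral>x. g x * w x \<partial>lborel)) \<le> TV UNIV w"
proof -
  have iw: "integrable lborel w" and loc: "loc_integrable UNIV w"
    using w by (auto simp: BV_def L1_def lborel_on_UNIV TV_def split: if_splits)
  have [measurable]: "w \<in> borel_measurable borel" using iw by auto
  have cf: "continuous_on UNIV f"
    by (rule primitive_on_continuous_open[OF f]) auto
  have [measurable]: "f \<in> borel_measurable borel"
    by (rule borel_measurable_continuous_onI cf)+
  obtain \<Phi> where \<Phi>: "\<And>x. (\<Phi> has_real_derivative f x) (at x)"
    using antiderivative_exists[OF cf] by blast
  \<comment> \<open>\<open>S h\<close> is the average of \<open>f\<close> over [x, x + h], written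
    with an antiderivative of \<open>f\<close>, and \<open>D h\<close> is its continuous
    derivative.\<close>
  define D where "D h x = (f (x + h) - f x) / h" for h x
  define S where "S h x = (\<Phi> (x + h) - \<Phi> x) / h" for h x
  have S: "(S h has_real_derivative D h x) (at x)" for h x
  proof -
    have "((\<lambda>x. \<Phi> (x + h)) has_real_derivative f (x + h)) (at x)"
      using DERIV_shift[of \<Phi> "f (x + h)" x h] \<Phi> by simp
    then show ?thesis
      unfolding S_def[abs_def] D_def by (intro DERIV_cdivide DERIV_diff \<Phi>)
  qed
  have S1: "\<bar>S h x\<bar> \<le> 1" if "h > 0" for h x
  proof -
    obtain z where "\<Phi> (x + h) - \<Phi> x = (x + h - x) * f z"
      using MVT2[of x "x + h" \<Phi> f] \<Phi> \<open>h > 0\<close> by auto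
    then show ?thesis using f1[of z] that by (simp add: S_def)
  qed
  have cS: "continuous_on UNIV (S h)" for h
    by (rule continuous_at_imp_continuous_on) (blast intro: DERIV_isCont S)
  have cD: "continuous_on UNIV (D h)" for h
    unfolding D_def divide_inverse by (intro continuous_intros continuous_on_compose2[OF cf]) auto
  have [measurable]: "S h \<in> borel_measurable borel" "D h \<in> borel_measurable borel" for h
    by (rule borel_measurable_continuous_onI cS cD)+
  have D1: "\<bar>D h x\<bar> \<le> 2 / h" if "h > 0" for h x
    using f1[of x] f1[of "x + h"] that by (auto simp: D_def abs_le_iff field_simps)
  have step1: "ennreal (- (\<integral>x. w x * D h x \<partial>lborel)) \<le> TV UNIV w" if h: "h > 0" for h
  proof -
    define cut where "cut r = bump 1 (- real r) (real r)" for r :: nat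
    define cut' where "cut' r x = tent_kernel 1 (- real r) x - tent_kernel 1 (real r) x" for r :: nat and x
    define \<phi> where "\<phi> r x = - (cut r x * S h x)" for r x
    define \<phi>' where "\<phi>' r x = - (cut' r x * S h x + cut r x * D h x)" for r x
    have [measurable]: "cut r \<in> borel_measurable borel" "cut' r \<in> borel_measurable borel" for r
      unfolding cut_def cut'_def[abs_def] by measurable
    have d\<phi>: "(\<phi> r has_real_derivative \<phi>' r x) (at x)" for r x
      unfolding \<phi>_def[abs_def] \<phi>'_def cut_def cut'_def
      by (auto intro!: derivative_eq_intros DERIV_bump S)
    have c\<phi>': "continuous_on UNIV (\<phi>' r)" for r
      unfolding \<phi>'_def cut_def cut'_def
      by (intro continuous_intros continuous_tent_kernel continuous_bump cS cD)
    have cutr: "0 \<le> cut r x" "cut r x \<le> 1" for r x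
      unfolding cut_def by (rule bump_range; simp)+
    have cut'r: "\<bar>cut' r x\<bar> \<le> 2" for r x
      using tent_le[of "x + real r"] tent_le[of "x - real r"] tent_nonneg[of "x + real r"] tent_nonneg[of "x - real r"]
      by (auto simp: cut'_def tent_kernel_def)
    have "\<phi> r \<in> C1c UNIV" for r
      unfolding C1c_def compact_support_in_def
    proof (intro CollectI conjI exI[of _ "{- real r..real r + 1/1}"])
      show "Ck_on UNIV 1 (\<phi> r)" by (rule Ck_on_1I[OF d\<phi> c\<phi>'])
      show "\<forall>p\<in>UNIV - {- real r..real r + 1 / 1}. \<phi> r p = 0"
        using bump_eq_0[of 1 "- real r" "real r"] by (auto simp: \<phi>_def cut_def)
    qed auto
    moreover have "\<bar>\<phi> r x\<bar> \<le> 1" for r x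
      using mult_mono[of "\<bar>cut r x\<bar>" 1 "\<bar>S h x\<bar>" 1] cutr[of r x] S1[OF h, of x] by (simp add: \<phi>_def abs_mult)
    ultimately have "ennreal (\<integral>x. w x * deriv (\<phi> r) x \<partial>lborel) \<le> TV UNIV w" for r
      unfolding TV_def using loc by (auto simp: lborel_on_UNIV intro!: SUP_upper2[of "\<phi> r"])
    moreover have "deriv (\<phi> r) = \<phi>' r" for r
      by (rule ext, rule DERIV_imp_deriv, rule d\<phi>)
    ultimately have le: "ennreal (\<integral>x. w x * \<phi>' r x \<partial>lborel) \<le> TV UNIV w" for r
      by simp
    \<comment> \<open>The cut-off is removed at fixed \<open>h\<close>, where
      \<open>2 + 2 / h\<close> bounds \<open>\<phi>'\<close> and \<open>w\<close> is integrable.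
      Only afterwards does \<open>h\<close> tend to 0, by weak convergence.\<close>
    have "(\<lambda>r. \<integral>x. w x * \<phi>' r x \<partial>lborel) \<longlonglongrightarrow> (\<integral>x. w x * - D h x \<partial>lborel)"
    proof (rule integral_dominated_convergence[where w = "\<lambda>x. (2 + 2 / h) * \<bar>w x\<bar>"])
      show "integrable lborel (\<lambda>x. (2 + 2 / h) * \<bar>w x\<bar>)" using iw by auto
      show "AE x in lborel. (\<lambda>r. w x * \<phi>' r x) \<longlonglongrightarrow> w x * - D h x"
      proof (intro AE_I2 tendsto_mult tendsto_const tendsto_eventually)
        fix x
        obtain N :: nat where N: "\<bar>x\<bar> + 2 \<le> real N" using real_arch_simple by blast
        show "\<forall>\<^sub>F r in sequentially. \<phi>' r x = - D h x"
          using eventually_ge_at_top[of N]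
        proof eventually_elim
          case (elim r)
          then have r: "\<bar>x\<bar> + 2 \<le> real r" using N by linarith
          have "cut' r x = 0"
          proof -
            have "x + real r > 1" "x - real r < 0" using r by linarith+
            then show ?thesis
              using tent_eq_0[of "x + real r"] tent_eq_0[of "x - real r"]
              by (simp add: cut'_def tent_kernel_def)
          qed
          moreover have "cut r x = 1"
            using r by (simp add: cut_def bump_def smooth_step_eq_1 smooth_step_eq_0)
          ultimately show ?case by (simp add: \<phi>'_def)
        qed
      qed
      show "AE x in lborel. norm (w x * \<phi>' r x) \<le> (2 + 2 / h) * \<bar>w x\<bar>" for r
      proof (rule AE_I2)
        fix x
        have "\<bar>\<phi>' r x\<bar> \<le> \<bar>cut' r x\<bar> * \<bar>S h x\<bar> + \<bar>cut r x\<bar> * \<bar>D h x\<bar>"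
          unfolding \<phi>'_def abs_minus_cancel abs_mult[symmetric] by (rule abs_triangle_ineq)
        also have "\<dots> \<le> 2 * 1 + 1 * (2 / h)"
          using cutr[of r x] by (intro add_mono mult_mono cut'r S1[OF h] D1[OF h]) auto
        finally show "norm (w x * \<phi>' r x) \<le> (2 + 2 / h) * \<bar>w x\<bar>"
          using mult_left_mono[of "\<bar>\<phi>' r x\<bar>" "2 + 2 / h" "\<bar>w x\<bar>"] by (simp add: abs_mult mult.commute)
      qed
    next
      show "(\<lambda>x. w x * - D h x) \<in> borel_measurable lborel" by measurable
      show "(\<lambda>x. w x * \<phi>' r x) \<in> borel_measurable lborel" for r
        unfolding \<phi>'_def by measurable
    qed
    then have "(\<lambda>r. ennreal (\<integral>x. w x * \<phi>' r x \<partial>lborel)) \<longlonglongrightarrow> ennreal (\<integral>x. w x * - D h x \<partial>lborel)"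
      by (rule tendsto_ennrealI)
    then have "ennreal (\<integral>x. w x * - D h x \<partial>lborel) \<le> TV UNIV w"
      by (rule LIMSEQ_le_const2) (use le in auto)
    then show ?thesis by simp
  qed
  have Deq: "D (1 / real (Suc n)) x = real (Suc n) * (\<integral>s. indicator {0..1 / real (Suc n)} s * g (x + s *\<^sub>R 1) \<partial>lborel)" for n x
    using primitive_onD(2)[OF f, of x "x + 1 / real (Suc n)"] integral_Icc_shift[of x "1 / real (Suc n)" g]
    by (simp add: D_def field_simps del: of_nat_Suc)
  have "(\<lambda>n. \<integral>x. w x * D (1 / real (Suc n)) x \<partial>lborel) \<longlonglongrightarrow> (\<integral>x. w x * g x \<partial>lborel)"
    unfolding Deq by (rule L2_average_limit) (use w2 g2 in auto)
  then have "(\<lambda>n. ennreal (- (\<integral>x. w x * D (1 / real (Suc n)) x \<partial>lborel))) \<longlonglongrightarrow> ennreal (- (\<integral>x. w x * g x \<partial>lborel))"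
    by (intro tendsto_ennrealI tendsto_minus)
  then have "ennreal (- (\<integral>x. w x * g x \<partial>lborel)) \<le> TV UNIV w"
    by (rule LIMSEQ_le_const2) (use step1 in auto)
  then show ?thesis by (simp add: mult.commute)
qed

section \<open>Test functions in the plane\<close>

text \<open>\<open>Ck_on\<close> refers to \<open>frechet_derivative\<close> within the set, which
  is a choice; computing it from a known derivative requires uniqueness, also at boundary points of
  the closed half-plane.\<close>

definition unique_derivative_set :: "(real \<times> real) set \<Rightarrow> bool" where
  "unique_derivative_set S \<longleftrightarrow> (\<forall>p\<in>S. \<forall>f D D'. (f has_derivative D) (at p within S) \<longrightarrow>
     (f has_derivative D') (at p within S) \<longrightarrow> D = (D' :: real \<times> real \<Rightarrow> real))"

lemma unique_derivative_open: "open S \<Longrightarrow> unique_derivative_set S"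
  unfolding unique_derivative_set_def using at_within_open has_derivative_unique by metis

lemma unique_derivative_half_plane: "unique_derivative_set ({0..} \<times> UNIV)"
  unfolding unique_derivative_set_def
proof (intro ballI allI impI)
  fix p and f D D' :: "real \<times> real \<Rightarrow> real"
  assume p: "p \<in> {0..} \<times> (UNIV :: real set)"
    and D: "(f has_derivative D) (at p within {0..} \<times> UNIV)" "(f has_derivative D') (at p within {0..} \<times> UNIV)"
  show "D = D'"
  proof (rule frechet_derivative_unique_within[OF D])
    fix i :: "real \<times> real" and e :: real assume "i \<in> Basis" "e > 0"
    then show "\<exists>d. 0 < \<bar>d\<bar> \<and> \<bar>d\<bar> < e \<and> p + d *\<^sub>R i \<in> {0..} \<times> UNIV"
      using p by (intro exI[of _ "e / 2"]) (auto simp: Basis_prod_def)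
  qed
qed

lemma Ck_on_1_planeI:
  assumes S: "unique_derivative_set S" and f: "\<And>p. (f has_derivative D p) (at p)"
    and c: "\<And>v. continuous_on UNIV (\<lambda>p. D p v)"
  shows "Ck_on S 1 f"
  unfolding One_nat_def Ck_on.simps
proof (intro conjI allI)
  show "f differentiable_on S"
    using f by (auto simp: differentiable_on_def differentiable_def intro: has_derivative_at_withinI)
  show "continuous_on S (\<lambda>p. frechet_derivative f (at p within S) v)" for v
  proof (rule continuous_on_eq[of S "\<lambda>p. D p v"])
    show "continuous_on S (\<lambda>p. D p v)" by (rule continuous_on_subset[OF c]) simp
    fix p assume p: "p \<in> S"
    have 1: "(f has_derivative D p) (at p within S)" by (rule has_derivative_at_withinI[OF f])
    then have "f differentiable (at p within S)" unfolding differentiable_def by blast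
    then have "(f has_derivative frechet_derivative f (at p within S)) (at p within S)"
      by (simp add: frechet_derivative_works)
    with 1 S p have "D p = frechet_derivative f (at p within S)"
      unfolding unique_derivative_set_def by blast
    then show "D p v = frechet_derivative f (at p within S) v" by simp
  qed
qed

lemma tensor_has_derivative:
  assumes "\<And>t. (\<phi> has_real_derivative \<phi>' t) (at t)" "\<And>x. (\<psi> has_real_derivative \<psi>' x) (at x)"
  shows "((\<lambda>p. \<phi> (fst p) * \<psi> (snd p)) has_derivative
     (\<lambda>v. \<phi>' (fst p) * fst v * \<psi> (snd p) + \<phi> (fst p) * (\<psi>' (snd p) * snd v))) (at p)"
proof -
  have 1: "((\<lambda>p. \<phi> (fst p)) has_derivative (\<lambda>v. \<phi>' (fst p) * fst v)) (at p)"
    using has_derivative_compose[of fst fst p UNIV \<phi> "(*) (\<phi>' (fst p))"] assms(1)[of "fst p"]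
    by (simp add: has_field_derivative_def has_derivative_fst)
  have 2: "((\<lambda>p. \<psi> (snd p)) has_derivative (\<lambda>v. \<psi>' (snd p) * snd v)) (at p)"
    using has_derivative_compose[of snd snd p UNIV \<psi> "(*) (\<psi>' (snd p))"] assms(2)[of "snd p"]
    by (simp add: has_field_derivative_def has_derivative_snd)
  show ?thesis
    by (rule has_derivative_eq_rhs[OF has_derivative_mult[OF 1 2]]) (auto simp: fun_eq_iff)
qed

lemma
  fixes a b n a' b' n' :: real
  assumes S: "unique_derivative_set S" and n: "n > 0" "n' > 0" "a \<le> b" "a' \<le> b'"
    and sub: "{a..b + 1/n} \<times> {a'..b' + 1/n'} \<subseteq> S"
  shows bump_tensor_C1c: "(\<lambda>p. bump n a b (fst p) * bump n' a' b' (snd p)) \<in> C1c S"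
    and dt_bump_tensor: "dt (\<lambda>p. bump n a b (fst p) * bump n' a' b' (snd p)) p
      = (tent_kernel n a (fst p) - tent_kernel n b (fst p)) * bump n' a' b' (snd p)"
    and dx_bump_tensor: "dx (\<lambda>p. bump n a b (fst p) * bump n' a' b' (snd p)) p
      = bump n a b (fst p) * (tent_kernel n' a' (snd p) - tent_kernel n' b' (snd p))"
proof -
  let ?k = "\<lambda>t. tent_kernel n a t - tent_kernel n b t" and ?l = "\<lambda>x. tent_kernel n' a' x - tent_kernel n' b' x"
  note D = tensor_has_derivative[of "bump n a b" ?k "bump n' a' b'" ?l, OF DERIV_bump DERIV_bump]
  have "compact ({a..b + 1/n} \<times> {a'..b' + 1/n'})"
    by (intro compact_Times compact_Icc)
  moreover have "bump n a b (fst p) * bump n' a' b' (snd p) = 0" if "p \<notin> {a..b + 1/n} \<times> {a'..b' + 1/n'}" for p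
    using that bump_eq_0[OF n(1,3), of "fst p"] bump_eq_0[OF n(2,4), of "snd p"] by (cases p) auto
  moreover have "Ck_on S 1 (\<lambda>p. bump n a b (fst p) * bump n' a' b' (snd p))"
    by (rule Ck_on_1_planeI[OF S D])
       (intro continuous_intros continuous_on_compose2[OF continuous_tent_kernel[of UNIV]]
         continuous_on_compose2[OF continuous_bump[of UNIV]]; simp)
  ultimately show "(\<lambda>p. bump n a b (fst p) * bump n' a' b' (snd p)) \<in> C1c S"
    using sub unfolding C1c_def compact_support_in_def by blast
  note fd = frechet_derivative_at[OF D, symmetric]
  show "dt (\<lambda>p. bump n a b (fst p) * bump n' a' b' (snd p)) p = ?k (fst p) * bump n' a' b' (snd p)"
    "dx (\<lambda>p. bump n a b (fst p) * bump n' a' b' (snd p)) p = bump n a b (fst p) * ?l (snd p)"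
    by (simp_all add: dt_def dx_def fd)
qed

lemma C1c_plane_obtain:
  assumes \<phi>: "\<phi> \<in> C1c S" and S: "open S"
  obtains K where "compact K" "K \<subseteq> S" "\<And>p. p \<in> S - K \<Longrightarrow> \<phi> p = 0" "\<And>p. p \<in> S - K \<Longrightarrow> dx \<phi> p = 0"
    "continuous_on S \<phi>" "continuous_on S (dx \<phi>)"
    "\<And>t x. (t, x) \<in> S \<Longrightarrow> ((\<lambda>x. \<phi> (t, x)) has_real_derivative dx \<phi> (t, x)) (at x)"
proof -
  have D: "\<phi> differentiable_on S" and c: "continuous_on S (\<lambda>p. frechet_derivative \<phi> (at p within S) v)" for v
    using \<phi> unfolding C1c_def by (auto, cases v, auto)
  obtain K where K: "compact K" "K \<subseteq> S" "\<And>p. p \<in> S - K \<Longrightarrow> \<phi> p = 0"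
    using \<phi> unfolding C1c_def compact_support_in_def by blast
  have fd: "(\<phi> has_derivative frechet_derivative \<phi> (at p)) (at p)" if "p \<in> S" for p
  proof -
    have "\<phi> differentiable (at p within S)"
      using D that by (simp only: differentiable_on_def)
    then show ?thesis
      by (simp only: at_within_open[OF that S] frechet_derivative_works)
  qed
  show ?thesis
  proof (rule that[OF K(1,2)])
    show "\<phi> p = 0" if "p \<in> S - K" for p using K(3) that .
    show "continuous_on S \<phi>" using D by (rule differentiable_imp_continuous_on)
    show "continuous_on S (dx \<phi>)"
      by (rule continuous_on_eq[OF c[of "(0, 1)"]]) (simp add: dx_def at_within_open[OF _ S])
    show "dx \<phi> p = 0" if p: "p \<in> S - K" for p
    proof -
      have "open (S - K)" using S K(1) by (simp add: compact_imp_closed open_Diff)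
      then have "(\<phi> has_derivative (\<lambda>_. 0)) (at p)"
        using has_derivative_transform_within_open[OF has_derivative_const[of 0 "at p"], of "S - K" \<phi>] p K(3)
        by simp
      then have "frechet_derivative \<phi> (at p) = (\<lambda>_. 0)"
        using frechet_derivative_at by metis
      then show ?thesis by (simp add: dx_def)
    qed
    show "((\<lambda>x. \<phi> (t, x)) has_real_derivative dx \<phi> (t, x)) (at x)" if tx: "(t, x) \<in> S" for t x
    proof -
      have 1: "((\<lambda>x. (t, x)) has_derivative (\<lambda>h. (0, h))) (at x)"
        by (auto intro!: derivative_eq_intros)
      have "((\<lambda>x. \<phi> (t, x)) has_derivative (\<lambda>h. frechet_derivative \<phi> (at (t, x)) (0, h))) (at x)"
        by (rule has_derivative_compose[OF 1 fd[OF tx]])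
      moreover have "frechet_derivative \<phi> (at (t, x)) (0, h) = dx \<phi> (t, x) * h" for h
        using linear_scale[OF has_derivative_linear[OF fd[OF tx]], of h "(0, 1)"]
        by (simp add: dx_def)
      ultimately show ?thesis
        by (simp add: has_field_derivative_def)
    qed
  qed
qed

lemma compactly_supported_extension:
  fixes h :: "'a::euclidean_space \<Rightarrow> real"
  assumes c: "continuous_on S h" and K: "compact K" "K \<subseteq> S" "\<And>p. p \<in> S - K \<Longrightarrow> h p = 0"
  shows "(\<lambda>p. indicator S p * h p) \<in> borel_measurable borel"
    "integrable lborel (\<lambda>p. indicator S p * h p)"
    "integrable lborel (\<lambda>p. (indicator S p * h p)\<^sup>2)"
    "\<exists>C. \<forall>p. \<bar>indicator S p * h p\<bar> \<le> C"
proof -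
  have eq: "indicator S p * h p = indicator K p *\<^sub>R h p" for p
    using K(2,3) by (auto simp: indicator_def)
  have eq2: "(indicator S p * h p)\<^sup>2 = indicator K p *\<^sub>R (h p)\<^sup>2" for p
    unfolding eq by (simp add: indicator_def)
  have cK: "continuous_on K h" using c K(2) by (rule continuous_on_subset)
  show "integrable lborel (\<lambda>p. indicator S p * h p)"
    unfolding eq by (rule borel_integrable_compact[OF K(1) cK])
  then show "(\<lambda>p. indicator S p * h p) \<in> borel_measurable borel"
    by auto
  show "integrable lborel (\<lambda>p. (indicator S p * h p)\<^sup>2)"
    unfolding eq2 by (rule borel_integrable_compact[OF K(1)]) (intro continuous_intros cK)
  have "bounded (h ` K)"
    using K(1) cK by (intro compact_imp_bounded compact_continuous_image) auto
  then obtain C where "\<forall>y\<in>h ` K. norm y \<le> C"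
    unfolding bounded_iff by blast
  then have C: "\<bar>h p\<bar> \<le> C" if "p \<in> K" for p
    using that by auto
  show "\<exists>C. \<forall>p. \<bar>indicator S p * h p\<bar> \<le> C"
  proof (intro exI[of _ "max C 0"] allI)
    fix p
    show "\<bar>indicator S p * h p\<bar> \<le> max C 0"
      unfolding eq using C[of p] by (auto simp: indicator_def)
  qed
qed

text \<open>Makes the approximants of the Stone-Weierstrass theorem, multiplied by a cut-off,
  admissible as \<open>C^1\<close> test functions.\<close>

lemma real_polynomial_function_C1:
  fixes g :: "real \<times> real \<Rightarrow> real"
  assumes "real_polynomial_function g"
  shows "\<exists>D. (\<forall>p. (g has_derivative D p) (at p)) \<and> (\<forall>v. continuous_on UNIV (\<lambda>p. D p v))"
  using assms
proof induction
  case (linear f)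
  then show ?case
    by (intro exI[of _ "\<lambda>_. f"]) (auto intro: bounded_linear_imp_has_derivative)
next
  case (const c)
  show ?case by (intro exI[of _ "\<lambda>_ _. 0"]) auto
next
  case (add f g)
  then obtain D E where "\<forall>p. (f has_derivative D p) (at p)" "\<forall>v. continuous_on UNIV (\<lambda>p. D p v)"
    "\<forall>p. (g has_derivative E p) (at p)" "\<forall>v. continuous_on UNIV (\<lambda>p. E p v)" by blast
  then show ?case
    by (intro exI[of _ "\<lambda>p v. D p v + E p v"]) (auto intro!: has_derivative_add continuous_on_add)
next
  case (mult f g)
  then obtain D E where D: "\<forall>p. (f has_derivative D p) (at p)" "\<forall>v. continuous_on UNIV (\<lambda>p. D p v)"
    and E: "\<forall>p. (g has_derivative E p) (at p)" "\<forall>v. continuous_on UNIV (\<lambda>p. E p v)" by blast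
  have "continuous_on UNIV f" "continuous_on UNIV g"
    using D(1) E(1) by (auto intro!: continuous_at_imp_continuous_on has_derivative_continuous)
  then show ?case
    using D E by (intro exI[of _ "\<lambda>p v. f p * E p v + D p v * g p"])
      (auto intro!: has_derivative_mult continuous_intros)
qed

text \<open>With \<open>\<phi>0\<close> continuous and near \<open>w\<close> in \<open>L^2\<close>,
  and a polynomial \<open>g\<close> uniformly near \<open>\<phi>0\<close> on the support of the
  cut-off, the function \<open>cut * g\<close> is \<open>C^1\<close> with compact support. No
  convolution is involved.\<close>

lemma C1c_dense_strip:
  fixes w :: "real \<times> real \<Rightarrow> real"
  assumes w[measurable]: "w \<in> borel_measurable borel" and w2: "integrable lborel (\<lambda>p. (w p)\<^sup>2)"
    and w0: "\<And>p. p \<notin> strip T \<Longrightarrow> w p = 0" and T: "T > 0" and e: "e > 0"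
  shows "\<exists>\<phi>\<in>C1c (strip T). (\<forall>p. p \<notin> strip T \<longrightarrow> \<phi> p = 0) \<and> (\<integral>p. (w p - \<phi> p)\<^sup>2 \<partial>lborel) < e"
proof -
  have os: "open (strip T)" by (intro open_Times) auto
  \<comment> \<open>In time the cut-off rises over [1/N, 2/N] and falls over [T - 2/N, T - 1/N], so
    its support is a compact part of the strip. \<open>N0\<close> comes from
    \<open>3 / N \<le> T\<close>, which keeps the two ramps in order.\<close>
  define cut where "cut = (\<lambda>N p. bump (real N) (1 / real N) (T - 2 / real N) (fst p) * bump 1 (- real N) (real N) (snd p))"
  define N0 :: nat where "N0 = max 1 (nat \<lceil>3 / T\<rceil>)"
  have N0: "N > 0" "1 / real N \<le> T - 2 / real N" if "N \<ge> N0" for N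
  proof -
    show "N > 0" using that by (auto simp: N0_def)
    have "3 / T \<le> real N"
      using that unfolding N0_def by linarith
    then show "1 / real N \<le> T - 2 / real N"
      using T \<open>N > 0\<close> by (simp add: field_simps)
  qed
  have ccut: "continuous_on UNIV (cut N)" for N
    unfolding cut_def by (intro continuous_intros continuous_on_compose2[OF continuous_bump[of UNIV]]) auto
  have [measurable]: "cut N \<in> borel_measurable borel" for N
    by (rule borel_measurable_continuous_onI ccut)+
  have cutb: "0 \<le> cut N p" "cut N p \<le> 1" if "N \<ge> N0" for N p
  proof -
    show "0 \<le> cut N p"
      unfolding cut_def by (intro mult_nonneg_nonneg bump_range) (use N0[OF that] in auto)
    have "cut N p \<le> 1 * 1"
      unfolding cut_def by (intro mult_mono bump_range) (use N0[OF that] in auto)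
    then show "cut N p \<le> 1" by simp
  qed
  have cut1: "\<forall>\<^sub>F N in sequentially. cut N p = 1" if p: "p \<in> strip T" for p
  proof -
    obtain t x where tx: "p = (t, x)" by (cases p)
    have t: "0 < t" "t < T" using p tx by auto
    obtain M :: nat where M: "max (2 / t) (max (2 / (T - t)) (\<bar>x\<bar> + 1)) \<le> real M"
      using real_arch_simple by blast
    show ?thesis
      using eventually_ge_at_top[of "max 1 M"]
    proof eventually_elim
      case (elim N)
      then have N: "2 / t \<le> real N" "2 / (T - t) \<le> real N" "\<bar>x\<bar> + 1 \<le> real N" "real N > 0"
        using M by auto
      have "real N * (t - 1 / real N) = real N * t - 1" "real N * (t - (T - 2 / real N)) = 2 - real N * (T - t)"
        using N(4) by (simp_all add: field_simps)
      moreover have "real N * t \<ge> 2" "real N * (T - t) \<ge> 2"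
        using N t by (simp_all add: field_simps)
      moreover have "x + real N \<ge> 1" "x - real N \<le> 0" using N(3) by linarith+
      ultimately show ?case
        by (simp add: cut_def tx bump_def smooth_step_eq_0 smooth_step_eq_1)
    qed
  qed
  have "(\<lambda>N. \<integral>p. (w p - cut (N + N0) p * w p)\<^sup>2 \<partial>lborel) \<longlonglongrightarrow> (\<integral>p. 0 \<partial>(lborel :: (real \<times> real) measure))"
  proof (rule integral_dominated_convergence[where w = "\<lambda>p. (w p)\<^sup>2"])
    show "AE p in lborel. (\<lambda>N. (w p - cut (N + N0) p * w p)\<^sup>2) \<longlonglongrightarrow> 0"
    proof (rule AE_I2, rule tendsto_eventually)
      fix p
      show "\<forall>\<^sub>F N in sequentially. (w p - cut (N + N0) p * w p)\<^sup>2 = 0"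
      proof (cases "p \<in> strip T")
        case True
        have "\<forall>\<^sub>F N in sequentially. cut (N + N0) p = 1"
          using cut1[OF True] by (rule eventually_sequentially_seg[THEN iffD2])
        then show ?thesis by eventually_elim simp
      next
        case False
        then show ?thesis using w0 by simp
      qed
    qed
    show "AE p in lborel. norm ((w p - cut (N + N0) p * w p)\<^sup>2) \<le> (w p)\<^sup>2" for N
    proof (rule AE_I2)
      fix p
      have "\<bar>1 - cut (N + N0) p\<bar> \<le> 1" using cutb[of "N + N0" p] by auto
      then have "\<bar>(1 - cut (N + N0) p) * w p\<bar> \<le> \<bar>w p\<bar>"
        unfolding abs_mult by (rule mult_left_le_one_le[rotated 2]) auto
      then have "((1 - cut (N + N0) p) * w p)\<^sup>2 \<le> (w p)\<^sup>2"
        by (simp only: abs_le_square_iff)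
      then show "norm ((w p - cut (N + N0) p * w p)\<^sup>2) \<le> (w p)\<^sup>2"
        by (simp add: left_diff_distrib)
    qed
  qed (use w2 in auto)
  then have "\<forall>\<^sub>F N in sequentially. (\<integral>p. (w p - cut (N + N0) p * w p)\<^sup>2 \<partial>lborel) < e / 8"
    using e by (intro order_tendstoD(2)) auto
  then obtain N' where N': "(\<integral>p. (w p - cut (N' + N0) p * w p)\<^sup>2 \<partial>lborel) < e / 8"
    by (auto simp: eventually_sequentially)
  define N where "N = N' + N0"
  have N: "N \<ge> N0" by (simp add: N_def)
  note N' = N'[folded N_def]
  obtain \<phi>0 r where \<phi>0: "continuous_on UNIV \<phi>0" "integrable lborel (\<lambda>x. (\<phi>0 x)\<^sup>2)"
    "(\<integral>x. (w x - \<phi>0 x)\<^sup>2 \<partial>lborel) < e / 16"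
    using L2_dense_continuous_compact_support[OF w w2, of "e / 16"] e by auto
  have [measurable]: "\<phi>0 \<in> borel_measurable borel"
    by (rule borel_measurable_continuous_onI \<phi>0)+
  define K where "K = {1 / real N..T - 2 / real N + 1 / real N} \<times> {- real N..real N + 1 / 1}"
  have K: "compact K" "K \<subseteq> strip T"
  proof -
    show "compact K" unfolding K_def by (intro compact_Times compact_Icc)
    have "1 / real N > 0" "2 / real N = 1 / real N + 1 / real N" using N0[OF N] by simp_all
    then have "0 < t \<and> t < T" if "1 / real N \<le> t" "t \<le> T - 2 / real N + 1 / real N" for t
      using that by linarith
    then have "{1 / real N..T - 2 / real N + 1 / real N} \<subseteq> {0<..<T}"
      unfolding subset_iff atLeastAtMost_iff greaterThanLessThan_iff by blast
    then show "K \<subseteq> strip T" unfolding K_def by blast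
  qed
  have cut0: "cut N p = 0" if "p \<notin> K" for p
    using that bump_eq_0[of "real N" "1 / real N" "T - 2 / real N" "fst p"] bump_eq_0[of 1 "- real N" "real N" "snd p"] N0[OF N]
    by (cases p) (auto simp: K_def cut_def)
  define \<mu> where "\<mu> = measure lborel K"
  have iK: "integrable lborel (indicator K :: _ \<Rightarrow> real)"
    using borel_integrable_compact[OF K(1), of "\<lambda>_. 1 :: real"] by simp
  have \<mu>: "\<mu> \<ge> 0" "(\<integral>p. indicator K p \<partial>lborel) = \<mu>"
    by (simp_all add: \<mu>_def)
  \<comment> \<open>The error will be at most
    \<open>2 * (e/8) + 4 * (e/16) + 4 * \<delta>^2 * \<mu>\<close>, and this choice keeps the last
    term below \<open>e / 4\<close>.\<close>
  define \<delta> where "\<delta> = sqrt (e / (16 * (\<mu> + 1)))"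
  have \<delta>: "\<delta> > 0" "\<delta>\<^sup>2 = e / (16 * (\<mu> + 1))" using e \<mu>(1) by (simp_all add: \<delta>_def)
  obtain g where g: "real_polynomial_function g" "\<And>x. x \<in> K \<Longrightarrow> \<bar>\<phi>0 x - g x\<bar> < \<delta>"
    using Stone_Weierstrass_real_polynomial_function[OF K(1) continuous_on_subset[OF \<phi>0(1)] \<delta>(1)] by blast
  obtain D where D: "\<And>p. (g has_derivative D p) (at p)" "\<And>v. continuous_on UNIV (\<lambda>p. D p v)"
    using real_polynomial_function_C1[OF g(1)] by blast
  have cg: "continuous_on UNIV g"
    using D(1) by (auto intro!: continuous_at_imp_continuous_on has_derivative_continuous)
  have [measurable]: "g \<in> borel_measurable borel"
    by (rule borel_measurable_continuous_onI cg)+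
  define \<phi> where "\<phi> p = cut N p * g p" for p
  have \<phi>K: "\<phi> p = 0" if "p \<notin> K" for p using cut0[OF that] by (simp add: \<phi>_def)
  have "Ck_on (strip T) 1 \<phi>"
    unfolding \<phi>_def[abs_def]
  proof (rule Ck_on_1_planeI[OF unique_derivative_open[OF os]])
    let ?a = "1 / real N" and ?b = "T - 2 / real N"
    let ?D = "\<lambda>p v. (tent_kernel N ?a (fst p) - tent_kernel N ?b (fst p)) * fst v * bump 1 (- real N) (real N) (snd p)
      + bump N ?a ?b (fst p) * ((tent_kernel 1 (- real N) (snd p) - tent_kernel 1 (real N) (snd p)) * snd v)"
    show "((\<lambda>p. cut N p * g p) has_derivative (\<lambda>v. cut N p * D p v + ?D p v * g p)) (at p)" for p
      by (rule has_derivative_mult[OF _ D(1)]) (unfold cut_def, rule tensor_has_derivative[OF DERIV_bump DERIV_bump])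
    show "continuous_on UNIV (\<lambda>p. cut N p * D p v + ?D p v * g p)" for v
      by (intro continuous_intros ccut D(2) cg continuous_on_compose2[OF continuous_tent_kernel[of UNIV]]
         continuous_on_compose2[OF continuous_bump[of UNIV]]; simp)
  qed
  then have "\<phi> \<in> C1c (strip T)"
    unfolding C1c_def compact_support_in_def using K \<phi>K by blast
  moreover have "\<forall>p. p \<notin> strip T \<longrightarrow> \<phi> p = 0" using \<phi>K K(2) by blast
  moreover have "(\<integral>p. (w p - \<phi> p)\<^sup>2 \<partial>lborel) < e"
  proof -
    have [measurable]: "\<phi> \<in> borel_measurable borel" unfolding \<phi>_def by measurable
    have i1: "integrable lborel (\<lambda>p. (w p - cut N p * w p)\<^sup>2)"
    proof (rule Bochner_Integration.integrable_bound[OF w2])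
      show "AE p in lborel. norm ((w p - cut N p * w p)\<^sup>2) \<le> norm ((w p)\<^sup>2)"
      proof (rule AE_I2)
        fix p
        have "\<bar>1 - cut N p\<bar> \<le> 1" using cutb[OF N, of p] by auto
        then have "\<bar>(1 - cut N p) * w p\<bar> \<le> \<bar>w p\<bar>"
          unfolding abs_mult by (rule mult_left_le_one_le[rotated 2]) auto
        then have "((1 - cut N p) * w p)\<^sup>2 \<le> (w p)\<^sup>2"
          by (simp only: abs_le_square_iff)
        then show "norm ((w p - cut N p * w p)\<^sup>2) \<le> norm ((w p)\<^sup>2)"
          by (simp add: left_diff_distrib)
      qed
    qed measurable
    have i2: "integrable lborel (\<lambda>p. (w p - \<phi>0 p)\<^sup>2)"
      by (rule square_integrable_diff) (use w2 \<phi>0 in auto)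
    have pt: "(w p - \<phi> p)\<^sup>2 \<le> 2 * (w p - cut N p * w p)\<^sup>2 + 4 * (w p - \<phi>0 p)\<^sup>2 + 4 * \<delta>\<^sup>2 * indicator K p" for p
    proof (cases "p \<in> K")
      case True
      have "(w p - \<phi> p)\<^sup>2 \<le> 2 * (w p - cut N p * w p)\<^sup>2 + 2 * (cut N p * w p - \<phi> p)\<^sup>2"
        by (rule power2_diff_le)
      also have "(cut N p * w p - \<phi> p)\<^sup>2 = (cut N p)\<^sup>2 * (w p - g p)\<^sup>2"
        by (simp add: \<phi>_def power_mult_distrib[symmetric] right_diff_distrib)
      also have "\<dots> \<le> 1 * (w p - g p)\<^sup>2"
        using cutb[OF N, of p] by (intro mult_right_mono) (auto simp: power_le_one)
      also have "1 * (w p - g p)\<^sup>2 \<le> 2 * (w p - \<phi>0 p)\<^sup>2 + 2 * (\<phi>0 p - g p)\<^sup>2"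
        using power2_diff_le by simp
      also have "(\<phi>0 p - g p)\<^sup>2 \<le> \<delta>\<^sup>2"
        using g(2)[OF True] \<delta>(1) by (intro power2_le_iff_abs_le[THEN iffD2]) auto
      finally show ?thesis using True by simp
    next
      case False
      then show ?thesis using cut0[OF False] \<phi>K[OF False] by simp
    qed
    have iR: "integrable lborel (\<lambda>p. 2 * (w p - cut N p * w p)\<^sup>2 + 4 * (w p - \<phi>0 p)\<^sup>2 + 4 * \<delta>\<^sup>2 * indicator K p)"
      using i1 i2 iK by auto
    have "(\<integral>p. (w p - \<phi> p)\<^sup>2 \<partial>lborel) \<le>
       (\<integral>p. 2 * (w p - cut N p * w p)\<^sup>2 + 4 * (w p - \<phi>0 p)\<^sup>2 + 4 * \<delta>\<^sup>2 * indicator K p \<partial>lborel)"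
    proof (rule integral_mono[OF _ iR pt])
      show "integrable lborel (\<lambda>p. (w p - \<phi> p)\<^sup>2)"
        by (rule Bochner_Integration.integrable_bound[OF iR], measurable)
           (use pt in \<open>auto intro!: AE_I2 order_trans[OF pt abs_ge_self]\<close>)
    qed
    also have "\<dots> = 2 * (\<integral>p. (w p - cut N p * w p)\<^sup>2 \<partial>lborel) + 4 * (\<integral>p. (w p - \<phi>0 p)\<^sup>2 \<partial>lborel) + 4 * \<delta>\<^sup>2 * \<mu>"
      using i1 i2 iK \<mu>(2) by simp
    also have "4 * \<delta>\<^sup>2 * \<mu> \<le> e / 4"
      using e \<mu>(1) unfolding \<delta>(2) by (simp add: field_simps)
    finally show ?thesis using N' \<phi>0(3) e by simp
  qed
  ultimately show ?thesis by blast
qed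

section \<open>Regularity of the viscoplastic solutions\<close>

lemma loc_integrable_borel_measurable:
  fixes g :: "real \<Rightarrow> real"
  assumes "loc_integrable UNIV g"
  shows "g \<in> borel_measurable borel"
proof (rule borel_measurable_LIMSEQ_real)
  show "(\<lambda>x. indicator {- real n..real n} x * g x) \<in> borel_measurable borel" for n
  proof -
    have "set_integrable lborel {- real n..real n} g"
      using assms compact_Icc by (auto simp: loc_integrable_def)
    then show ?thesis by (auto simp: set_integrable_def dest!: borel_measurable_integrable)
  qed
  show "(\<lambda>n. indicator {- real n..real n} x * g x) \<longlonglongrightarrow> g x" for x
  proof (rule tendsto_eventually)
    obtain N :: nat where "\<bar>x\<bar> \<le> real N" using real_arch_simple by blast
    then have "x \<in> {- real n..real n}" if "n \<ge> N" for n
      using that by (auto simp: abs_le_iff)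
    then show "\<forall>\<^sub>F n in sequentially. indicator {- real n..real n} x * g x = g x"
      by (intro eventually_mono[OF eventually_ge_at_top[of N]]) simp
  qed
qed

lemma weak_deriv_wderiv: "weak_deriv f g \<Longrightarrow> weak_deriv f (wderiv f)"
  unfolding wderiv_def using someI_ex[of "\<lambda>g. weak_deriv f g"] by blast

lemma weak_deriv_unique:
  assumes "weak_deriv f g" "weak_deriv f g'" "continuous_on UNIV f"
  shows "AE x in lborel. g x = g' x"
  using primitive_on_unique[OF weak_deriv_primitive[OF assms(1,3)] weak_deriv_primitive[OF assms(2,3)]]
  by simp

lemma integrable_square_cong_AE:
  fixes f g :: "real \<Rightarrow> real"
  assumes "AE x in lborel. f x = g x" "f \<in> borel_measurable borel" "g \<in> borel_measurable borel"
  shows "integrable lborel (\<lambda>x. (f x)\<^sup>2) \<longleftrightarrow> integrable lborel (\<lambda>x. (g x)\<^sup>2)"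
    "(\<integral>x. (f x)\<^sup>2 \<partial>lborel) = (\<integral>x. (g x)\<^sup>2 \<partial>lborel)"
proof -
  have ae: "AE x in lborel. (f x)\<^sup>2 = (g x)\<^sup>2"
    using assms(1) by eventually_elim simp
  show "integrable lborel (\<lambda>x. (f x)\<^sup>2) \<longleftrightarrow> integrable lborel (\<lambda>x. (g x)\<^sup>2)"
    by (rule integrable_cong_AE[OF _ _ ae]) (use assms in auto)
  show "(\<integral>x. (f x)\<^sup>2 \<partial>lborel) = (\<integral>x. (g x)\<^sup>2 \<partial>lborel)"
    by (rule integral_cong_AE[OF _ _ ae]) (use assms in auto)
qed

text \<open>\<open>H2_norm\<close> speaks of the representative chosen by \<open>wderiv\<close>.
  Uniqueness of weak derivatives of continuous functions carries the bounds over to the given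
  \<open>g\<close>.\<close>

lemma H2_weak_deriv:
  assumes f: "f \<in> H2" "continuous_on UNIV f" and g: "weak_deriv f g"
  shows "g \<in> borel_measurable borel" "integrable lborel (\<lambda>x. (g x)\<^sup>2)" "integrable lborel (\<lambda>x. (f x)\<^sup>2)"
    "(\<integral>x. (g x)\<^sup>2 \<partial>lborel) \<le> (H2_norm f)\<^sup>2" "(\<integral>x. (f x)\<^sup>2 \<partial>lborel) \<le> (H2_norm f)\<^sup>2"
proof -
  have meas: "h \<in> borel_measurable borel" if "weak_deriv f h" for h
    using that by (intro loc_integrable_borel_measurable) (simp add: weak_deriv_def)
  show gm: "g \<in> borel_measurable borel" by (rule meas[OF g])
  obtain h where h: "h \<in> L2 lborel" "weak_deriv f h"
    using f(1) unfolding H2_def by blast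
  show "integrable lborel (\<lambda>x. (g x)\<^sup>2)"
    using h(1) integrable_square_cong_AE(1)[OF weak_deriv_unique[OF g h(2) f(2)] gm meas[OF h(2)]]
    by (simp add: L2_def)
  show "integrable lborel (\<lambda>x. (f x)\<^sup>2)" using f(1) by (simp add: H2_def L2_def)
  have w: "weak_deriv f (wderiv f)" by (rule weak_deriv_wderiv[OF g])
  have "(\<integral>x. (g x)\<^sup>2 \<partial>lborel) = (L2_norm lborel (wderiv f))\<^sup>2"
    using integrable_square_cong_AE(2)[OF weak_deriv_unique[OF g w f(2)] gm meas[OF w]]
    by (simp add: L2_norm_def)
  then show "(\<integral>x. (g x)\<^sup>2 \<partial>lborel) \<le> (H2_norm f)\<^sup>2" by (simp add: H2_norm_def)
  have "(\<integral>x. (f x)\<^sup>2 \<partial>lborel) = (L2_norm lborel f)\<^sup>2" by (simp add: L2_norm_def)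
  then show "(\<integral>x. (f x)\<^sup>2 \<partial>lborel) \<le> (H2_norm f)\<^sup>2" by (simp add: H2_norm_def)
qed

lemma square_integrable_strip:
  fixes f :: "real \<times> real \<Rightarrow> real"
  assumes f[measurable]: "f \<in> borel_measurable borel" and f0: "\<And>q. q \<notin> strip T \<Longrightarrow> f q = 0"
    and b: "AE t in lborel. 0 < t \<and> t < T \<longrightarrow> integrable lborel (\<lambda>x. (f (t, x))\<^sup>2) \<and> (\<integral>x. (f (t, x))\<^sup>2 \<partial>lborel) \<le> K"
  shows "integrable lborel (\<lambda>q. (f q)\<^sup>2)"
proof -
  have m[measurable]: "f \<in> borel_measurable (lborel \<Otimes>\<^sub>M lborel)"
    by (simp add: lborel_prod)
  have "integrable (lborel \<Otimes>\<^sub>M lborel) (\<lambda>q. (f q)\<^sup>2)"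
  proof (rule lborel_pair.Fubini_integrable)
    show "AE t in lborel. integrable lborel (\<lambda>x. (f (t, x))\<^sup>2)"
      using b
    proof eventually_elim
      case (elim t)
      then show ?case using f0 by (cases "t \<in> {0<..<T}") auto
    qed
    have "integrable lborel (\<lambda>t. \<bar>K\<bar> * indicator {0<..<T} t)"
      using emeasure_bounded_finite[of "{0<..<T}"]
      by (intro integrable_mult_right) (simp add: integrable_indicator_iff)
    then show "integrable lborel (\<lambda>t. \<integral>x. norm ((f (t, x))\<^sup>2) \<partial>lborel)"
    proof (rule Bochner_Integration.integrable_bound)
      show "(\<lambda>t. \<integral>x. norm ((f (t, x))\<^sup>2) \<partial>lborel) \<in> borel_measurable lborel" by measurable
      show "AE t in lborel. norm (\<integral>x. norm ((f (t, x))\<^sup>2) \<partial>lborel) \<le> norm (\<bar>K\<bar> * indicator {0<..<T} t)"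
        using b
      proof eventually_elim
        case (elim t)
        then show ?case using f0 by (cases "t \<in> {0<..<T}") auto
      qed
    qed
  qed measurable
  then show ?thesis by (simp add: lborel_prod)
qed

locale viscoplastic_strip =
  fixes \<epsilon> T :: real and u0 :: "real \<Rightarrow> real" and u p ut :: "real \<times> real \<Rightarrow> real"
  assumes eps: "\<epsilon> > 0" and T: "T > 0"
    and sol: "viscoplastic_solution \<epsilon> u0 u p"
    and wdt: "weak_dt (strip T) u ut" and utL: "ut \<in> Linf_L2 {0<..<T}"
begin

text \<open>Extensions by zero, so that Fubini and translations are those of Lebesgue measure on the
  whole plane.\<close>

definition "uS q = indicator (strip T) q * u q"
definition "pS q = indicator (strip T) q * p q"
definition "utS q = indicator (strip T) q * ut q"

lemma open_strip: "open (strip T)"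
  by (intro open_Times) auto

lemma strip_borel [measurable]: "strip T \<in> sets borel"
  using open_strip by auto

lemma u_continuous: "continuous_on ({0..} \<times> UNIV) u"
  using sol by (simp add: viscoplastic_solution_def)

lemma u_slice_continuous: "t \<ge> 0 \<Longrightarrow> continuous_on UNIV (\<lambda>x. u (t, x))"
  by (rule continuous_on_compose2[OF u_continuous]) (auto intro!: continuous_intros)

lemma u_initial: "u (0, x) = u0 x"
  using sol by (simp add: viscoplastic_solution_def)

lemma uS_borel [measurable]: "uS \<in> borel_measurable borel"
proof -
  have "continuous_on (strip T) u"
    by (rule continuous_on_subset[OF u_continuous]) auto
  from borel_measurable_continuous_on_indicator[OF strip_borel this]
  show ?thesis by (simp add: uS_def[abs_def])
qed

lemma pS_borel [measurable]: "pS \<in> borel_measurable borel"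
proof -
  have H: "{0::real<..} \<times> (UNIV :: real set) \<in> sets borel"
    by (intro borel_open open_Times) auto
  have "p \<in> borel_measurable (lborel_on ({0<..} \<times> UNIV))"
    using sol by (simp add: viscoplastic_solution_def)
  then have "(\<lambda>q. indicator ({0<..} \<times> UNIV) q *\<^sub>R p q) \<in> borel_measurable lborel"
    using H by (subst (asm) borel_measurable_restrict_space_iff) auto
  then have "(\<lambda>q. indicator (strip T) q * (indicator ({0<..} \<times> UNIV) q *\<^sub>R p q)) \<in> borel_measurable borel"
    by (intro borel_measurable_times borel_measurable_indicator strip_borel) simp
  moreover have "indicator (strip T) q * (indicator ({0<..} \<times> UNIV) q *\<^sub>R p q) = pS q" for q
    by (auto simp: pS_def indicator_def)
  ultimately show ?thesis by (simp only:)
qed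

lemma utS_borel [measurable]: "utS \<in> borel_measurable borel"
proof -
  have "ut \<in> borel_measurable (lborel_on (strip T))"
    using utL by (simp add: Linf_of_def)
  then show ?thesis
    unfolding utS_def[abs_def] by (subst (asm) borel_measurable_restrict_space_iff) auto
qed

text \<open>The regularity of a typical time slice. The bound \<open>K\<close> may depend on
  \<open>\<epsilon>\<close>: it secures integrability and does not appear in the final
  estimate.\<close>

definition good :: "real \<Rightarrow> real \<Rightarrow> bool" where
  "good K t \<longleftrightarrow> 0 < t \<and> t < T \<and> primitive_on UNIV (\<lambda>x. u (t, x)) (\<lambda>x. p (t, x)) \<and>
     continuous_on UNIV (\<lambda>x. p (t, x)) \<and> ((\<lambda>x. u (t, x)) \<longlongrightarrow> 0) at_infinity \<and>
     (\<lambda>x. ut (t, x)) \<in> borel_measurable borel \<and>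
     integrable lborel (\<lambda>x. (u (t, x))\<^sup>2) \<and> integrable lborel (\<lambda>x. (p (t, x))\<^sup>2) \<and>
     integrable lborel (\<lambda>x. (ut (t, x))\<^sup>2) \<and>
     (\<integral>x. (u (t, x))\<^sup>2 \<partial>lborel) \<le> K \<and> (\<integral>x. (p (t, x))\<^sup>2 \<partial>lborel) \<le> K \<and> (\<integral>x. (ut (t, x))\<^sup>2 \<partial>lborel) \<le> K"

lemma AE_good: "\<exists>K. AE t in lborel. 0 < t \<and> t < T \<longrightarrow> good K t"
proof -
  have 1: "AE t in lborel. t \<in> {0<..} \<longrightarrow> weak_deriv (\<lambda>x. u (t, x)) (\<lambda>x. p (t, x)) \<and> continuous_on UNIV (\<lambda>x. p (t, x))"
  proof (rule AE_restrict_space_iff[THEN iffD1, rotated])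
    show "AE t in lborel_on {0<..}. weak_deriv (\<lambda>x. u (t, x)) (\<lambda>x. p (t, x)) \<and> continuous_on UNIV (\<lambda>x. p (t, x))"
      using sol unfolding viscoplastic_solution_def by (elim conjE)
  qed simp
  have "u \<in> Linf_of {0<..<T} UNIV H2 H2_norm"
    using sol T unfolding viscoplastic_solution_def by blast
  then obtain C1 where "AE t in lborel_on {0<..<T}. (\<lambda>x. u (t, x)) \<in> H2 \<and> H2_norm (\<lambda>x. u (t, x)) \<le> C1"
    unfolding Linf_of_def by blast
  then have 2: "AE t in lborel. t \<in> {0<..<T} \<longrightarrow> (\<lambda>x. u (t, x)) \<in> H2 \<and> H2_norm (\<lambda>x. u (t, x)) \<le> C1"
    by (rule AE_restrict_space_iff[THEN iffD1, rotated]) simp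
  obtain C2 where "AE t in lborel_on {0<..<T}. (\<lambda>x. ut (t, x)) \<in> L2 lborel \<and> L2_norm lborel (\<lambda>x. ut (t, x)) \<le> C2"
    using utL unfolding Linf_of_def by blast
  then have 3: "AE t in lborel. t \<in> {0<..<T} \<longrightarrow> (\<lambda>x. ut (t, x)) \<in> L2 lborel \<and> L2_norm lborel (\<lambda>x. ut (t, x)) \<le> C2"
    by (rule AE_restrict_space_iff[THEN iffD1, rotated]) simp
  have lim: "((\<lambda>x. u (t, x)) \<longlongrightarrow> 0) at_infinity" if "t \<ge> 0" for t
    using sol that by (simp add: viscoplastic_solution_def)
  have "AE t in lborel. 0 < t \<and> t < T \<longrightarrow> good (C1\<^sup>2 + C2\<^sup>2) t"
    using 1 2 3
  proof (eventually_elim, intro impI)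
    fix t assume t: "0 < t \<and> t < T"
    assume "t \<in> {0<..} \<longrightarrow> weak_deriv (\<lambda>x. u (t, x)) (\<lambda>x. p (t, x)) \<and> continuous_on UNIV (\<lambda>x. p (t, x))"
      "t \<in> {0<..<T} \<longrightarrow> (\<lambda>x. u (t, x)) \<in> H2 \<and> H2_norm (\<lambda>x. u (t, x)) \<le> C1"
      "t \<in> {0<..<T} \<longrightarrow> (\<lambda>x. ut (t, x)) \<in> L2 lborel \<and> L2_norm lborel (\<lambda>x. ut (t, x)) \<le> C2"
    then have w: "weak_deriv (\<lambda>x. u (t, x)) (\<lambda>x. p (t, x))" "continuous_on UNIV (\<lambda>x. p (t, x))"
      and h: "(\<lambda>x. u (t, x)) \<in> H2" "H2_norm (\<lambda>x. u (t, x)) \<le> C1"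
      and v: "(\<lambda>x. ut (t, x)) \<in> L2 lborel" "L2_norm lborel (\<lambda>x. ut (t, x)) \<le> C2"
      using t by auto
    have cu: "continuous_on UNIV (\<lambda>x. u (t, x))" using t by (intro u_slice_continuous) auto
    note b = H2_weak_deriv[OF h(1) cu w(1)]
    have "(H2_norm (\<lambda>x. u (t, x)))\<^sup>2 \<le> C1\<^sup>2"
      using h(2) by (intro power_mono) (auto simp: H2_norm_def)
    then have H: "(H2_norm (\<lambda>x. u (t, x)))\<^sup>2 \<le> C1\<^sup>2 + C2\<^sup>2" by (simp add: add_increasing2)
    have "(L2_norm lborel (\<lambda>x. ut (t, x)))\<^sup>2 \<le> C2\<^sup>2"
      using v(2) by (intro power_mono) (auto simp: L2_norm_def)
    then have "(\<integral>x. (ut (t, x))\<^sup>2 \<partial>lborel) \<le> C1\<^sup>2 + C2\<^sup>2"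
      by (simp add: L2_norm_def add_increasing)
    then show "good (C1\<^sup>2 + C2\<^sup>2) t"
      unfolding good_def using t b H w(2) v(1) weak_deriv_primitive[OF w(1) cu] lim[of t]
      by (auto simp: L2_def)
  qed
  then show ?thesis by blast
qed

lemma uS_L2: "integrable lborel (\<lambda>q. (uS q)\<^sup>2)"
  and pS_L2: "integrable lborel (\<lambda>q. (pS q)\<^sup>2)"
  and utS_L2: "integrable lborel (\<lambda>q. (utS q)\<^sup>2)"
proof -
  obtain K where K: "AE t in lborel. 0 < t \<and> t < T \<longrightarrow> good K t" using AE_good by blast
  have 1: "AE t in lborel. 0 < t \<and> t < T \<longrightarrow> integrable lborel (\<lambda>x. (uS (t, x))\<^sup>2) \<and> (\<integral>x. (uS (t, x))\<^sup>2 \<partial>lborel) \<le> K"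
    using K by eventually_elim (auto simp: good_def uS_def)
  have 2: "AE t in lborel. 0 < t \<and> t < T \<longrightarrow> integrable lborel (\<lambda>x. (pS (t, x))\<^sup>2) \<and> (\<integral>x. (pS (t, x))\<^sup>2 \<partial>lborel) \<le> K"
    using K by eventually_elim (auto simp: good_def pS_def)
  have 3: "AE t in lborel. 0 < t \<and> t < T \<longrightarrow> integrable lborel (\<lambda>x. (utS (t, x))\<^sup>2) \<and> (\<integral>x. (utS (t, x))\<^sup>2 \<partial>lborel) \<le> K"
    using K by eventually_elim (auto simp: good_def utS_def)
  show "integrable lborel (\<lambda>q. (uS q)\<^sup>2)"
    by (rule square_integrable_strip[OF uS_borel _ 1]) (auto simp: uS_def)
  show "integrable lborel (\<lambda>q. (pS q)\<^sup>2)"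
    by (rule square_integrable_strip[OF pS_borel _ 2]) (auto simp: pS_def)
  show "integrable lborel (\<lambda>q. (utS q)\<^sup>2)"
    by (rule square_integrable_strip[OF utS_borel _ 3]) (auto simp: utS_def)
qed

text \<open>One-dimensional Sobolev bound: \<open>u^2\<close> has derivative
  \<open>2 * u * p\<close>, which is at most \<open>u^2 + p^2\<close>, and tends to 0 at minus
  infinity.\<close>

lemma good_bounded:
  assumes "good K t"
  shows "(u (t, x))\<^sup>2 \<le> 2 * K"
proof -
  note g = assms[unfolded good_def]
  have pr: "primitive_on UNIV (\<lambda>x. u (t, x) * u (t, x)) (\<lambda>x. p (t, x) * u (t, x) + u (t, x) * p (t, x))"
    using g by (intro primitive_on_mult) auto
  let ?k = "\<lambda>x. p (t, x) * u (t, x) + u (t, x) * p (t, x)"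
  have le: "\<bar>?k x\<bar> \<le> (u (t, x))\<^sup>2 + (p (t, x))\<^sup>2" for x
    using sum_squares_bound[of "\<bar>u (t, x)\<bar>" "\<bar>p (t, x)\<bar>"] by (simp add: abs_mult mult.commute)
  have i: "integrable lborel (\<lambda>x. (u (t, x))\<^sup>2 + (p (t, x))\<^sup>2)" using g by auto
  have b: "(u (t, x))\<^sup>2 - (u (t, y))\<^sup>2 \<le> 2 * K" if "y \<le> x" for y
  proof -
    have "(u (t, x))\<^sup>2 - (u (t, y))\<^sup>2 = (LBINT s:{y..x}. ?k s)"
      using primitive_onD(2)[OF pr, of y x] that by (simp add: power2_eq_square)
    also have "\<dots> \<le> (LBINT s:{y..x}. (u (t, s))\<^sup>2 + (p (t, s))\<^sup>2)"
    proof (rule set_integral_mono)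
      show "set_integrable lborel {y..x} ?k" using primitive_onD(1)[OF pr, of y x] that by simp
      show "set_integrable lborel {y..x} (\<lambda>s. (u (t, s))\<^sup>2 + (p (t, s))\<^sup>2)"
        using integrable_mult_indicator[OF _ i] by (simp add: set_integrable_def)
      show "?k s \<le> (u (t, s))\<^sup>2 + (p (t, s))\<^sup>2" for s using le[of s] by linarith
    qed
    also have "\<dots> \<le> (\<integral>s. (u (t, s))\<^sup>2 + (p (t, s))\<^sup>2 \<partial>lborel)"
      unfolding set_lebesgue_integral_def
      by (rule integral_mono[OF integrable_mult_indicator[OF _ i] i]) (auto simp: indicator_def)
    also have "\<dots> \<le> 2 * K" using g by simp
    finally show ?thesis .
  qed
  have "((\<lambda>y. u (t, y)) \<longlongrightarrow> 0) at_bot"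
    using g tendsto_mono[OF at_bot_le_at_infinity] by blast
  then have "((\<lambda>y. (u (t, x))\<^sup>2 - (u (t, y))\<^sup>2) \<longlongrightarrow> (u (t, x))\<^sup>2 - 0\<^sup>2) at_bot"
    by (intro tendsto_intros)
  then have "(u (t, x))\<^sup>2 - 0\<^sup>2 \<le> 2 * K"
    by (rule tendsto_upperbound) (auto intro: eventually_mono[OF eventually_le_at_bot[of x] b])
  then show ?thesis by simp
qed

end

section \<open>The plastic law and its dependence on the total stress\<close>

definition plastic' :: "real \<Rightarrow> real \<Rightarrow> real" where
  "plastic' \<epsilon> s = \<epsilon>\<^sup>2 / (sqrt (s\<^sup>2 + \<epsilon>\<^sup>2))^3"

text \<open>The derivative of the stress with respect to the total stress
  \<open>plastic \<epsilon> s + \<epsilon> * s\<close>, expressed in terms of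
  \<open>s\<close>.\<close>

definition plastic_ratio :: "real \<Rightarrow> real \<Rightarrow> real" where
  "plastic_ratio \<epsilon> s = plastic' \<epsilon> s / (plastic' \<epsilon> s + \<epsilon>)"

context
  fixes \<epsilon> :: real
  assumes eps: "\<epsilon> > 0"
begin

lemma sqrt_pos: "sqrt (s\<^sup>2 + \<epsilon>\<^sup>2) > 0"
  using eps by (simp add: add_nonneg_pos)

lemma plastic'_pos: "plastic' \<epsilon> s > 0"
  unfolding plastic'_def using eps sqrt_pos[of s] by (intro divide_pos_pos zero_less_power) auto

lemma DERIV_plastic: "(plastic \<epsilon> has_real_derivative plastic' \<epsilon> s) (at s)"
proof -
  let ?r = "sqrt (s\<^sup>2 + \<epsilon>\<^sup>2)"
  have r: "?r > 0" "?r\<^sup>2 = s\<^sup>2 + \<epsilon>\<^sup>2" using sqrt_pos[of s] by auto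
  have pos: "s\<^sup>2 + \<epsilon>\<^sup>2 > 0" using eps by (simp add: add_nonneg_pos)
  have "((\<lambda>s. sqrt (s\<^sup>2 + \<epsilon>\<^sup>2)) has_real_derivative (inverse ?r / 2) * (2 * s)) (at s)"
    by (rule DERIV_chain2[of sqrt]) (use pos in \<open>auto intro!: derivative_eq_intros DERIV_real_sqrt\<close>)
  then have "((\<lambda>s. s / sqrt (s\<^sup>2 + \<epsilon>\<^sup>2)) has_real_derivative
      (1 * ?r - s * ((inverse ?r / 2) * (2 * s))) / (?r * ?r)) (at s)"
    by (rule DERIV_divide[OF DERIV_ident]) (use r in auto)
  also have "(1 * ?r - s * ((inverse ?r / 2) * (2 * s))) / (?r * ?r) = (?r\<^sup>2 - s\<^sup>2) / ?r^3"
  proof -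
    have "(1 * r - s * ((inverse r / 2) * (2 * s))) / (r * r) = (r\<^sup>2 - s\<^sup>2) / r^3" if "r > 0" for r :: real
      using that by (simp add: field_simps power2_eq_square power3_eq_cube)
    from this[OF r(1)] show ?thesis .
  qed
  also have "\<dots> = plastic' \<epsilon> s"
    using r(2) by (simp add: plastic'_def)
  finally show ?thesis
    by (simp add: plastic_def[abs_def])
qed

lemma continuous_plastic: "continuous_on A (plastic \<epsilon>)"
  by (rule continuous_at_imp_continuous_on) (blast intro: DERIV_isCont DERIV_plastic)

lemma continuous_plastic': "continuous_on A (plastic' \<epsilon>)"
  unfolding plastic'_def using sqrt_pos by (intro continuous_intros) (auto simp: less_imp_neq[symmetric])

lemma abs_plastic_le_1: "\<bar>plastic \<epsilon> s\<bar> \<le> 1"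
proof -
  have "\<bar>s\<bar> \<le> sqrt (s\<^sup>2 + \<epsilon>\<^sup>2)" by (rule real_le_rsqrt) simp
  then show ?thesis using sqrt_pos[of s] by (simp add: plastic_def)
qed

text \<open>Being bounded by 1 is of no help for integrability over the whole line; this bound gives
  it, at the price of a constant that blows up with \<open>1 / \<epsilon>\<close>, and is kept out
  of the uniform estimate.\<close>

lemma abs_plastic_le: "\<bar>plastic \<epsilon> s\<bar> \<le> \<bar>s\<bar> / \<epsilon>"
proof -
  have "\<epsilon> \<le> sqrt (s\<^sup>2 + \<epsilon>\<^sup>2)" using eps by (intro real_le_rsqrt) auto
  then show ?thesis using eps by (simp add: plastic_def frac_le)
qed

lemma plastic_square_le: "(plastic \<epsilon> s)\<^sup>2 \<le> s\<^sup>2 / \<epsilon>\<^sup>2"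
  using abs_plastic_le[of s] eps abs_le_square_iff[of "plastic \<epsilon> s" "s / \<epsilon>"]
  by (simp add: power_divide)

lemma plastic_ratio_range: "0 \<le> plastic_ratio \<epsilon> s" "plastic_ratio \<epsilon> s \<le> 1"
  using plastic'_pos[of s] eps by (auto simp: plastic_ratio_def field_simps)

lemma continuous_plastic_ratio: "continuous_on A (plastic_ratio \<epsilon>)"
  unfolding plastic_ratio_def using plastic'_pos eps
  by (intro continuous_intros continuous_plastic') (metis add_pos_pos less_irrefl)

text \<open>The total stress is a strictly increasing bijection of the line with positive
  derivative, so its inverse \<open>g\<close> is \<open>C^1\<close>, and \<open>F\<close> is
  \<open>plastic \<epsilon>\<close> after \<open>g\<close>. Through \<open>F\<close> the chain rule
  yields a derivative of the stress from that of the total stress, without differentiating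
  \<open>p\<close>.\<close>

lemma plastic_function_of_stress:
  "\<exists>F F'. (\<forall>y. (F has_real_derivative F' y) (at y)) \<and> continuous_on UNIV F' \<and>
     (\<forall>s. F (plastic \<epsilon> s + \<epsilon> * s) = plastic \<epsilon> s \<and> F' (plastic \<epsilon> s + \<epsilon> * s) = plastic_ratio \<epsilon> s)"
proof -
  define \<beta> where "\<beta> s = plastic \<epsilon> s + \<epsilon> * s" for s
  define \<beta>' where "\<beta>' s = plastic' \<epsilon> s + \<epsilon>" for s
  have d: "(\<beta> has_real_derivative \<beta>' s) (at s)" for s
    unfolding \<beta>_def[abs_def] \<beta>'_def by (auto intro!: derivative_eq_intros DERIV_plastic)
  have pos: "\<beta>' s > 0" for s
    using plastic'_pos[of s] eps by (simp add: \<beta>'_def)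
  have cont: "continuous_on A \<beta>" for A
    by (rule continuous_at_imp_continuous_on) (blast intro: DERIV_isCont d)
  have mono: "\<beta> x < \<beta> y" if "x < y" for x y
    by (rule DERIV_pos_imp_increasing[OF that]) (use d pos in blast)
  have inj: "inj \<beta>"
  proof (rule injI)
    fix x y assume "\<beta> x = \<beta> y"
    then show "x = y" using mono[of x y] mono[of y x] by (cases x y rule: linorder_cases) auto
  qed
  have surj: "\<exists>s. \<beta> s = y" for y
  proof -
    \<comment> \<open>The plastic part never exceeds 1 in absolute value, so at \<open>m\<close> the
      linear part \<open>\<bar>y\<bar> + 1\<close> wins and \<open>y\<close> lies between the values
      at \<open>- m\<close> and \<open>m\<close>.\<close>
    define m where "m = (\<bar>y\<bar> + 1) / \<epsilon>"
    have m: "\<epsilon> * m = \<bar>y\<bar> + 1" "m > 0" using eps by (simp_all add: m_def)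
    have "\<beta> (- m) \<le> y" "y \<le> \<beta> m"
      using m abs_plastic_le_1[of m] abs_plastic_le_1[of "- m"] by (auto simp: \<beta>_def)
    then show ?thesis
      using IVT'[of \<beta> "- m" y m] cont m by auto
  qed
  define g where "g = inv \<beta>"
  have bg: "\<beta> (g y) = y" for y
    using surj unfolding g_def by (metis f_inv_into_f rangeI)
  have gb: "g (\<beta> s) = s" for s
    using inj by (simp add: g_def)
  have dg: "(g has_real_derivative inverse (\<beta>' (g y))) (at y)" for y
  proof -
    have "(*) (\<beta>' (g y)) \<circ> (*) (inverse (\<beta>' (g y))) = id"
      using pos[of "g y"] by (auto simp: fun_eq_iff)
    from has_derivative_inverse_strong[OF open_UNIV UNIV_I cont gb d[of "g y", unfolded has_field_derivative_def] this]
    show ?thesis by (simp add: has_field_derivative_def bg)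
  qed
  have cg: "continuous_on A g" for A
    by (rule continuous_at_imp_continuous_on) (blast intro: DERIV_isCont dg)
  show ?thesis
  proof (intro exI conjI allI)
    show "((\<lambda>y. plastic \<epsilon> (g y)) has_real_derivative plastic' \<epsilon> (g y) * inverse (\<beta>' (g y))) (at y)" for y
      by (rule DERIV_chain2[OF DERIV_plastic dg])
    show "continuous_on UNIV (\<lambda>y. plastic' \<epsilon> (g y) * inverse (\<beta>' (g y)))"
      unfolding \<beta>'_def
      by (intro continuous_intros continuous_on_compose2[OF continuous_plastic'[of UNIV]] cg)
         (use pos in \<open>auto simp: \<beta>'_def less_imp_neq[symmetric]\<close>)
    show "plastic \<epsilon> (g (plastic \<epsilon> s + \<epsilon> * s)) = plastic \<epsilon> s" for s
      using gb[of s] by (simp add: \<beta>_def)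
    show "plastic' \<epsilon> (g (plastic \<epsilon> s + \<epsilon> * s)) * inverse (\<beta>' (g (plastic \<epsilon> s + \<epsilon> * s))) = plastic_ratio \<epsilon> s" for s
      using gb[of s] by (simp add: \<beta>_def \<beta>'_def plastic_ratio_def divide_inverse)
  qed
qed

text \<open>The inequality is \<open>\<theta> (1 - \<theta>) G\<^sup>2 - \<theta> G u p + u\<^sup>2 / 4 \<ge> 0\<close> with \<open>\<theta> = plastic_ratio \<epsilon> p\<close> and
  \<open>G = v + u p\<close>; the discriminant is nonpositive because \<open>\<theta> p\<^sup>2 \<le> 1 - \<theta>\<close>.\<close>

lemma stress_square_le:
  "(plastic_ratio \<epsilon> p * (v + u * p))\<^sup>2 \<le> plastic_ratio \<epsilon> p * (v + u * p) * v + u\<^sup>2 / 4"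
proof -
  define \<theta> where "\<theta> = plastic_ratio \<epsilon> p"
  define G where "G = v + u * p"
  define r where "r = sqrt (p\<^sup>2 + \<epsilon>\<^sup>2)"
  have r: "r > 0" "r\<^sup>2 = p\<^sup>2 + \<epsilon>\<^sup>2" "\<epsilon> \<le> r"
    using sqrt_pos[of p] eps by (auto simp: r_def intro: real_le_rsqrt)
  have \<theta>: "0 \<le> \<theta>" "\<theta> \<le> 1" using plastic_ratio_range by (auto simp: \<theta>_def)
  have "\<epsilon> * p\<^sup>2 \<le> r * r\<^sup>2"
    using r eps by (intro mult_mono) auto
  then have "\<epsilon> * (\<epsilon> * p\<^sup>2) \<le> \<epsilon> * (r * r\<^sup>2)"
    using eps by (intro mult_left_mono) auto
  then have "\<epsilon>\<^sup>2 * p\<^sup>2 \<le> \<epsilon> * r^3"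
    by (simp add: power2_eq_square power3_eq_cube mult.assoc)
  \<comment> \<open>Dividing this by \<open>plastic' \<epsilon> p + \<epsilon>\<close> turns it into
    \<open>\<theta> * p^2 \<le> 1 - \<theta>\<close>.\<close>
  then have ap: "plastic' \<epsilon> p * p\<^sup>2 \<le> \<epsilon>"
    unfolding plastic'_def r_def[symmetric] using r(1) by (simp add: pos_divide_le_eq)
  have den: "plastic' \<epsilon> p + \<epsilon> > 0"
    using plastic'_pos[of p] eps by simp
  have "\<theta> * p\<^sup>2 = (plastic' \<epsilon> p * p\<^sup>2) / (plastic' \<epsilon> p + \<epsilon>)" "1 - \<theta> = \<epsilon> / (plastic' \<epsilon> p + \<epsilon>)"
    using den by (simp_all add: \<theta>_def plastic_ratio_def diff_divide_eq_iff)
  then have key: "\<theta> * p\<^sup>2 \<le> 1 - \<theta>"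
    using divide_right_mono[OF ap, of "plastic' \<epsilon> p + \<epsilon>"] den by simp
  have "\<theta> * p\<^sup>2 * (\<theta> * G\<^sup>2) \<le> (1 - \<theta>) * (\<theta> * G\<^sup>2)"
    using key \<theta> by (intro mult_right_mono) auto
  \<comment> \<open>Completing the square: the two sides differ by
    \<open>\<theta> * G^2 * (1 - \<theta> - \<theta> * p^2)\<close>.\<close>
  then have "\<theta> * (1 - \<theta>) * G\<^sup>2 - \<theta> * G * (u * p) + u\<^sup>2 / 4 \<ge> (\<theta> * p * G - u / 2)\<^sup>2"
    by (simp add: power2_eq_square algebra_simps)
  then have "\<theta> * (1 - \<theta>) * G\<^sup>2 - \<theta> * G * (u * p) + u\<^sup>2 / 4 \<ge> 0"
    using zero_le_power2[of "\<theta> * p * G - u / 2"] by linarith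
  then have "(\<theta> * G)\<^sup>2 \<le> \<theta> * G * (G - u * p) + u\<^sup>2 / 4"
    by (simp add: power2_eq_square algebra_simps)
  then show ?thesis
    by (simp add: \<theta>_def G_def)
qed

end

section \<open>The equation on single lines\<close>

lemma integral_lborel_on:
  fixes f :: "'a::euclidean_space \<Rightarrow> real"
  assumes "S \<in> sets borel"
  shows "(\<integral>q. f q \<partial>lborel_on S) = (\<integral>q. indicator S q * f q \<partial>lborel)"
  using assms by (subst integral_restrict_space) auto

context viscoplastic_strip
begin

definition "fluxS q = indicator (strip T) q * ((u q)\<^sup>2 / 2 - \<epsilon> * p q - plastic \<epsilon> (p q))"

definition "RS q = indicator (strip T) q * plastic \<epsilon> (p q)"

lemma RS_eq: "RS q = plastic \<epsilon> (pS q)"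
  by (simp add: RS_def pS_def indicator_def plastic_def)

lemma fluxS_eq: "fluxS q = (uS q)\<^sup>2 / 2 - \<epsilon> * pS q - RS q"
  by (simp add: fluxS_def RS_def pS_def uS_def indicator_def)

lemma RS_borel [measurable]: "RS \<in> borel_measurable borel"
  unfolding RS_eq[abs_def]
  by (rule measurable_compose[OF pS_borel borel_measurable_continuous_onI[OF continuous_plastic[OF eps]]])

lemma RS_L2: "integrable lborel (\<lambda>q. (RS q)\<^sup>2)"
proof (rule Bochner_Integration.integrable_bound)
  show "integrable lborel (\<lambda>q. (pS q)\<^sup>2 / \<epsilon>\<^sup>2)" using pS_L2 by simp
  show "AE q in lborel. norm ((RS q)\<^sup>2) \<le> norm ((pS q)\<^sup>2 / \<epsilon>\<^sup>2)"
    using plastic_square_le[OF eps] by (simp add: RS_eq)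
qed measurable

lemma bump_tensor_bounds:
  fixes a b n a' b' n' :: real
  assumes n: "n > 0" "n' > 0" "a \<le> b" "a' \<le> b'"
  defines "A \<equiv> \<lambda>q::real \<times> real. (tent_kernel n a (fst q) - tent_kernel n b (fst q)) * bump n' a' b' (snd q)"
    and "B \<equiv> \<lambda>q::real \<times> real. bump n a b (fst q) * (tent_kernel n' a' (snd q) - tent_kernel n' b' (snd q))"
  shows "A \<in> borel_measurable borel" "B \<in> borel_measurable borel"
    "integrable lborel (\<lambda>q. (A q)\<^sup>2)" "integrable lborel (\<lambda>q. (B q)\<^sup>2)" "\<exists>C. \<forall>q. \<bar>B q\<bar> \<le> C"
    "\<And>q. fst q \<notin> {a..b + 1/n} \<Longrightarrow> A q = 0 \<and> B q = 0"
proof -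
  let ?K = "{a..b + 1/n} \<times> {a'..b' + 1/n'}"
  have K: "compact ?K" by (intro compact_Times compact_Icc)
  have k0: "tent_kernel n a t - tent_kernel n b t = 0" if "t \<notin> {a..b + 1/n}" for t
    by (rule tent_kernel_diff_eq_0[OF n(1,3) that])
  have k0': "tent_kernel n' a' t - tent_kernel n' b' t = 0" if "t \<notin> {a'..b' + 1/n'}" for t
    by (rule tent_kernel_diff_eq_0[OF n(2,4) that])
  have A0: "A q = 0" if "q \<in> UNIV - ?K" for q
    using that k0[of "fst q"] bump_eq_0[OF n(2,4), of "snd q"] by (cases q) (auto simp: A_def)
  have B0: "B q = 0" if "q \<in> UNIV - ?K" for q
    using that k0'[of "snd q"] bump_eq_0[OF n(1,3), of "fst q"] by (cases q) (auto simp: B_def)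
  have cA: "continuous_on UNIV A" and cB: "continuous_on UNIV B"
    unfolding A_def B_def
    by (intro continuous_intros continuous_on_compose2[OF continuous_tent_kernel[of UNIV]]
         continuous_on_compose2[OF continuous_bump[of UNIV]]; simp)+
  show "A \<in> borel_measurable borel" "B \<in> borel_measurable borel"
    using cA cB by (auto intro: borel_measurable_continuous_onI)
  show "integrable lborel (\<lambda>q. (A q)\<^sup>2)"
    using compactly_supported_extension(3)[OF cA K _ A0] by simp
  show "integrable lborel (\<lambda>q. (B q)\<^sup>2)" "\<exists>C. \<forall>q. \<bar>B q\<bar> \<le> C"
    using compactly_supported_extension(3,4)[OF cB K _ B0] by simp_all
  show "A q = 0 \<and> B q = 0" if "fst q \<notin> {a..b + 1/n}" for q
    using that k0[of "fst q"] bump_eq_0[OF n(1,3), of "fst q"] by (simp add: A_def B_def)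
qed

text \<open>The weak time derivative removes the derivative of the test function in \<open>t\<close>
  from the conservation law; what remains says that the flux has spatial derivative
  \<open>- ut\<close>. The bump in \<open>t\<close> is supported inside (0, T), so the initial term
  drops out and half-plane and strip may be exchanged.\<close>

lemma
  fixes a b n a' b' n' :: real
  assumes n: "n > 0" "n' > 0" "a \<le> b" "a' \<le> b'" and ab: "0 < a" "b + 1/n < T"
  shows weak_dt_bump: "(\<integral>q. uS q * ((tent_kernel n a (fst q) - tent_kernel n b (fst q)) * bump n' a' b' (snd q)) \<partial>lborel)
      = - (\<integral>q. utS q * (bump n a b (fst q) * bump n' a' b' (snd q)) \<partial>lborel)"
    and conservation_bump: "(\<integral>q. fluxS q * (bump n a b (fst q) * (tent_kernel n' a' (snd q) - tent_kernel n' b' (snd q))) \<partial>lborel)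
      = (\<integral>q. utS q * (bump n a b (fst q) * bump n' a' b' (snd q)) \<partial>lborel)"
proof -
  let ?\<phi> = "\<lambda>q. bump n a b (fst q) * bump n' a' b' (snd q)"
  let ?A = "\<lambda>q. (tent_kernel n a (fst q) - tent_kernel n b (fst q)) * bump n' a' b' (snd q)"
  let ?B = "\<lambda>q. bump n a b (fst q) * (tent_kernel n' a' (snd q) - tent_kernel n' b' (snd q))"
  have sub: "{a..b + 1/n} \<times> {a'..b' + 1/n'} \<subseteq> strip T"
    using ab by auto
  have sub': "{a..b + 1/n} \<times> {a'..b' + 1/n'} \<subseteq> {0..} \<times> UNIV"
    using ab by auto
  note dd = dt_bump_tensor[OF unique_derivative_half_plane n sub'] dx_bump_tensor[OF unique_derivative_half_plane n sub']
  note bb = bump_tensor_bounds[OF n]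
  have "?\<phi> \<in> C1c (strip T)"
    by (rule bump_tensor_C1c[OF unique_derivative_open[OF open_strip] n sub])
  then have "(\<integral>q. u q * dt ?\<phi> q \<partial>lborel_on (strip T)) = - (\<integral>q. ut q * ?\<phi> q \<partial>lborel_on (strip T))"
    using wdt unfolding weak_dt_def by blast
  then show 1: "(\<integral>q. uS q * ?A q \<partial>lborel) = - (\<integral>q. utS q * ?\<phi> q \<partial>lborel)"
    by (simp add: integral_lborel_on dd uS_def utS_def mult.assoc)
  have "?\<phi> \<in> C1c ({0..} \<times> UNIV)"
    by (rule bump_tensor_C1c[OF unique_derivative_half_plane n sub'])
  then have "(\<integral>q. u q * dt ?\<phi> q + ((u q)\<^sup>2 / 2 - \<epsilon> * p q - plastic \<epsilon> (p q)) * dx ?\<phi> q \<partial>lborel_on ({0<..} \<times> UNIV))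
       + (\<integral>x. u0 x * ?\<phi> (0, x) \<partial>lborel) = 0"
    using sol unfolding viscoplastic_solution_def weak_conservation_law_def by blast
  moreover have "bump n a b 0 = 0"
    using bump_eq_0[OF n(1,3), of 0] ab by simp
  moreover have "{0::real<..} \<times> (UNIV :: real set) \<in> sets borel"
    by (intro borel_open open_Times) auto
  ultimately have "0 = (\<integral>q. indicator ({0<..} \<times> UNIV) q * (u q * ?A q + ((u q)\<^sup>2 / 2 - \<epsilon> * p q - plastic \<epsilon> (p q)) * ?B q) \<partial>lborel)"
    by (simp add: integral_lborel_on dd)
  also have "\<dots> = (\<integral>q. uS q * ?A q + fluxS q * ?B q \<partial>lborel)"
  proof (rule Bochner_Integration.integral_cong[OF refl])
    fix q :: "real \<times> real"
    show "indicator ({0<..} \<times> UNIV) q * (u q * ?A q + ((u q)\<^sup>2 / 2 - \<epsilon> * p q - plastic \<epsilon> (p q)) * ?B q) = uS q * ?A q + fluxS q * ?B q"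
    proof (cases "q \<in> strip T")
      case True
      then show ?thesis by (auto simp: uS_def fluxS_def)
    next
      case False
      show ?thesis
      proof (cases "fst q > 0")
        case True
        then have "fst q \<notin> {a..b + 1/n}" using False ab by (cases q) auto
        from bb(6)[OF this] show ?thesis by (simp only: mult_zero_right add_0)
      next
        case False
        then have "q \<notin> {0<..} \<times> UNIV" "q \<notin> strip T" by (cases q; auto)+
        then show ?thesis by (simp add: uS_def fluxS_def)
      qed
    qed
  qed
  also have "\<dots> = (\<integral>q. uS q * ?A q \<partial>lborel) + (\<integral>q. fluxS q * ?B q \<partial>lborel)"
  proof (rule Bochner_Integration.integral_add)
    show "integrable lborel (\<lambda>q. uS q * ?A q)"
      by (rule integrable_mult_L2) (use uS_L2 bb in auto)
    \<comment> \<open>\<open>(uS q)^2\<close> is at hand as an integrable function, so its partner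
      must be bounded; the other terms are paired within \<open>L^2\<close>.\<close>
    obtain C where C: "\<And>q. \<bar>?B q\<bar> \<le> C" using bb(5) by blast
    have "integrable lborel (\<lambda>q. (uS q)\<^sup>2 * ?B q)"
      by (rule integrable_mult_bounded[OF uS_L2 _ C]) (use bb in auto)
    moreover have "integrable lborel (\<lambda>q. pS q * ?B q)" "integrable lborel (\<lambda>q. RS q * ?B q)"
      by (rule integrable_mult_L2; use pS_L2 RS_L2 bb in auto)+
    ultimately have "integrable lborel (\<lambda>q. (uS q)\<^sup>2 * ?B q / 2 - \<epsilon> * (pS q * ?B q) - RS q * ?B q)"
      by (intro Bochner_Integration.integrable_diff integrable_divide integrable_mult_right)
    moreover have "fluxS q * y = (uS q)\<^sup>2 * y / 2 - \<epsilon> * (pS q * y) - RS q * y" for q y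
      by (simp add: fluxS_eq left_diff_distrib)
    ultimately show "integrable lborel (\<lambda>q. fluxS q * ?B q)"
      by (simp only:)
  qed
  finally show "(\<integral>q. fluxS q * ?B q \<partial>lborel) = (\<integral>q. utS q * ?\<phi> q \<partial>lborel)"
    using 1 by simp
qed

end

lemma
  fixes h :: "real \<times> real \<Rightarrow> real"
  assumes "integrable lborel h"
  shows integrable_lborel_swap: "integrable lborel (\<lambda>q. h (snd q, fst q))"
    and integral_lborel_swap: "(\<integral>q. h (snd q, fst q) \<partial>lborel) = (\<integral>q. h q \<partial>lborel)"
proof -
  have h: "integrable (lborel \<Otimes>\<^sub>M lborel) h" using assms by (simp add: lborel_prod)
  have "integrable (lborel \<Otimes>\<^sub>M lborel) (\<lambda>(x, y). h (y, x))"
    by (rule lborel_pair.integrable_product_swap[OF h])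
  then show "integrable lborel (\<lambda>q. h (snd q, fst q))"
    by (simp add: lborel_prod split_beta')
  have "(\<integral>(x, y). h (y, x) \<partial>(lborel \<Otimes>\<^sub>M lborel)) = integral\<^sup>L (lborel \<Otimes>\<^sub>M lborel) h"
    by (rule lborel_pair.integral_product_swap) (use h in auto)
  then show "(\<integral>q. h (snd q, fst q) \<partial>lborel) = (\<integral>q. h q \<partial>lborel)"
    by (simp add: lborel_prod split_beta')
qed

lemma integrable_bounded_indicator_mult_L2:
  fixes f :: "'a::euclidean_space \<Rightarrow> real"
  assumes "f \<in> borel_measurable borel" "integrable lborel (\<lambda>q. (f q)\<^sup>2)" "K \<in> sets borel" "bounded K"
  shows "integrable lborel (\<lambda>q. indicator K q * f q)"
proof (rule integrable_mult_L2)
  have "integrable lborel (indicator K :: 'a \<Rightarrow> real)"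
    using assms emeasure_bounded_finite[of K] by (simp add: integrable_indicator_iff)
  moreover have "(indicator K q)\<^sup>2 = (indicator K q :: real)" for q
    by (simp add: indicator_def)
  ultimately show "integrable lborel (\<lambda>q. (indicator K q :: real)\<^sup>2)" by simp
qed (use assms in auto)

lemma bounded_box_Int: "bounded ((A \<inter> {a..b}) \<times> (B \<inter> {c..d}))" for a b c d :: real
  by (rule bounded_subset[of "{a..b} \<times> {c..d}"]) (auto intro: bounded_Times)

context viscoplastic_strip
begin

definition "dR q = plastic_ratio \<epsilon> (pS q) * (utS q + uS q * pS q)"

lemma dR_borel [measurable]: "dR \<in> borel_measurable borel"
proof -
  have [measurable]: "plastic_ratio \<epsilon> \<in> borel_measurable borel"
    by (rule borel_measurable_continuous_onI[OF continuous_plastic_ratio[OF eps]])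
  show ?thesis unfolding dR_def[abs_def] by measurable
qed

lemma dR_outside: "q \<notin> strip T \<Longrightarrow> dR q = 0"
  by (simp add: dR_def utS_def uS_def)

lemma dR_eq: "q \<in> strip T \<Longrightarrow> dR q = plastic_ratio \<epsilon> (p q) * (ut q + u q * p q)"
  by (simp add: dR_def utS_def uS_def pS_def)

lemma AE_flux_slices:
  "AE t in lborel. t \<in> {0<..<T} \<longrightarrow> primitive_on UNIV (\<lambda>x. fluxS (t, x)) (\<lambda>x. - utS (t, x))"
proof (rule primitive_on_slices)
  obtain K where K: "AE t in lborel. 0 < t \<and> t < T \<longrightarrow> good K t" using AE_good by blast
  show "AE t in lborel. t \<in> {0<..<T} \<longrightarrow> continuous_on UNIV (\<lambda>x. fluxS (t, x))"
    using K
  proof (eventually_elim, intro impI)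
    fix t assume "0 < t \<and> t < T \<longrightarrow> good K t" "t \<in> {0<..<T}"
    then have "continuous_on UNIV (\<lambda>x. p (t, x))" "continuous_on UNIV (\<lambda>x. u (t, x))"
      by (auto simp: good_def intro: u_slice_continuous)
    then have "continuous_on UNIV (\<lambda>x. (u (t, x))\<^sup>2 / 2 - \<epsilon> * p (t, x) - plastic \<epsilon> (p (t, x)))"
      by (intro continuous_intros continuous_on_compose2[OF continuous_plastic[OF eps, of UNIV]]) auto
    then show "continuous_on UNIV (\<lambda>x. fluxS (t, x))"
      using \<open>t \<in> {0<..<T}\<close> by (simp add: fluxS_def)
  qed
  fix m :: nat
  let ?K = "({0<..<T} \<inter> {- real m..real m}) \<times> (UNIV \<inter> {- real m..real m})"
  have K: "?K \<in> sets borel" "bounded ?K"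
  proof -
    show "?K \<in> sets borel" by (intro borel_Times) auto
    show "bounded ?K" by (rule bounded_box_Int)
  qed
  have "integrable lborel (\<lambda>q. (uS q)\<^sup>2 * indicator ?K q)"
    by (rule integrable_mult_bounded[OF uS_L2, of _ 1]) (use K in \<open>auto simp: indicator_def\<close>)
  moreover have "integrable lborel (\<lambda>q. indicator ?K q * pS q)" "integrable lborel (\<lambda>q. indicator ?K q * RS q)"
    by (rule integrable_bounded_indicator_mult_L2; use pS_L2 RS_L2 K in auto)+
  ultimately have "integrable lborel (\<lambda>q. (uS q)\<^sup>2 * indicator ?K q / 2 - \<epsilon> * (indicator ?K q * pS q) - indicator ?K q * RS q)"
    by (intro Bochner_Integration.integrable_diff integrable_divide integrable_mult_right)
  moreover have "indicator ?K q * fluxS q = (uS q)\<^sup>2 * indicator ?K q / 2 - \<epsilon> * (indicator ?K q * pS q) - indicator ?K q * RS q" for q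
    by (cases "q \<in> ?K") (simp_all add: fluxS_eq)
  ultimately show "integrable lborel (\<lambda>q. indicator ?K q * fluxS q)"
    by (simp only:)
  have "integrable lborel (\<lambda>q. indicator ?K q * utS q)"
    by (rule integrable_bounded_indicator_mult_L2) (use utS_L2 K in auto)
  then show "integrable lborel (\<lambda>q. indicator ?K q * - utS q)"
    by simp
next
  fix a b :: real and n :: nat and a' b' :: real and n' :: nat
  assume "a \<in> {0<..<T}" "a \<le> b" "0 < n" "b + 1 / real n \<in> {0<..<T}" "a' \<le> b'" "0 < n'"
  then show "(\<integral>q. fluxS q * (bump (real n) a b (fst q) * (tent_kernel (real n') a' (snd q) - tent_kernel (real n') b' (snd q))) \<partial>lborel)
    = - (\<integral>q. - utS q * (bump (real n) a b (fst q) * bump (real n') a' b' (snd q)) \<partial>lborel)"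
    using conservation_bump[of "real n" "real n'" a b a' b'] by simp
qed auto

text \<open>The total stress is \<open>u^2 / 2\<close> minus the flux, and both terms have a known
  density along the slice.\<close>

lemma AE_total_stress_slices:
  "AE t in lborel. 0 < t \<and> t < T \<longrightarrow>
     primitive_on UNIV (\<lambda>x. plastic \<epsilon> (p (t, x)) + \<epsilon> * p (t, x)) (\<lambda>x. ut (t, x) + u (t, x) * p (t, x))"
proof -
  obtain K where K: "AE t in lborel. 0 < t \<and> t < T \<longrightarrow> good K t" using AE_good by blast
  show ?thesis
    using K AE_flux_slices
  proof (eventually_elim, intro impI)
    fix t assume "0 < t \<and> t < T \<longrightarrow> good K t" "0 < t \<and> t < T"
      and "t \<in> {0<..<T} \<longrightarrow> primitive_on UNIV (\<lambda>x. fluxS (t, x)) (\<lambda>x. - utS (t, x))"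
    then have g: "good K t" and fl: "primitive_on UNIV (\<lambda>x. fluxS (t, x)) (\<lambda>x. - utS (t, x))" and t: "t \<in> {0<..<T}"
      by auto
    have pu: "primitive_on UNIV (\<lambda>x. u (t, x)) (\<lambda>x. p (t, x))" using g by (simp add: good_def)
    have "primitive_on UNIV (\<lambda>x. (u (t, x))\<^sup>2 / 2) (\<lambda>x. u (t, x) * p (t, x))"
      by (rule primitive_on_chain[OF pu]) (auto intro!: derivative_eq_intros continuous_intros)
    from primitive_on_diff[OF this fl]
    show "primitive_on UNIV (\<lambda>x. plastic \<epsilon> (p (t, x)) + \<epsilon> * p (t, x)) (\<lambda>x. ut (t, x) + u (t, x) * p (t, x))"
      using t by (simp add: fluxS_def utS_def add.commute)
  qed
qed

lemma AE_stress_slices: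
  "AE t in lborel. 0 < t \<and> t < T \<longrightarrow> primitive_on UNIV (\<lambda>x. plastic \<epsilon> (p (t, x))) (\<lambda>x. dR (t, x))"
proof -
  obtain F F' where F: "\<And>y. (F has_real_derivative F' y) (at y)" "continuous_on UNIV F'"
    "\<And>s. F (plastic \<epsilon> s + \<epsilon> * s) = plastic \<epsilon> s" "\<And>s. F' (plastic \<epsilon> s + \<epsilon> * s) = plastic_ratio \<epsilon> s"
    using plastic_function_of_stress[OF eps] by blast
  show ?thesis
    using AE_total_stress_slices
  proof (eventually_elim, intro impI)
    fix t assume "0 < t \<and> t < T \<longrightarrow>
     primitive_on UNIV (\<lambda>x. plastic \<epsilon> (p (t, x)) + \<epsilon> * p (t, x)) (\<lambda>x. ut (t, x) + u (t, x) * p (t, x))"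
      and t: "0 < t \<and> t < T"
    then have "primitive_on UNIV (\<lambda>x. plastic \<epsilon> (p (t, x)) + \<epsilon> * p (t, x)) (\<lambda>x. ut (t, x) + u (t, x) * p (t, x))"
      by simp
    from primitive_on_chain[OF this _ F(1,2)]
    have "primitive_on UNIV (\<lambda>x. plastic \<epsilon> (p (t, x))) (\<lambda>x. plastic_ratio \<epsilon> (p (t, x)) * (ut (t, x) + u (t, x) * p (t, x)))"
      by (simp add: F(3,4))
    then show "primitive_on UNIV (\<lambda>x. plastic \<epsilon> (p (t, x))) (\<lambda>x. dR (t, x))"
      using t by (simp add: dR_eq)
  qed
qed

text \<open>The slicing lemma with time and space exchanged; the continuity it asks for is that of
  \<open>u\<close> in time.\<close>

lemma AE_time_slices_open:
  "AE x in lborel. x \<in> UNIV \<longrightarrow> primitive_on {0<..<T} (\<lambda>t. uS (t, x)) (\<lambda>t. utS (t, x))"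
proof -
  have sw: "integrable lborel (\<lambda>q. indicator ((UNIV \<inter> {- real m..real m}) \<times> ({0<..<T} \<inter> {- real m..real m})) q * f (snd q, fst q))"
    if f: "f \<in> borel_measurable borel" "integrable lborel (\<lambda>q. (f q)\<^sup>2)" for f :: "real \<times> real \<Rightarrow> real" and m :: nat
  proof -
    let ?K = "({0<..<T} \<inter> {- real m..real m}) \<times> (UNIV \<inter> {- real m..real m})"
    have K: "?K \<in> sets borel" "bounded ?K"
    proof -
      show "?K \<in> sets borel" by (intro borel_Times) auto
      show "bounded ?K" by (rule bounded_box_Int)
    qed
    have "integrable lborel (\<lambda>q. indicator ?K q * f q)"
      by (rule integrable_bounded_indicator_mult_L2[OF f K])
    from integrable_lborel_swap[OF this] show ?thesis
      by (rule Bochner_Integration.integrable_cong[THEN iffD1, rotated -1]) (auto simp: indicator_def)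
  qed
  have "AE x in lborel. x \<in> UNIV \<longrightarrow> primitive_on {0<..<T} (\<lambda>t. (\<lambda>q. uS (snd q, fst q)) (x, t)) (\<lambda>t. (\<lambda>q. utS (snd q, fst q)) (x, t))"
  proof (rule primitive_on_slices[OF _ _ _ _ sw sw])
    show "AE x in lborel. x \<in> UNIV \<longrightarrow> continuous_on {0<..<T} (\<lambda>t. uS (snd (x, t), fst (x, t)))"
    proof (intro AE_I2 impI)
      fix x :: real
      have "continuous_on {0<..<T} (\<lambda>t. u (t, x))"
        by (rule continuous_on_compose2[OF u_continuous]) (auto intro!: continuous_intros)
      then show "continuous_on {0<..<T} (\<lambda>t. uS (snd (x, t), fst (x, t)))"
        by (rule continuous_on_eq) (auto simp: uS_def)
    qed
    fix a b :: real and n :: nat and a' b' :: real and n' :: nat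
    assume A: "a \<le> b" "0 < n" "a' \<in> {0<..<T}" "a' \<le> b'" "0 < n'" "b' + 1 / real n' \<in> {0<..<T}"
    have n: "real n' > 0" "real n > 0" using A by auto
    note bb = bump_tensor_bounds[OF n A(4,1)]
    have i1: "integrable lborel (\<lambda>q. uS q * ((tent_kernel n' a' (fst q) - tent_kernel n' b' (fst q)) * bump n a b (snd q)))"
      by (rule integrable_mult_L2) (use uS_L2 bb in auto)
    have i2: "integrable lborel (\<lambda>q. utS q * (bump n' a' b' (fst q) * bump n a b (snd q)))"
    proof -
      have "\<bar>bump n' a' b' (fst q) * bump n a b (snd q)\<bar> \<le> indicator ({a'..b' + 1/n'} \<times> {a..b + 1/n}) q" for q :: "real \<times> real"
        using bump_range[OF n(1) A(4), of "fst q"] bump_range[OF n(2) A(1), of "snd q"]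
          bump_eq_0[OF n(1) A(4), of "fst q"] bump_eq_0[OF n(2) A(1), of "snd q"]
        by (cases q) (auto simp: indicator_def abs_mult mult_le_one)
      then have le: "\<bar>utS q * (bump n' a' b' (fst q) * bump n a b (snd q))\<bar> \<le> \<bar>indicator ({a'..b' + 1/n'} \<times> {a..b + 1/n}) q * utS q\<bar>" for q
        by (simp add: abs_mult[of "utS q"] abs_mult[of "indicator _ _"] mult.commute[of "\<bar>utS q\<bar>"] mult_right_mono)
      have "integrable lborel (\<lambda>q. indicator ({a'..b' + 1/n'} \<times> {a..b + 1/n}) q * utS q)"
        by (rule integrable_bounded_indicator_mult_L2)
           (use utS_L2 in \<open>auto intro!: borel_Times bounded_Times\<close>)
      moreover have "(\<lambda>q::real \<times> real. bump n' a' b' (fst q) * bump n a b (snd q)) \<in> borel_measurable borel"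
        by (rule borel_measurable_continuous_onI)
           (intro continuous_intros continuous_on_compose2[OF continuous_bump[of UNIV]]; simp)
      ultimately show ?thesis
        using le by (elim Bochner_Integration.integrable_bound) auto
    qed
    have "b' + 1 / real n' < T" "0 < a'" using A by auto
    from weak_dt_bump[OF n A(4,1) this(2,1)] integral_lborel_swap[OF i1] integral_lborel_swap[OF i2]
    show "(\<integral>q. uS (snd q, fst q) * (bump n a b (fst q) * (tent_kernel n' a' (snd q) - tent_kernel n' b' (snd q))) \<partial>lborel)
      = - (\<integral>q. utS (snd q, fst q) * (bump n a b (fst q) * bump n' a' b' (snd q)) \<partial>lborel)"
      by (simp add: mult.commute)
  qed (use uS_L2 utS_L2 in auto)
  then show ?thesis by simp
qed

text \<open>Continuity of \<open>u\<close> reaches time 0, and before it \<open>u\<close> is frozen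
  at the initial datum with density 0. Backward differences over [t - h, t] then make sense for
  every \<open>t < T\<close>, also when \<open>t < h\<close>.\<close>

lemma AE_time_slices:
  "AE x in lborel. primitive_on {..<T} (\<lambda>t. u (max t 0, x)) (\<lambda>t. utS (t, x))"
proof -
  have "integrable (lborel \<Otimes>\<^sub>M lborel) (\<lambda>(t, x). (utS (t, x))\<^sup>2)"
    using utS_L2 by (simp add: lborel_prod split_beta')
  from lborel_pair.AE_integrable_snd[OF this]
  have "AE x in lborel. integrable lborel (\<lambda>t. (utS (t, x))\<^sup>2)" .
  with AE_time_slices_open show ?thesis
  proof eventually_elim
    case (elim x)
    have seti: "set_integrable lborel {a..b} (\<lambda>t. utS (t, x))" for a b
      unfolding set_integrable_def real_scaleR_def
      by (rule integrable_bounded_indicator_mult_L2)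
         (use elim(2) in \<open>auto intro!: measurable_compose[OF _ utS_borel]\<close>)
    obtain G where G: "primitive_on UNIV G (\<lambda>t. utS (t, x))"
      using primitive_on_exists[of UNIV "\<lambda>t. utS (t, x)"] seti by auto
    \<comment> \<open>\<open>h\<close> will turn out constant: on (0, T) by the open slices, at 0 by
      continuity, and before 0 because both terms are constant there.\<close>
    define h where "h t = u (max t 0, x) - G t" for t
    have "continuous_on UNIV G"
      by (rule primitive_on_continuous_open[OF G]) auto
    then have ch: "continuous_on {0..T/2} h"
      unfolding h_def
      by (intro continuous_intros continuous_on_compose2[OF u_continuous]) (auto intro: continuous_on_subset)
    have const: "h a = h b" if "0 < a" "a \<le> b" "b < T" for a b
      using primitive_onD(2)[OF elim(1)[rule_format, OF UNIV_I], of a b] primitive_onD(2)[OF G, of a b] that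
      by (simp add: h_def uS_def)
    have pos: "h t = h (T / 2)" if "0 < t" "t < T" for t
      using const[of t "T / 2"] const[of "T / 2" t] that T by (cases "t \<le> T / 2") auto
    have zero: "h 0 = h (T / 2)"
    proof (rule continuous_constant_on_closure[of "{0<..<T/2}" h])
      show "continuous_on (closure {0<..<T/2}) h" using ch T by simp
      show "h t = h (T / 2)" if "t \<in> {0<..<T/2}" for t using pos[of t] that T by auto
      show "0 \<in> closure {0<..<T/2}" using T by simp
    qed
    have neg: "h t = h (T / 2)" if "t < 0" for t
    proof -
      have "(LBINT s:{t..0}. utS (s, x)) = 0"
        unfolding set_lebesgue_integral_def
        by (subst Bochner_Integration.integral_cong[OF refl, where g = "\<lambda>_. 0"]) (auto simp: indicator_def utS_def)
      then have "G t = G 0" using primitive_onD(2)[OF G, of t 0] that by simp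
      then show ?thesis using zero that by (simp add: h_def)
    qed
    have h: "h t = h (T / 2)" if "t < T" for t
      using pos[of t] zero neg[of t] that by (cases t "0::real" rule: linorder_cases) auto
    show ?case
      unfolding primitive_on_def
    proof (intro ballI impI conjI)
      fix a b assume ab: "a \<in> {..<T}" "b \<in> {..<T}" "a \<le> b"
      show "set_integrable lborel {a..b} (\<lambda>t. utS (t, x))" by (rule seti)
      show "u (max b 0, x) - u (max a 0, x) = (LBINT t:{a..b}. utS (t, x))"
        using primitive_onD(2)[OF G, of a b] h[of a] h[of b] ab by (simp add: h_def)
    qed
  qed
qed

end

section \<open>The stress derivative in the subdifferential\<close>

lemma strip_in_borel: "strip T \<in> sets borel"
  by (intro borel_open open_Times) auto

lemma X_space_iff:
  "w \<in> X_space T \<longleftrightarrow> (\<lambda>q. indicator (strip T) q * w q) \<in> borel_measurable borel \<and>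
     integrable lborel (\<lambda>q. (indicator (strip T) q * w q)\<^sup>2)"
proof -
  note S = strip_in_borel[of T]
  have "w \<in> borel_measurable (lborel_on (strip T)) \<longleftrightarrow> (\<lambda>q. indicator (strip T) q *\<^sub>R w q) \<in> borel_measurable lborel"
    by (rule borel_measurable_restrict_space_iff) (use S in auto)
  moreover have "integrable (lborel_on (strip T)) (\<lambda>q. (w q)\<^sup>2) \<longleftrightarrow> integrable lborel (\<lambda>q. indicator (strip T) q *\<^sub>R (w q)\<^sup>2)"
    by (rule integrable_restrict_space) (use S in auto)
  moreover have "indicator (strip T) q *\<^sub>R (w q)\<^sup>2 = (indicator (strip T) q * w q)\<^sup>2" for q
    by (simp add: indicator_def)
  ultimately show ?thesis by (simp add: X_space_def L2_def)
qed

lemma X_norm_eq: "X_norm T w = sqrt (\<integral>q. (indicator (strip T) q * w q)\<^sup>2 \<partial>lborel)"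
proof -
  note S = strip_in_borel[of T]
  have "indicator (strip T) q * (w q)\<^sup>2 = (indicator (strip T) q * w q)\<^sup>2" for q
    by (simp add: indicator_def)
  then show ?thesis by (simp add: X_norm_def L2_norm_def integral_lborel_on[OF S])
qed

lemma L2_functional_eq:
  "L2_functional T g w = (\<integral>q. (indicator (strip T) q * g q) * (indicator (strip T) q * w q) \<partial>lborel)"
proof -
  note S = strip_in_borel[of T]
  have "indicator (strip T) q * (g q * w q) = (indicator (strip T) q * g q) * (indicator (strip T) q * w q)" for q
    by (simp add: indicator_def)
  then show ?thesis by (simp only: L2_functional_def integral_lborel_on[OF S])
qed

lemma L2_functional_bound:
  assumes "g \<in> X_space T" "w \<in> X_space T"
  shows "\<bar>L2_functional T g w\<bar> \<le> X_norm T g * X_norm T w"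
  unfolding L2_functional_eq X_norm_eq
  by (rule Cauchy_Schwarz_integral) (use assms in \<open>auto simp: X_space_iff\<close>)

lemma L2_functional_dual:
  assumes g: "g \<in> X_space T"
  shows "L2_functional T g \<in> dual (X_space T) (X_norm T)"
  unfolding dual_def
proof (intro CollectI conjI ballI allI)
  fix v w and a b :: real assume v: "v \<in> X_space T" and w: "w \<in> X_space T"
  let ?I = "indicator (strip T) :: real \<times> real \<Rightarrow> real"
  have i: "integrable lborel (\<lambda>q. (?I q * g q) * (?I q * h q))" if "h \<in> X_space T" for h
    by (rule integrable_mult_L2) (use g that in \<open>auto simp: X_space_iff\<close>)
  have "L2_functional T g (\<lambda>q. a * v q + b * w q)
      = (\<integral>q. a * ((?I q * g q) * (?I q * v q)) + b * ((?I q * g q) * (?I q * w q)) \<partial>lborel)"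
    unfolding L2_functional_eq by (rule Bochner_Integration.integral_cong) (auto simp: algebra_simps)
  also have "\<dots> = a * L2_functional T g v + b * L2_functional T g w"
    unfolding L2_functional_eq using i[OF v] i[OF w] by simp
  finally show "L2_functional T g (\<lambda>q. a * v q + b * w q) = a * L2_functional T g v + b * L2_functional T g w" .
next
  show "\<exists>C. \<forall>w\<in>X_space T. \<bar>L2_functional T g w\<bar> \<le> C * X_norm T w"
    using L2_functional_bound[OF g] by blast
qed

lemma ereal_le_enn2ereal: "ennreal a \<le> b \<Longrightarrow> ereal a \<le> enn2ereal b"
proof -
  assume "ennreal a \<le> b"
  then have "enn2ereal (ennreal a) \<le> enn2ereal b" by (simp add: less_eq_ennreal.rep_eq)
  moreover have "ereal a \<le> enn2ereal (ennreal a)"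
    by (cases "a \<ge> 0") (auto simp: enn2ereal_ennreal ennreal_neg zero_ennreal.rep_eq)
  ultimately show ?thesis by (rule order_trans[rotated])
qed

context viscoplastic_strip
begin

text \<open>Only a qualitative statement, since \<open>K\<close> may depend on
  \<open>\<epsilon>\<close>; it makes all pairings with \<open>dR\<close> meaningful before the
  uniform bound is available.\<close>

lemma dR_L2: "integrable lborel (\<lambda>q. (dR q)\<^sup>2)"
proof -
  obtain K where K: "AE t in lborel. 0 < t \<and> t < T \<longrightarrow> good K t" using AE_good by blast
  have "AE t in lborel. 0 < t \<and> t < T \<longrightarrow> integrable lborel (\<lambda>x. (dR (t, x))\<^sup>2) \<and>
      (\<integral>x. (dR (t, x))\<^sup>2 \<partial>lborel) \<le> 2 * K + 4 * K * K"
    using K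
  proof (eventually_elim, intro impI)
    fix t assume "0 < t \<and> t < T \<longrightarrow> good K t" and t: "0 < t \<and> t < T"
    then have g: "good K t" by simp
    note g' = g[unfolded good_def]
    have K0: "K \<ge> 0" using good_bounded[OF g, of 0] zero_le_power2[of "u (t, 0)"] by linarith
    have le: "(dR (t, x))\<^sup>2 \<le> 2 * (ut (t, x))\<^sup>2 + 4 * K * (p (t, x))\<^sup>2" for x
    proof -
      let ?\<theta> = "plastic_ratio \<epsilon> (p (t, x))"
      have "(dR (t, x))\<^sup>2 = ?\<theta>\<^sup>2 * (ut (t, x) + u (t, x) * p (t, x))\<^sup>2"
        using t by (simp add: dR_eq power_mult_distrib)
      also have "\<dots> \<le> 1 * (ut (t, x) + u (t, x) * p (t, x))\<^sup>2"
        using plastic_ratio_range[OF eps] by (intro mult_right_mono) (auto simp: power_le_one)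
      also have "\<dots> \<le> 2 * (ut (t, x))\<^sup>2 + 2 * (u (t, x) * p (t, x))\<^sup>2"
        using power2_diff_le[of "ut (t, x)" "- (u (t, x) * p (t, x))" 0] by simp
      also have "(u (t, x) * p (t, x))\<^sup>2 \<le> 2 * K * (p (t, x))\<^sup>2"
        unfolding power_mult_distrib using good_bounded[OF g, of x] by (intro mult_right_mono) auto
      finally show ?thesis by simp
    qed
    have i: "integrable lborel (\<lambda>x. 2 * (ut (t, x))\<^sup>2 + 4 * K * (p (t, x))\<^sup>2)"
      using g' by auto
    have i': "integrable lborel (\<lambda>x. (dR (t, x))\<^sup>2)"
    proof (rule Bochner_Integration.integrable_bound[OF i])
      show "(\<lambda>x. (dR (t, x))\<^sup>2) \<in> borel_measurable lborel"
        by (auto intro!: borel_measurable_power measurable_compose[OF _ dR_borel])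
      show "AE x in lborel. norm ((dR (t, x))\<^sup>2) \<le> norm (2 * (ut (t, x))\<^sup>2 + 4 * K * (p (t, x))\<^sup>2)"
        using order_trans[OF le abs_ge_self] by (intro AE_I2) simp
    qed
    have "(\<integral>x. (dR (t, x))\<^sup>2 \<partial>lborel) \<le> (\<integral>x. 2 * (ut (t, x))\<^sup>2 + 4 * K * (p (t, x))\<^sup>2 \<partial>lborel)"
      by (rule integral_mono[OF i' i le])
    also have "\<dots> = 2 * (\<integral>x. (ut (t, x))\<^sup>2 \<partial>lborel) + 4 * K * (\<integral>x. (p (t, x))\<^sup>2 \<partial>lborel)"
      using g' by simp
    also have "\<dots> \<le> 2 * K + 4 * K * K"
      using g' K0 by (intro add_mono mult_left_mono) auto
    finally show "integrable lborel (\<lambda>x. (dR (t, x))\<^sup>2) \<and> (\<integral>x. (dR (t, x))\<^sup>2 \<partial>lborel) \<le> 2 * K + 4 * K * K"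
      using i' by simp
  qed
  from square_integrable_strip[OF dR_borel _ this] show ?thesis
    using dR_outside by blast
qed

lemma indicator_dR: "indicator (strip T) q * dR q = dR q"
  using dR_outside[of q] by (cases "q \<in> strip T") auto

lemma dR_X_space: "dR \<in> X_space T" "(\<lambda>q. - dR q) \<in> X_space T"
  using dR_L2 by (auto simp: X_space_iff indicator_dR)

lemma loc_integrable_strip:
  fixes f :: "real \<times> real \<Rightarrow> real"
  assumes "(\<lambda>q. indicator (strip T) q * f q) \<in> borel_measurable borel"
    "integrable lborel (\<lambda>q. (indicator (strip T) q * f q)\<^sup>2)"
  shows "loc_integrable (strip T) f"
  unfolding loc_integrable_def set_integrable_def
proof (intro allI impI)
  fix K assume K: "compact K \<and> K \<subseteq> strip T"
  have "integrable lborel (\<lambda>q. indicator K q * (indicator (strip T) q * f q))"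
    by (rule integrable_bounded_indicator_mult_L2)
       (use K assms in \<open>auto simp: compact_imp_bounded borel_compact\<close>)
  moreover have "indicator K q * (indicator (strip T) q * f q) = indicator K q *\<^sub>R f q" for q
    using K by (auto simp: indicator_def)
  ultimately show "integrable lborel (\<lambda>q. indicator K q *\<^sub>R f q)" by (simp only:)
qed

lemma AE_slice_integrable:
  fixes f :: "real \<times> real \<Rightarrow> real"
  assumes "integrable lborel f"
  shows "AE t in lborel. integrable lborel (\<lambda>x. f (t, x))"
    "(\<integral>q. f q \<partial>lborel) = (\<integral>t. (\<integral>x. f (t, x) \<partial>lborel) \<partial>lborel)"
    "integrable lborel (\<lambda>t. \<integral>x. f (t, x) \<partial>lborel)"
  using assms lborel_pair.AE_integrable_fst'[of f] lborel_pair.integral_fst'[of f] lborel_pair.integrable_fst'[of f]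
  by (simp_all add: lborel_prod)

text \<open>Integration by parts on almost every slice, put together by Fubini.\<close>

lemma weak_dx_dR: "weak_dx (strip T) (\<lambda>q. plastic \<epsilon> (p q)) dR"
  unfolding weak_dx_def
proof (intro conjI ballI)
  show "loc_integrable (strip T) (\<lambda>q. plastic \<epsilon> (p q))"
    using RS_L2 RS_borel by (intro loc_integrable_strip) (simp_all add: RS_def[abs_def])
  show "loc_integrable (strip T) dR"
    using dR_L2 by (intro loc_integrable_strip) (simp_all add: indicator_dR)
  fix \<phi> assume \<phi>: "\<phi> \<in> C1c (strip T)"
  obtain L where L: "compact L" "L \<subseteq> strip T" "\<And>q. q \<in> strip T - L \<Longrightarrow> \<phi> q = 0" "\<And>q. q \<in> strip T - L \<Longrightarrow> dx \<phi> q = 0"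
    "continuous_on (strip T) \<phi>" "continuous_on (strip T) (dx \<phi>)"
    "\<And>t x. (t, x) \<in> strip T \<Longrightarrow> ((\<lambda>x. \<phi> (t, x)) has_real_derivative dx \<phi> (t, x)) (at x)"
    using C1c_plane_obtain[OF \<phi> open_strip] by blast
  let ?I = "indicator (strip T) :: real \<times> real \<Rightarrow> real"
  note e1 = compactly_supported_extension[OF L(5,1,2,3)] and e2 = compactly_supported_extension[OF L(6,1,2,4)]
  have i1: "integrable lborel (\<lambda>q. RS q * (?I q * dx \<phi> q))" and i2: "integrable lborel (\<lambda>q. dR q * (?I q * \<phi> q))"
    and i3: "integrable lborel (\<lambda>q. RS q * (?I q * \<phi> q))"
    by (rule integrable_mult_L2; use RS_L2 dR_L2 e1 e2 in auto)+
  have "(\<integral>q. plastic \<epsilon> (p q) * dx \<phi> q \<partial>lborel_on (strip T)) = (\<integral>q. RS q * (?I q * dx \<phi> q) \<partial>lborel)"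
    unfolding integral_lborel_on[OF strip_borel]
    by (rule Bochner_Integration.integral_cong) (auto simp: RS_def indicator_def)
  also have "\<dots> = (\<integral>t. (\<integral>x. RS (t, x) * (?I (t, x) * dx \<phi> (t, x)) \<partial>lborel) \<partial>lborel)"
    by (rule AE_slice_integrable(2)[OF i1])
  also have "\<dots> = (\<integral>t. - (\<integral>x. dR (t, x) * (?I (t, x) * \<phi> (t, x)) \<partial>lborel) \<partial>lborel)"
  proof (rule integral_cong_AE)
    show "(\<lambda>t. \<integral>x. RS (t, x) * (?I (t, x) * dx \<phi> (t, x)) \<partial>lborel) \<in> borel_measurable lborel"
      using AE_slice_integrable(3)[OF i1] by auto
    show "(\<lambda>t. - (\<integral>x. dR (t, x) * (?I (t, x) * \<phi> (t, x)) \<partial>lborel)) \<in> borel_measurable lborel"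
      using AE_slice_integrable(3)[OF i2] by auto
    show "AE t in lborel. (\<integral>x. RS (t, x) * (?I (t, x) * dx \<phi> (t, x)) \<partial>lborel)
        = - (\<integral>x. dR (t, x) * (?I (t, x) * \<phi> (t, x)) \<partial>lborel)"
      using AE_slice_integrable(1)[OF i1] AE_slice_integrable(1)[OF i2] AE_slice_integrable(1)[OF i3] AE_stress_slices
    proof eventually_elim
      case (elim t)
      show ?case
      proof (cases "0 < t \<and> t < T")
        case False
        then show ?thesis by (auto simp: indicator_def)
      next
        case True
        then have t: "(t, x) \<in> strip T" for x by simp
        have "primitive_on UNIV (\<lambda>x. \<phi> (t, x)) (\<lambda>x. dx \<phi> (t, x))"
          by (rule primitive_on_C1[OF L(7)[OF t]])
             (rule continuous_on_compose2[OF L(6)], use True in \<open>auto intro!: continuous_intros\<close>)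
        from integration_by_parts_line[OF elim(4)[rule_format, OF True] this]
        show ?thesis using elim(1-3) t by (simp add: RS_def)
      qed
    qed
  qed
  also have "\<dots> = - (\<integral>q. dR q * (?I q * \<phi> q) \<partial>lborel)"
    using AE_slice_integrable(2)[OF i2] by simp
  also have "\<dots> = - (\<integral>q. dR q * \<phi> q \<partial>lborel_on (strip T))"
    unfolding integral_lborel_on[OF strip_borel]
    by (intro arg_cong[of _ _ uminus] Bochner_Integration.integral_cong) auto
  finally show "(\<integral>q. plastic \<epsilon> (p q) * dx \<phi> q \<partial>lborel_on (strip T)) = - (\<integral>q. dR q * \<phi> q \<partial>lborel_on (strip T))" .
qed

text \<open>On almost every slice \<open>- dR\<close> is minus the derivative of a function bounded
  by 1, so \<open>TV_dual_bound\<close> applies there; the slice inequalities are then integrated in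
  time.\<close>

lemma dR_le_Psi:
  assumes w: "w \<in> Y_space T"
  shows "ennreal (L2_functional T (\<lambda>q. - dR q) w) \<le> (\<integral>\<^sup>+ t. TV UNIV (\<lambda>x. w (t, x)) \<partial>lborel_on {0<..<T})"
proof -
  define wS where "wS q = indicator (strip T) q * w q" for q
  have wX: "w \<in> X_space T" and wBV: "AE t in lborel_on {0<..<T}. (\<lambda>x. w (t, x)) \<in> BV UNIV"
    using w by (auto simp: Y_space_def L1_of_def)
  have wm[measurable]: "wS \<in> borel_measurable borel" and w2: "integrable lborel (\<lambda>q. (wS q)\<^sup>2)"
    using wX unfolding X_space_iff wS_def[abs_def] by auto
  have i: "integrable lborel (\<lambda>q. - dR q * wS q)"
    by (rule integrable_mult_L2) (use dR_L2 w2 in auto)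
  define k where "k t = (\<integral>x. - dR (t, x) * wS (t, x) \<partial>lborel)" for t
  have ik: "integrable lborel k"
    using AE_slice_integrable(3)[OF i] by (simp add: k_def[abs_def])
  have k0: "k t = 0" if "t \<notin> {0<..<T}" for t
    using that dR_outside[of "(t, _)"] by (auto simp: k_def)
  have BV': "AE t in lborel. t \<in> {0<..<T} \<longrightarrow> (\<lambda>x. w (t, x)) \<in> BV UNIV"
    by (rule AE_restrict_space_iff[THEN iffD1, rotated, OF wBV]) simp
  have kTV: "AE t in lborel. t \<in> {0<..<T} \<longrightarrow> ennreal (k t) \<le> TV UNIV (\<lambda>x. w (t, x))"
    using BV' AE_slice_integrable(1)[OF w2] AE_slice_integrable(1)[OF dR_L2] AE_stress_slices
  proof (eventually_elim, intro impI)
    fix t assume A: "t \<in> {0<..<T} \<longrightarrow> (\<lambda>x. w (t, x)) \<in> BV UNIV" "integrable lborel (\<lambda>x. (wS (t, x))\<^sup>2)"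
      "integrable lborel (\<lambda>x. (dR (t, x))\<^sup>2)" "0 < t \<and> t < T \<longrightarrow> primitive_on UNIV (\<lambda>x. plastic \<epsilon> (p (t, x))) (\<lambda>x. dR (t, x))"
      "t \<in> {0<..<T}"
    then have wt: "wS (t, x) = w (t, x)" for x by (simp add: wS_def)
    have "ennreal (- (\<integral>x. dR (t, x) * w (t, x) \<partial>lborel)) \<le> TV UNIV (\<lambda>x. w (t, x))"
    proof (rule TV_dual_bound)
      show "(\<lambda>x. dR (t, x)) \<in> borel_measurable borel"
        by (auto intro!: measurable_compose[OF _ dR_borel])
    qed (use A wt abs_plastic_le_1[OF eps] in auto)
    then show "ennreal (k t) \<le> TV UNIV (\<lambda>x. w (t, x))"
      by (simp add: k_def wt)
  qed
  have "L2_functional T (\<lambda>q. - dR q) w = (\<integral>q. - dR q * wS q \<partial>lborel)"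
    unfolding L2_functional_eq by (simp add: wS_def indicator_dR)
  also have "\<dots> = (\<integral>t. k t \<partial>lborel)"
    using AE_slice_integrable(2)[OF i] by (simp add: k_def)
  also have "\<dots> \<le> (\<integral>t. max 0 (k t) \<partial>lborel)"
    by (rule integral_mono) (use ik in auto)
  finally have "ennreal (L2_functional T (\<lambda>q. - dR q) w) \<le> ennreal (\<integral>t. max 0 (k t) \<partial>lborel)"
    by (rule ennreal_leI)
  also have "\<dots> = (\<integral>\<^sup>+t. ennreal (max 0 (k t)) \<partial>lborel)"
    by (rule nn_integral_eq_integral[symmetric]) (use ik in auto)
  also have "\<dots> = (\<integral>\<^sup>+t. ennreal (k t) * indicator {0<..<T} t \<partial>lborel)"
    by (rule nn_integral_cong) (use k0 in \<open>auto simp: indicator_def max_def ennreal_neg\<close>)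
  \<comment> \<open>Monotonicity of the nonnegative integral asks for no measurability, so none is
    claimed for the total variation as a function of time.\<close>
  also have "\<dots> \<le> (\<integral>\<^sup>+t. TV UNIV (\<lambda>x. w (t, x)) * indicator {0<..<T} t \<partial>lborel)"
    by (rule nn_integral_mono_AE) (use kTV in eventually_elim, auto simp: indicator_def)
  also have "\<dots> = (\<integral>\<^sup>+ t. TV UNIV (\<lambda>x. w (t, x)) \<partial>lborel_on {0<..<T})"
    by (subst nn_integral_restrict_space) auto
  finally show ?thesis .
qed

lemma dR_subdiff: "L2_functional T (\<lambda>q. - dR q) \<in> subdiff_zero T (Psi T)"
  unfolding subdiff_zero_def
proof (intro CollectI conjI ballI)
  show "L2_functional T (\<lambda>q. - dR q) \<in> dual (X_space T) (X_norm T)"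
    by (rule L2_functional_dual[OF dR_X_space(2)])
  fix w assume "w \<in> X_space T"
  show "ereal (L2_functional T (\<lambda>q. - dR q) w) \<le> enn2ereal (Psi T w)"
    by (rule ereal_le_enn2ereal) (use dR_le_Psi[of w] in \<open>auto simp: Psi_def\<close>)
qed

end

section \<open>The uniform bound of the stress derivative\<close>

lemma AE_lborel_translate:
  fixes c :: "'a::euclidean_space"
  assumes "AE t in lborel. P t"
  shows "AE t in lborel. P (c + t)"
proof -
  have "AE t in distr lborel borel ((+) c). P t"
    unfolding lborel_distr_plus by (rule assms)
  then show ?thesis by (rule AE_distrD[rotated]) simp
qed

context viscoplastic_strip
begin

text \<open>The equation tested with \<open>u\<close>. The total stress \<open>B\<close> has density
  \<open>V + U * P\<close>, so the integral of \<open>U * V\<close> is minus that of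
  \<open>P * B\<close> minus that of \<open>U^2 * P\<close>. The last integrand is the derivative of
  \<open>U^3 / 3\<close>, and \<open>P * B\<close> is nonnegative because \<open>B\<close> has the
  sign of \<open>P\<close>.\<close>

lemma AE_dissipation:
  "AE t in lborel. 0 < t \<and> t < T \<longrightarrow> (\<integral>x. u (t, x) * ut (t, x) \<partial>lborel) \<le> 0"
proof -
  obtain K where K: "AE t in lborel. 0 < t \<and> t < T \<longrightarrow> good K t" using AE_good by blast
  show ?thesis
    using K AE_total_stress_slices
  proof (eventually_elim, intro impI)
    fix t assume "0 < t \<and> t < T \<longrightarrow> good K t" "0 < t \<and> t < T \<longrightarrow>
     primitive_on UNIV (\<lambda>x. plastic \<epsilon> (p (t, x)) + \<epsilon> * p (t, x)) (\<lambda>x. ut (t, x) + u (t, x) * p (t, x))"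
      and t: "0 < t \<and> t < T"
    then have g: "good K t" and pB: "primitive_on UNIV (\<lambda>x. plastic \<epsilon> (p (t, x)) + \<epsilon> * p (t, x)) (\<lambda>x. ut (t, x) + u (t, x) * p (t, x))"
      by auto
    note g' = g[unfolded good_def]
    define U where "U x = u (t, x)" for x
    define P where "P x = p (t, x)" for x
    define V where "V x = ut (t, x)" for x
    define B where "B x = plastic \<epsilon> (P x) + \<epsilon> * P x" for x
    have pB: "primitive_on UNIV B (\<lambda>x. V x + U x * P x)"
      using pB by (simp add: U_def P_def V_def B_def[abs_def])
    have pU: "primitive_on UNIV U P" using g' by (simp add: U_def[abs_def] P_def[abs_def])
    have cU: "continuous_on UNIV U" using u_slice_continuous[of t] t by (simp add: U_def[abs_def])
    have cP: "continuous_on UNIV P" using g' by (simp add: P_def[abs_def])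
    have cB: "continuous_on UNIV B"
      by (rule primitive_on_continuous_open[OF pB]) auto
    have [measurable]: "U \<in> borel_measurable borel" "P \<in> borel_measurable borel" "B \<in> borel_measurable borel"
      using cU cP cB by (auto intro: borel_measurable_continuous_onI)
    have [measurable]: "V \<in> borel_measurable borel" using g' by (simp add: V_def[abs_def])
    have U2: "integrable lborel (\<lambda>x. (U x)\<^sup>2)" and P2: "integrable lborel (\<lambda>x. (P x)\<^sup>2)" and V2: "integrable lborel (\<lambda>x. (V x)\<^sup>2)"
      using g' by (simp_all add: U_def P_def V_def)
    have bU: "\<bar>U x\<bar> \<le> sqrt (2 * K)" for x
      using good_bounded[OF g, of x] by (intro real_le_rsqrt) (simp add: U_def)
    have B2: "integrable lborel (\<lambda>x. (B x)\<^sup>2)"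
    proof (rule Bochner_Integration.integrable_bound)
      show "integrable lborel (\<lambda>x. (1 / \<epsilon> + \<epsilon>)\<^sup>2 * (P x)\<^sup>2)" using P2 by simp
      have "(B x)\<^sup>2 \<le> (1 / \<epsilon> + \<epsilon>)\<^sup>2 * (P x)\<^sup>2" for x
      proof -
        have "\<bar>B x\<bar> \<le> \<bar>P x\<bar> / \<epsilon> + \<bar>\<epsilon> * P x\<bar>"
          unfolding B_def using abs_plastic_le[OF eps, of "P x"] by (intro order_trans[OF abs_triangle_ineq] add_right_mono)
        also have "\<dots> = \<bar>(1 / \<epsilon> + \<epsilon>) * P x\<bar>"
        proof -
          have "\<bar>1 / \<epsilon> + \<epsilon>\<bar> = 1 / \<epsilon> + \<epsilon>" using eps by simp
          then show ?thesis
            unfolding abs_mult using eps by (simp only:) (simp add: distrib_right)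
        qed
        finally show ?thesis by (simp only: abs_le_square_iff power_mult_distrib)
      qed
      then show "AE x in lborel. norm ((B x)\<^sup>2) \<le> norm ((1 / \<epsilon> + \<epsilon>)\<^sup>2 * (P x)\<^sup>2)" by simp
    qed measurable
    have iUP: "integrable lborel (\<lambda>x. U x * P x)" and iUV: "integrable lborel (\<lambda>x. U x * V x)"
      and iUB: "integrable lborel (\<lambda>x. U x * B x)" and iPB: "integrable lborel (\<lambda>x. P x * B x)"
      by (rule integrable_mult_L2; use U2 V2 B2 P2 in simp)+
    have iUUP: "integrable lborel (\<lambda>x. U x * (U x * P x))"
      using integrable_mult_bounded[OF iUP _ bU] by (simp add: mult.commute)
    have iUG: "integrable lborel (\<lambda>x. U x * (V x + U x * P x))"
      using iUV iUUP by (simp add: distrib_left)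
    have 1: "(\<integral>x. U x * (V x + U x * P x) \<partial>lborel) = - (\<integral>x. P x * B x \<partial>lborel)"
      by (rule integration_by_parts_line[OF pU pB iUB iPB iUG])
    have "primitive_on UNIV (\<lambda>x. (U x)^3 / 3) (\<lambda>x. (U x)\<^sup>2 * P x)"
      by (rule primitive_on_chain[OF pU]) (auto intro!: derivative_eq_intros continuous_intros)
    moreover have "integrable lborel (\<lambda>x. (U x)^3 / 3)"
      using integrable_mult_bounded[OF U2 _ bU] by (simp add: power2_eq_square power3_eq_cube mult.assoc)
    moreover have "integrable lborel (\<lambda>x. (U x)\<^sup>2 * P x)"
      using iUUP by (simp add: power2_eq_square mult.assoc)
    ultimately have "(\<integral>x. (U x)\<^sup>2 * P x \<partial>lborel) = 0"
      by (rule integral_derivative_zero)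
    then have 2: "(\<integral>x. U x * (U x * P x) \<partial>lborel) = 0"
      by (simp add: power2_eq_square mult.assoc)
    have "0 \<le> P x * B x" for x
      using eps by (simp add: B_def plastic_def distrib_left mult.left_commute)
    then have "0 \<le> (\<integral>x. P x * B x \<partial>lborel)" by (intro Bochner_Integration.integral_nonneg)
    moreover have "(\<integral>x. U x * (V x + U x * P x) \<partial>lborel) = (\<integral>x. U x * V x \<partial>lborel) + (\<integral>x. U x * (U x * P x) \<partial>lborel)"
      using iUV iUUP by (simp add: distrib_left)
    ultimately show "(\<integral>x. u (t, x) * ut (t, x) \<partial>lborel) \<le> 0"
      using 1 2 by (simp add: U_def V_def)
  qed
qed

text \<open>On almost every line in time \<open>u^2\<close> has density \<open>2 * u * ut\<close>.
  Exchanging the order of integration, the dissipation inequality keeps the energy of each slice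
  below its initial value; the factor \<open>T\<close> is the length of the time interval.\<close>

lemma energy_bound:
  assumes u0: "integrable lborel (\<lambda>x. (u0 x)\<^sup>2)"
  shows "(\<integral>q. (uS q)\<^sup>2 \<partial>lborel) \<le> T * (\<integral>x. (u0 x)\<^sup>2 \<partial>lborel)"
proof -
  define E where "E q = 2 * (uS q * utS q)" for q
  have iE: "integrable lborel E"
    unfolding E_def by (intro integrable_mult_right integrable_mult_L2) (use uS_L2 utS_L2 in auto)
  have slice: "(\<integral>x. (u (t, x))\<^sup>2 \<partial>lborel) \<le> (\<integral>x. (u0 x)\<^sup>2 \<partial>lborel)" if t: "0 < t" "t < T" for t
  proof -
    define Et where "Et q = E q * indicator {0..t} (fst q)" for q
    have iEt: "integrable lborel Et"
      unfolding Et_def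
      by (rule integrable_mult_bounded[OF iE, of _ 1])
        (auto intro!: measurable_compose[OF borel_measurable_continuous_onI[OF continuous_on_fst[OF continuous_on_id]]]
          split: split_indicator)
    have iEt': "integrable (lborel \<Otimes>\<^sub>M lborel) (\<lambda>(s, x). Et (s, x))"
      using iEt by (simp add: lborel_prod)
    have "AE x in lborel. (u (t, x))\<^sup>2 = (u0 x)\<^sup>2 + (\<integral>s. Et (s, x) \<partial>lborel)"
      using AE_time_slices
    proof eventually_elim
      case (elim x)
      have "primitive_on {..<T} (\<lambda>s. (u (max s 0, x))\<^sup>2) (\<lambda>s. 2 * u (max s 0, x) * utS (s, x))"
        by (rule primitive_on_chain[OF elim]) (auto intro!: derivative_eq_intros continuous_intros)
      from primitive_onD(2)[OF this, of 0 t] t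
      have "(u (t, x))\<^sup>2 - (u0 x)\<^sup>2 = (LBINT s:{0..t}. 2 * u (max s 0, x) * utS (s, x))"
        by (simp add: u_initial)
      also have "\<dots> = (\<integral>s. Et (s, x) \<partial>lborel)"
        unfolding set_lebesgue_integral_def
        by (rule Bochner_Integration.integral_cong) (auto simp: Et_def E_def uS_def utS_def indicator_def max_def)
      finally show ?case by simp
    qed
    then have "(\<integral>x. (u (t, x))\<^sup>2 \<partial>lborel) = (\<integral>x. (u0 x)\<^sup>2 + (\<integral>s. Et (s, x) \<partial>lborel) \<partial>lborel)"
      using u0 lborel_pair.integrable_snd[OF iEt'] u_slice_continuous[of t] t u_slice_continuous[of 0]
      by (intro integral_cong_AE) (auto simp: u_initial intro!: borel_measurable_continuous_onI borel_measurable_power borel_measurable_add)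
    also have "\<dots> = (\<integral>x. (u0 x)\<^sup>2 \<partial>lborel) + (\<integral>x. (\<integral>s. Et (s, x) \<partial>lborel) \<partial>lborel)"
      using u0 lborel_pair.integrable_snd[OF iEt'] by simp
    also have "(\<integral>x. (\<integral>s. Et (s, x) \<partial>lborel) \<partial>lborel) = (\<integral>s. (\<integral>x. Et (s, x) \<partial>lborel) \<partial>lborel)"
      by (rule lborel_pair.Fubini_integral[OF iEt'])
    also have "\<dots> \<le> (\<integral>s. 0 \<partial>(lborel :: real measure))"
    proof (rule integral_mono_AE)
      show "integrable lborel (\<lambda>s. \<integral>x. Et (s, x) \<partial>lborel)"
        using lborel_pair.integrable_fst[OF iEt'] .
      show "AE s in lborel. (\<integral>x. Et (s, x) \<partial>lborel) \<le> 0"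
        using AE_dissipation
      proof eventually_elim
        case (elim s)
        show ?case
        proof (cases "0 < s \<and> s \<le> t")
          case True
          then have "(\<integral>x. Et (s, x) \<partial>lborel) = 2 * (\<integral>x. u (s, x) * ut (s, x) \<partial>lborel)"
            using t by (simp add: Et_def E_def uS_def utS_def)
          then show ?thesis using elim True t by simp
        next
          case False
          then have "Et (s, x) = 0" for x
            by (auto simp: Et_def E_def uS_def indicator_def)
          then show ?thesis by simp
        qed
      qed
    qed auto
    finally show ?thesis by simp
  qed
  have "(\<integral>q. (uS q)\<^sup>2 \<partial>lborel) = (\<integral>t. (\<integral>x. (uS (t, x))\<^sup>2 \<partial>lborel) \<partial>lborel)"
    by (rule AE_slice_integrable(2)[OF uS_L2])
  also have "\<dots> \<le> (\<integral>t. indicator {0<..<T} t * (\<integral>x. (u0 x)\<^sup>2 \<partial>lborel) \<partial>lborel)"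
  proof (rule integral_mono[OF AE_slice_integrable(3)[OF uS_L2]])
    show "integrable lborel (\<lambda>t. indicator {0<..<T} t * (\<integral>x. (u0 x)\<^sup>2 \<partial>lborel))"
      using T by (intro integrable_mult_left) (simp add: integrable_indicator_iff)
    show "(\<integral>x. (uS (t, x))\<^sup>2 \<partial>lborel) \<le> indicator {0<..<T} t * (\<integral>x. (u0 x)\<^sup>2 \<partial>lborel)" for t
      using slice[of t] by (cases "t \<in> {0<..<T}") (auto simp: uS_def)
  qed
  also have "\<dots> = T * (\<integral>x. (u0 x)\<^sup>2 \<partial>lborel)"
    using T by simp
  finally show ?thesis .
qed

end

text \<open>The antiderivative of \<open>plastic \<epsilon>\<close> that vanishes at 0; this
  normalization makes it integrable along slices.\<close>

definition plastic_potential :: "real \<Rightarrow> real \<Rightarrow> real" where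
  "plastic_potential \<epsilon> s = sqrt (s\<^sup>2 + \<epsilon>\<^sup>2) - \<epsilon>"

context
  fixes \<epsilon> :: real
  assumes eps: "\<epsilon> > 0"
begin

lemma plastic_potential_0: "plastic_potential \<epsilon> 0 = 0"
  using eps by (simp add: plastic_potential_def)

lemma plastic_potential_nonneg: "0 \<le> plastic_potential \<epsilon> s"
  using eps by (simp add: plastic_potential_def real_le_rsqrt)

lemma plastic_potential_le_abs: "plastic_potential \<epsilon> s \<le> \<bar>s\<bar>"
  using sqrt_add_le_add_sqrt[of "s\<^sup>2" "\<epsilon>\<^sup>2"] eps by (simp add: plastic_potential_def)

text \<open>For integrability alone. The size of the initial value is taken from
  \<open>plastic_potential_le_abs\<close>, which is uniform in \<open>\<epsilon>\<close>.\<close>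

lemma plastic_potential_le_square: "plastic_potential \<epsilon> s \<le> s\<^sup>2 / \<epsilon>"
proof -
  have "sqrt (s\<^sup>2 + \<epsilon>\<^sup>2) \<le> s\<^sup>2 / \<epsilon> + \<epsilon>"
  proof (rule real_le_lsqrt)
    have "(s\<^sup>2 / \<epsilon> + \<epsilon>)\<^sup>2 = (s\<^sup>2 / \<epsilon>)\<^sup>2 + 2 * s\<^sup>2 + \<epsilon>\<^sup>2"
      using eps by (simp add: power2_sum)
    then show "s\<^sup>2 + \<epsilon>\<^sup>2 \<le> (s\<^sup>2 / \<epsilon> + \<epsilon>)\<^sup>2" by simp
  qed (use eps in auto)
  then show ?thesis by (simp add: plastic_potential_def)
qed

text \<open>The tangent at \<open>b\<close> lies below the graph; it amounts to Cauchy-Schwarz for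
  the vectors \<open>(a, \<epsilon>)\<close> and \<open>(b, \<epsilon>)\<close>.\<close>

lemma plastic_potential_convex:
  "plastic_potential \<epsilon> b - plastic_potential \<epsilon> a \<le> plastic \<epsilon> b * (b - a)"
proof -
  define r where "r = sqrt (b\<^sup>2 + \<epsilon>\<^sup>2)"
  define s where "s = sqrt (a\<^sup>2 + \<epsilon>\<^sup>2)"
  have r: "r > 0" "r\<^sup>2 = b\<^sup>2 + \<epsilon>\<^sup>2" and s: "s > 0" "s\<^sup>2 = a\<^sup>2 + \<epsilon>\<^sup>2"
    using sqrt_pos[OF eps] by (simp_all add: r_def s_def)
  have "(a * b + \<epsilon>\<^sup>2)\<^sup>2 \<le> (s * r)\<^sup>2"
  proof -
    have "(s * r)\<^sup>2 - (a * b + \<epsilon>\<^sup>2)\<^sup>2 = (\<epsilon> * (a - b))\<^sup>2"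
      unfolding power_mult_distrib r(2) s(2) by (simp add: power2_eq_square algebra_simps)
    then show ?thesis using zero_le_power2[of "\<epsilon> * (a - b)"] by linarith
  qed
  then have "a * b + \<epsilon>\<^sup>2 \<le> s * r"
    using r(1) s(1) by (intro power2_le_imp_le[of "a * b + \<epsilon>\<^sup>2" "s * r"]) auto
  then have "r\<^sup>2 - s * r \<le> b * (b - a)"
    unfolding r(2) by (simp add: power2_eq_square algebra_simps)
  then have "(r - s) * r \<le> b * (b - a)"
    by (simp add: power2_eq_square algebra_simps)
  then have "r - s \<le> b * (b - a) / r"
    using r(1) by (simp add: pos_le_divide_eq)
  then show ?thesis
    by (simp add: plastic_potential_def plastic_def r_def s_def)
qed

lemma continuous_plastic_potential: "continuous_on A (plastic_potential \<epsilon>)"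
  unfolding plastic_potential_def by (intro continuous_intros)

end

context viscoplastic_strip
begin

text \<open>Testing the equation with \<open>\<partial>\<^sub>x R\<close> requires the time derivative of the integral \<open>J\<close> of
  \<open>plastic_potential \<epsilon> p\<close>. Convexity bounds backward difference quotients of \<open>J\<close> by the pairing of
  \<open>- \<partial>\<^sub>x R\<close> with backward difference quotients of \<open>u\<close>, where \<open>u (t, x) = u0 x\<close> for \<open>t < 0\<close>.\<close>

lemma stress_work_bound:
  assumes p0: "primitive_on UNIV u0 p0" and p0m: "p0 \<in> borel_measurable borel"
    and p02: "integrable lborel (\<lambda>x. (p0 x)\<^sup>2)" and u02: "integrable lborel (\<lambda>x. (u0 x)\<^sup>2)"
    and p01: "integrable lborel p0"
  shows "(\<integral>q. dR q * utS q \<partial>lborel) \<le> (\<integral>x. \<bar>p0 x\<bar> \<partial>lborel)"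
proof -
  let ?\<Phi> = "plastic_potential \<epsilon>"
  have m\<Phi>[measurable]: "?\<Phi> \<in> borel_measurable borel"
    by (rule borel_measurable_continuous_onI[OF continuous_plastic_potential[OF eps]])
  define W where "W q = ?\<Phi> (pS q)" for q
  define j where "j t = (\<integral>x. W (t, x) \<partial>lborel)" for t
  define J0 where "J0 = (\<integral>x. ?\<Phi> (p0 x) \<partial>lborel)"
  have int\<Phi>: "integrable lborel (\<lambda>x. ?\<Phi> (f x))"
    if "f \<in> borel_measurable borel" "integrable lborel (\<lambda>x. (f x)\<^sup>2)" for f :: "'a::euclidean_space \<Rightarrow> real"
  proof (rule Bochner_Integration.integrable_bound)
    show "integrable lborel (\<lambda>x. (f x)\<^sup>2 / \<epsilon>)" using that by simp
    show "(\<lambda>x. ?\<Phi> (f x)) \<in> borel_measurable lborel" using that by simp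
    show "AE x in lborel. norm (?\<Phi> (f x)) \<le> norm ((f x)\<^sup>2 / \<epsilon>)"
      using plastic_potential_nonneg[OF eps] plastic_potential_le_square[OF eps] eps by (intro AE_I2) simp
  qed
  have iW: "integrable lborel W" unfolding W_def by (rule int\<Phi>[OF pS_borel pS_L2])
  have ij: "integrable lborel j" using AE_slice_integrable(3)[OF iW] by (simp add: j_def[abs_def])
  have j0: "j t \<ge> 0" for t
    unfolding j_def W_def by (intro Bochner_Integration.integral_nonneg plastic_potential_nonneg[OF eps])
  have jout: "j t = 0" if "t \<notin> {0<..<T}" for t
    using that plastic_potential_0[OF eps] by (auto simp: j_def W_def pS_def)
  have J0: "J0 \<ge> 0" "J0 \<le> (\<integral>x. \<bar>p0 x\<bar> \<partial>lborel)"
    unfolding J0_def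
    by (auto intro!: Bochner_Integration.integral_nonneg integral_mono plastic_potential_nonneg[OF eps]
        plastic_potential_le_abs[OF eps] int\<Phi> p0m p02 p01 integrable_abs)
  obtain K where K: "AE t in lborel. 0 < t \<and> t < T \<longrightarrow> good K t" using AE_good by blast
  \<comment> \<open>\<open>v\<close> points backward in time, so \<open>D h\<close> integrates
    \<open>ut\<close> over [t - h, t], in the form that \<open>L2_average_limit\<close> treats. By
    \<open>AE_time_slices\<close> it is the backward difference of \<open>u\<close>.\<close>
  define v :: "real \<times> real" where "v = (-1, 0)"
  define D where "D h q = (\<integral>s. indicator {0..h} s * utS (q + s *\<^sub>R v) \<partial>lborel)" for h q
  \<comment> \<open>Convexity bounds the pairing at time \<open>t\<close> by the decrease of
    \<open>j\<close> from \<open>t - h\<close> to \<open>t\<close>. Integrated over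
    \<open>t\<close>, the two translates of \<open>j\<close> cancel; only times in [0, h], where the
    earlier slice is the initial one, leave something, namely \<open>h * J0\<close>.\<close>
  have key: "(\<integral>q. dR q * D h q \<partial>lborel) \<le> h * J0" if h: "h > 0" for h
  proof -
    have i3: "integrable (lborel \<Otimes>\<^sub>M lborel) (\<lambda>(s, q). indicator {0..h} s * (dR q * utS (q + s *\<^sub>R v)))"
      by (rule L2_shift_product_integrable[OF dR_borel dR_L2 utS_borel utS_L2])
    have "integrable lborel (\<lambda>q. \<integral>s. indicator {0..h} s * (dR q * utS (q + s *\<^sub>R v)) \<partial>lborel)"
      by (rule lborel_pair.integrable_snd[OF i3])
    moreover have "(\<integral>s. indicator {0..h} s * (dR q * utS (q + s *\<^sub>R v)) \<partial>lborel) = dR q * D h q" for q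
      unfolding D_def mult.left_commute[of _ "dR q"] by simp
    ultimately have iD: "integrable lborel (\<lambda>q. dR q * D h q)" by simp
    define k where "k t = (\<integral>x. dR (t, x) * D h (t, x) \<partial>lborel)" for t
    have ik: "integrable lborel k" using AE_slice_integrable(3)[OF iD] by (simp add: k_def[abs_def])
    have k_eq: "AE x in lborel. D h (t, x) = u (max t 0, x) - u (max (t - h) 0, x)" if t: "t < T" for t
      using AE_time_slices
    proof eventually_elim
      case (elim x)
      have "u (max t 0, x) - u (max (t - h) 0, x) = (LBINT s:{t - h..t}. utS (s, x))"
        using primitive_onD(2)[OF elim, of "t - h" t] t h by simp
      also have "\<dots> = (\<integral>s. indicator {0..h} s * utS (t + - 1 * s, x) \<partial>lborel)"
        unfolding set_lebesgue_integral_def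
        by (subst lborel_integral_real_affine[of "-1" _ t])
           (auto intro!: Bochner_Integration.integral_cong simp: indicator_def)
      finally show ?case by (simp add: D_def v_def)
    qed
    define jh where "jh t = (if t < h then J0 else j (t - h))" for t
    have le: "AE t in lborel. t \<in> {0<..<T} \<longrightarrow> j t - jh t \<le> - k t"
    proof -
      \<comment> \<open>Both \<open>t\<close> and \<open>t - h\<close> must be good times. The
        single time \<open>h\<close> is discarded below, since there the earlier time is 0, which is
        not good.\<close>
      have K': "AE t in lborel. 0 < - h + t \<and> - h + t < T \<longrightarrow> good K (- h + t)"
        by (rule AE_lborel_translate[OF K])
      show ?thesis
        using K K' AE_stress_slices AE_lborel_singleton[of h] AE_slice_integrable(1)[OF dR_L2]
      proof (eventually_elim, intro impI)
        fix t assume A: "0 < t \<and> t < T \<longrightarrow> good K t" "0 < - h + t \<and> - h + t < T \<longrightarrow> good K (- h + t)"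
          "0 < t \<and> t < T \<longrightarrow> primitive_on UNIV (\<lambda>x. plastic \<epsilon> (p (t, x))) (\<lambda>x. dR (t, x))"
          "t \<noteq> h" "integrable lborel (\<lambda>x. (dR (t, x))\<^sup>2)" "t \<in> {0<..<T}"
        then have t: "0 < t" "t < T" and g: "good K t" by auto
        define U where "U x = u (t, x)" for x
        define P where "P x = p (t, x)" for x
        define U' where "U' x = u (max (t - h) 0, x)" for x
        define P' where "P' x = (if t < h then p0 x else p (t - h, x))" for x
        define Q where "Q x = dR (t, x)" for x
        note g' = g[unfolded good_def]
        have pU: "primitive_on UNIV U P" and P2: "integrable lborel (\<lambda>x. (P x)\<^sup>2)" and U2: "integrable lborel (\<lambda>x. (U x)\<^sup>2)"
          using g' by (simp_all add: U_def[abs_def] P_def[abs_def])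
        have cP: "continuous_on UNIV P" using g' by (simp add: P_def[abs_def])
        have Pm[measurable]: "P \<in> borel_measurable borel" by (rule borel_measurable_continuous_onI[OF cP])
        have cU: "continuous_on UNIV U" "continuous_on UNIV U'"
          using u_slice_continuous[of t] u_slice_continuous[of "max (t - h) 0"] t by (simp_all add: U_def[abs_def] U'_def[abs_def])
        have Um[measurable]: "U \<in> borel_measurable borel" "U' \<in> borel_measurable borel"
          using cU by (auto intro: borel_measurable_continuous_onI)
        have prime: "primitive_on UNIV U' P' \<and> P' \<in> borel_measurable borel \<and> integrable lborel (\<lambda>x. (P' x)\<^sup>2)
            \<and> integrable lborel (\<lambda>x. (U' x)\<^sup>2) \<and> jh t = (\<integral>x. ?\<Phi> (P' x) \<partial>lborel)"
        proof (cases "t < h")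
          case True
          then show ?thesis
            using p0 p0m p02 u02 by (simp add: U'_def[abs_def] P'_def[abs_def] jh_def J0_def u_initial)
        next
          case False
          then have th: "0 < t - h" "t - h < T" using A(4) t h by auto
          then have g2: "good K (t - h)" using A(2) by simp
          have "(\<lambda>x. p (t - h, x)) \<in> borel_measurable borel"
            using g2 by (auto simp: good_def intro: borel_measurable_continuous_onI)
          then show ?thesis
            using False th g2 by (simp add: good_def U'_def[abs_def] P'_def[abs_def] jh_def j_def W_def pS_def)
        qed
        then have P'm[measurable]: "P' \<in> borel_measurable borel" by simp
        have Q2: "integrable lborel (\<lambda>x. (Q x)\<^sup>2)" using A(5) by (simp add: Q_def)
        have Qm[measurable]: "Q \<in> borel_measurable borel"
          unfolding Q_def[abs_def] by (auto intro!: measurable_compose[OF _ dR_borel])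
        have pR: "primitive_on UNIV (\<lambda>x. plastic \<epsilon> (P x)) Q"
          using A(3) t by (simp add: P_def Q_def[abs_def])
        have Rm[measurable]: "(\<lambda>x. plastic \<epsilon> (P x)) \<in> borel_measurable borel"
          by (rule measurable_compose[OF Pm borel_measurable_continuous_onI[OF continuous_plastic[OF eps]]])
        have R2: "integrable lborel (\<lambda>x. (plastic \<epsilon> (P x))\<^sup>2)"
        proof (rule Bochner_Integration.integrable_bound)
          show "integrable lborel (\<lambda>x. (P x)\<^sup>2 / \<epsilon>\<^sup>2)" using P2 by simp
          show "AE x in lborel. norm ((plastic \<epsilon> (P x))\<^sup>2) \<le> norm ((P x)\<^sup>2 / \<epsilon>\<^sup>2)"
            using plastic_square_le[OF eps] by simp
        qed measurable
        have dU2: "integrable lborel (\<lambda>x. (U x - U' x)\<^sup>2)" and dP2: "integrable lborel (\<lambda>x. (P x - P' x)\<^sup>2)"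
          using U2 P2 prime by (auto intro!: square_integrable_diff)
        have i: "integrable lborel (\<lambda>x. (U x - U' x) * plastic \<epsilon> (P x))"
          "integrable lborel (\<lambda>x. (P x - P' x) * plastic \<epsilon> (P x))"
          "integrable lborel (\<lambda>x. (U x - U' x) * Q x)"
          by (rule integrable_mult_L2; use dU2 dP2 R2 Q2 in simp)+
        have "primitive_on UNIV (\<lambda>x. U x - U' x) (\<lambda>x. P x - P' x)"
          using primitive_on_diff[OF pU] prime by simp
        from integration_by_parts_line[OF this pR i]
        have ibp: "(\<integral>x. (P x - P' x) * plastic \<epsilon> (P x) \<partial>lborel) = - (\<integral>x. (U x - U' x) * Q x \<partial>lborel)" by simp
        have "j t - jh t = (\<integral>x. ?\<Phi> (P x) - ?\<Phi> (P' x) \<partial>lborel)"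
          using prime t int\<Phi>[OF Pm P2] int\<Phi>[OF P'm] by (simp add: j_def W_def pS_def P_def)
        also have "\<dots> \<le> (\<integral>x. (P x - P' x) * plastic \<epsilon> (P x) \<partial>lborel)"
        proof (rule integral_mono)
          show "integrable lborel (\<lambda>x. ?\<Phi> (P x) - ?\<Phi> (P' x))"
            using prime int\<Phi>[OF Pm P2] int\<Phi>[OF P'm] by simp
          show "?\<Phi> (P x) - ?\<Phi> (P' x) \<le> (P x - P' x) * plastic \<epsilon> (P x)" for x
            using plastic_potential_convex[OF eps, of "P x" "P' x"] by (simp add: mult.commute)
        qed (rule i(2))
        also have "\<dots> = - (\<integral>x. (U x - U' x) * Q x \<partial>lborel)" by (rule ibp)
        also have "(\<integral>x. (U x - U' x) * Q x \<partial>lborel) = k t"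
          unfolding k_def
        proof (rule integral_cong_AE)
          show "(\<lambda>x. dR (t, x) * D h (t, x)) \<in> borel_measurable lborel"
          proof -
            have "(\<lambda>x. D h (t, x)) \<in> borel_measurable lborel"
              unfolding D_def by measurable
            then show ?thesis using Qm by (simp add: Q_def[abs_def])
          qed
          show "AE x in lborel. (U x - U' x) * Q x = dR (t, x) * D h (t, x)"
            using k_eq[OF t(2)] by eventually_elim (use t in \<open>simp add: U_def U'_def Q_def\<close>)
        qed measurable
        finally show "j t - jh t \<le> - k t" .
      qed
    qed
    have ish: "integrable lborel (\<lambda>t. j (t - h))" "(\<integral>t. j (t - h) \<partial>lborel) = (\<integral>t. j t \<partial>lborel)"
      using integrable_translate[OF ij, of "- h"] integral_translate[OF ij, of "- h"] by simp_all
    have k0: "k t = 0" if "t \<notin> {0<..<T}" for t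
      using that dR_outside[of "(t, _)"] by (auto simp: k_def)
    \<comment> \<open>Outside (0, T) both \<open>k\<close> and \<open>j\<close> vanish at
      \<open>t\<close> and the other terms are nonnegative, so the inequality holds on the whole
      line, where integrals are translation invariant.\<close>
    have ub: "AE t in lborel. k t \<le> J0 * indicator {0..h} t + j (t - h) - j t"
      using le
    proof eventually_elim
      case (elim t)
      show ?case
      proof (cases "t \<in> {0<..<T}")
        case True
        then have "k t \<le> jh t - j t" using elim by simp
        also have "jh t \<le> J0 * indicator {0..h} t + j (t - h)"
          using True J0(1) j0[of "t - h"] by (auto simp: jh_def indicator_def)
        finally show ?thesis by simp
      next
        case False
        then show ?thesis using k0[OF False] jout[OF False] j0[of "t - h"] J0(1) by (simp add: indicator_def)
      qed
    qed
    have iI: "integrable lborel (\<lambda>t. J0 * indicator {0..h} t)"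
      using h by (intro integrable_mult_right) (simp add: integrable_indicator_iff)
    have "(\<integral>q. dR q * D h q \<partial>lborel) = (\<integral>t. k t \<partial>lborel)"
      unfolding k_def by (rule AE_slice_integrable(2)[OF iD])
    also have "\<dots> \<le> (\<integral>t. J0 * indicator {0..h} t + j (t - h) - j t \<partial>lborel)"
      by (rule integral_mono_AE[OF ik _ ub]) (use ij ish iI in auto)
    also have "\<dots> = h * J0"
      using ij ish iI h by simp
    finally show ?thesis .
  qed
  have "(\<lambda>n. \<integral>q. dR q * (real (Suc n) * D (1 / real (Suc n)) q) \<partial>lborel) \<longlonglongrightarrow> (\<integral>q. dR q * utS q \<partial>lborel)"
    unfolding D_def by (rule L2_average_limit[OF dR_borel dR_L2 utS_borel utS_L2])
  moreover have "(\<integral>q. dR q * (real (Suc n) * D (1 / real (Suc n)) q) \<partial>lborel) \<le> J0" for n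
  proof -
    have "(\<integral>q. dR q * (real (Suc n) * D (1 / real (Suc n)) q) \<partial>lborel) = real (Suc n) * (\<integral>q. dR q * D (1 / real (Suc n)) q \<partial>lborel)"
      by (simp add: mult.left_commute)
    also have "\<dots> \<le> real (Suc n) * (1 / real (Suc n) * J0)"
      by (intro mult_left_mono key) auto
    finally show ?thesis by simp
  qed
  ultimately have "(\<integral>q. dR q * utS q \<partial>lborel) \<le> J0"
    by (intro LIMSEQ_le_const2) auto
  then show ?thesis using J0(2) by simp
qed

lemma dR_L2_bound:
  assumes "primitive_on UNIV u0 p0" "p0 \<in> borel_measurable borel"
    and "integrable lborel (\<lambda>x. (p0 x)\<^sup>2)" "integrable lborel (\<lambda>x. (u0 x)\<^sup>2)" "integrable lborel p0"
  shows "(\<integral>q. (dR q)\<^sup>2 \<partial>lborel) \<le> (\<integral>x. \<bar>p0 x\<bar> \<partial>lborel) + T / 4 * (\<integral>x. (u0 x)\<^sup>2 \<partial>lborel)"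
proof -
  have i: "integrable lborel (\<lambda>q. dR q * utS q)"
    by (rule integrable_mult_L2) (use dR_L2 utS_L2 in auto)
  have "(\<integral>q. (dR q)\<^sup>2 \<partial>lborel) \<le> (\<integral>q. dR q * utS q + (uS q)\<^sup>2 / 4 \<partial>lborel)"
    by (rule integral_mono) (use dR_L2 i uS_L2 stress_square_le[OF eps] in \<open>auto simp: dR_def\<close>)
  also have "\<dots> = (\<integral>q. dR q * utS q \<partial>lborel) + (\<integral>q. (uS q)\<^sup>2 \<partial>lborel) / 4"
    using i uS_L2 by simp
  also have "\<dots> \<le> (\<integral>x. \<bar>p0 x\<bar> \<partial>lborel) + T * (\<integral>x. (u0 x)\<^sup>2 \<partial>lborel) / 4"
    using stress_work_bound[OF assms] energy_bound[OF assms(4)] by (intro add_mono divide_right_mono) auto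
  finally show ?thesis by simp
qed

end

section \<open>Passage to the limit\<close>

text \<open>In the bound, \<open>C\<close> comes from the stress work and \<open>T * c / 2\<close>
  is \<open>T / 4\<close> times the squared initial norm, which is at most \<open>2 * c\<close>.
  Neither depends on \<open>\<epsilon>\<close>.\<close>

lemma viscoplastic_stress_derivative:
  assumes eps: "\<epsilon> > 0" and T: "T > 0" and sol: "viscoplastic_solution \<epsilon> u0 u p"
    and u0: "u0 \<in> H2" "continuous_on UNIV u0"
    and C: "L1_norm lborel (wderiv u0) \<le> ennreal C" "C \<ge> 0"
    and c: "1/2 * (L2_norm lborel u0)\<^sup>2 \<le> c"
  shows "\<exists>d. weak_dx (strip T) (\<lambda>q. plastic \<epsilon> (p q)) d \<and> d \<in> X_space T \<and>
    (\<lambda>q. - d q) \<in> X_space T \<and> L2_functional T (\<lambda>q. - d q) \<in> subdiff_zero T (Psi T) \<and>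
    X_norm T (\<lambda>q. - d q) \<le> sqrt (C + T * c / 2)"
proof -
  obtain ut where ut: "weak_dt (strip T) u ut" "ut \<in> Linf_L2 {0<..<T}"
    using sol T unfolding viscoplastic_solution_def by blast
  interpret viscoplastic_strip \<epsilon> T u0 u p ut
    by standard (fact eps T sol ut)+
  obtain g where "weak_deriv u0 g"
    using u0(1) unfolding H2_def by blast
  then have w: "weak_deriv u0 (wderiv u0)" by (rule weak_deriv_wderiv)
  note H = H2_weak_deriv[OF u0 w]
  have nn: "(\<integral>\<^sup>+ x. ennreal (norm (wderiv u0 x)) \<partial>lborel) \<le> ennreal C"
    using C(1) by (simp add: L1_norm_def)
  have i1: "integrable lborel (wderiv u0)"
    by (rule integrableI_bounded) (use H(1) nn in \<open>auto intro: le_less_trans\<close>)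
  have "ennreal (\<integral>x. \<bar>wderiv u0 x\<bar> \<partial>lborel) \<le> ennreal C"
    using nn nn_integral_eq_integral[OF integrable_norm[OF i1]] by simp
  then have le: "(\<integral>x. \<bar>wderiv u0 x\<bar> \<partial>lborel) \<le> C"
    using C(2) by simp
  have c': "(\<integral>x. (u0 x)\<^sup>2 \<partial>lborel) \<le> 2 * c"
    using c by (simp add: L2_norm_def)
  have "(\<integral>q. (dR q)\<^sup>2 \<partial>lborel) \<le> (\<integral>x. \<bar>wderiv u0 x\<bar> \<partial>lborel) + T / 4 * (\<integral>x. (u0 x)\<^sup>2 \<partial>lborel)"
    by (rule dR_L2_bound[OF weak_deriv_primitive[OF w u0(2)] H(1,2,3) i1])
  also have "\<dots> \<le> C + T / 4 * (2 * c)"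
    using T by (intro add_mono le mult_left_mono c') auto
  finally have "X_norm T (\<lambda>q. - dR q) \<le> sqrt (C + T * c / 2)"
    unfolding X_norm_eq by (simp add: indicator_dR)
  then show ?thesis
    using weak_dx_dR dR_X_space dR_subdiff by blast
qed

lemma C1c_X_space:
  assumes "\<phi> \<in> C1c (strip T)"
  shows "\<phi> \<in> X_space T"
proof -
  have os: "open (strip T)" by (intro open_Times) auto
  obtain K where K: "compact K" "K \<subseteq> strip T" "\<And>q. q \<in> strip T - K \<Longrightarrow> \<phi> q = 0" "continuous_on (strip T) \<phi>"
    using C1c_plane_obtain[OF assms os] by metis
  show ?thesis
    using compactly_supported_extension(1,3)[OF K(4,1,2,3)] by (simp add: X_space_iff)
qed

lemma dual_restrict:
  assumes \<eta>: "\<eta> \<in> dual V N" and W: "W \<subseteq> V" and N: "\<And>w. w \<in> W \<Longrightarrow> 0 \<le> N w" "\<And>w. w \<in> W \<Longrightarrow> N w \<le> N' w"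
  shows "\<eta> \<in> dual W N'"
proof -
  obtain C where C: "\<And>w. w \<in> V \<Longrightarrow> \<bar>\<eta> w\<bar> \<le> C * N w"
    using \<eta> unfolding dual_def by blast
  have "\<bar>\<eta> w\<bar> \<le> \<bar>C\<bar> * N' w" if w: "w \<in> W" for w
  proof -
    have "\<bar>\<eta> w\<bar> \<le> C * N w" using C w W by blast
    also have "\<dots> \<le> \<bar>C\<bar> * N' w" using N[OF w] by (intro mult_mono) auto
    finally show ?thesis .
  qed
  then show ?thesis
    using \<eta> W unfolding dual_def by (auto simp: subset_iff)
qed

lemma X_space_lincomb:
  assumes "v \<in> X_space T" "w \<in> X_space T"
  shows "(\<lambda>q. a * v q + b * w q) \<in> X_space T"
proof -
  define vS where "vS q = indicator (strip T) q * v q" for q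
  define wS where "wS q = indicator (strip T) q * w q" for q
  have v: "vS \<in> borel_measurable borel" "integrable lborel (\<lambda>q. (vS q)\<^sup>2)"
    and w: "wS \<in> borel_measurable borel" "integrable lborel (\<lambda>q. (wS q)\<^sup>2)"
    using assms by (auto simp: X_space_iff vS_def[abs_def] wS_def[abs_def])
  have eq: "indicator (strip T) q * (a * v q + b * w q) = a * vS q - (- b) * wS q" for q
    by (simp add: vS_def wS_def algebra_simps)
  have "(\<lambda>q. a * vS q) \<in> borel_measurable lborel" "(\<lambda>q. (- b) * wS q) \<in> borel_measurable lborel"
    using v(1) w(1) by measurable
  moreover have "integrable lborel (\<lambda>q. (a * vS q)\<^sup>2)" "integrable lborel (\<lambda>q. ((- b) * wS q)\<^sup>2)"
    unfolding power_mult_distrib using v(2) w(2) by auto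
  ultimately have "integrable lborel (\<lambda>q. (a * vS q - (- b) * wS q)\<^sup>2)"
    by (rule square_integrable_diff)
  moreover have "(\<lambda>q. a * vS q - (- b) * wS q) \<in> borel_measurable borel"
    using v(1) w(1) by measurable
  ultimately show ?thesis
    unfolding X_space_iff eq by blast
qed

text \<open>No subsequence has to be extracted: the limit is determined on the dense set of test
  functions, so bounded functionals converge everywhere.\<close>

lemma dual_limit_from_test_functions:
  assumes T: "T > 0" and g: "\<And>n. g n \<in> X_space T" and M: "\<And>n. X_norm T (g n) \<le> M"
    and conv: "\<And>\<phi>. \<phi> \<in> C1c (strip T) \<Longrightarrow> convergent (\<lambda>n. L2_functional T (g n) \<phi>)"
  defines "\<zeta> \<equiv> \<lambda>w. lim (\<lambda>n. L2_functional T (g n) w)"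
  shows "\<And>w. w \<in> X_space T \<Longrightarrow> (\<lambda>n. L2_functional T (g n) w) \<longlonglongrightarrow> \<zeta> w"
    "\<zeta> \<in> dual (X_space T) (X_norm T)"
proof -
  define \<eta> where "\<eta> n = L2_functional T (g n)" for n
  have lin: "\<eta> n (\<lambda>q. a * v q + b * w q) = a * \<eta> n v + b * \<eta> n w"
    if "v \<in> X_space T" "w \<in> X_space T" for n v w a b
    using L2_functional_dual[OF g[of n]] that unfolding dual_def \<eta>_def by blast
  have M0: "M \<ge> 0" using M[of 0] X_norm_eq[of T "g 0"] by (auto intro: order_trans[rotated])
  have bound: "\<bar>\<eta> n w\<bar> \<le> M * X_norm T w" if "w \<in> X_space T" for n w
  proof -
    have "\<bar>\<eta> n w\<bar> \<le> X_norm T (g n) * X_norm T w"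
      unfolding \<eta>_def by (rule L2_functional_bound[OF g that])
    also have "\<dots> \<le> M * X_norm T w"
      by (intro mult_right_mono M) (simp add: X_norm_eq)
    finally show ?thesis .
  qed
  show lim: "(\<lambda>n. L2_functional T (g n) w) \<longlonglongrightarrow> \<zeta> w" if w: "w \<in> X_space T" for w
  proof -
    have "Cauchy (\<lambda>n. \<eta> n w)"
    proof (rule metric_CauchyI)
      fix e :: real assume e: "e > 0"
      let ?wS = "\<lambda>q. indicator (strip T) q * w q"
      \<comment> \<open>With this accuracy the common bound \<open>M\<close> makes the error of
        replacing \<open>w\<close> by \<open>\<phi>\<close> at most \<open>e / 4\<close> for all
        \<open>n\<close> at once.\<close>
      have "(e / (4 * (M + 1)))\<^sup>2 > 0" using e M0 by simp
      then obtain \<phi> where \<phi>: "\<phi> \<in> C1c (strip T)" "\<And>q. q \<notin> strip T \<Longrightarrow> \<phi> q = 0"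
        "(\<integral>q. (?wS q - \<phi> q)\<^sup>2 \<partial>lborel) < (e / (4 * (M + 1)))\<^sup>2"
        using C1c_dense_strip[of ?wS T "(e / (4 * (M + 1)))\<^sup>2"] w T unfolding X_space_iff by auto
      have \<phi>X: "\<phi> \<in> X_space T" by (rule C1c_X_space[OF \<phi>(1)])
      have close: "\<bar>\<eta> n w - \<eta> n \<phi>\<bar> \<le> e / 4" for n
      proof -
        have "\<eta> n w - \<eta> n \<phi> = \<eta> n (\<lambda>q. 1 * w q + (-1) * \<phi> q)"
          using lin[OF w \<phi>X, of n 1 "-1"] by simp
        also have "\<bar>\<dots>\<bar> \<le> M * X_norm T (\<lambda>q. 1 * w q + (-1) * \<phi> q)"
          by (rule bound[OF X_space_lincomb[OF w \<phi>X]])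
        also have "X_norm T (\<lambda>q. 1 * w q + (-1) * \<phi> q) = sqrt (\<integral>q. (?wS q - \<phi> q)\<^sup>2 \<partial>lborel)"
        proof -
          have "indicator (strip T) q * (1 * w q + (-1) * \<phi> q) = ?wS q - \<phi> q" for q
            using \<phi>(2)[of q] by (cases "q \<in> strip T") auto
          then show ?thesis unfolding X_norm_eq by (simp only:)
        qed
        also have "\<dots> \<le> e / (4 * (M + 1))"
          using \<phi>(3) e M0 by (intro real_le_lsqrt) auto
        also have "M * (e / (4 * (M + 1))) \<le> e / 4"
          using e M0 by (simp add: field_simps)
        finally show ?thesis using M0 by (simp add: mult_left_mono)
      qed
      have "Cauchy (\<lambda>n. \<eta> n \<phi>)"
        using conv[OF \<phi>(1)] by (simp add: \<eta>_def convergent_Cauchy)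
      then obtain N where N: "\<And>m n. m \<ge> N \<Longrightarrow> n \<ge> N \<Longrightarrow> dist (\<eta> m \<phi>) (\<eta> n \<phi>) < e / 4"
        using e unfolding Cauchy_def by (metis zero_less_divide_iff zero_less_numeral)
      show "\<exists>N. \<forall>m\<ge>N. \<forall>n\<ge>N. dist (\<eta> m w) (\<eta> n w) < e"
      proof (intro exI[of _ N] allI impI)
        fix m n assume "m \<ge> N" "n \<ge> N"
        then show "dist (\<eta> m w) (\<eta> n w) < e"
          using N[of m n] close[of m] close[of n] e unfolding dist_real_def abs_le_iff abs_less_iff by linarith
      qed
    qed
    then show ?thesis
      unfolding \<zeta>_def \<eta>_def by (simp add: Cauchy_convergent_iff convergent_LIMSEQ_iff)
  qed
  show "\<zeta> \<in> dual (X_space T) (X_norm T)"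
    unfolding dual_def
  proof (intro CollectI conjI ballI allI exI[of _ M])
    fix v w and a b :: real assume v: "v \<in> X_space T" and w: "w \<in> X_space T"
    have "(\<lambda>n. a * \<eta> n v + b * \<eta> n w) \<longlonglongrightarrow> a * \<zeta> v + b * \<zeta> w"
      unfolding \<eta>_def by (intro tendsto_intros lim v w)
    then have "(\<lambda>n. \<eta> n (\<lambda>q. a * v q + b * w q)) \<longlonglongrightarrow> a * \<zeta> v + b * \<zeta> w"
      by (simp only: lin[OF v w])
    then show "\<zeta> (\<lambda>q. a * v q + b * w q) = a * \<zeta> v + b * \<zeta> w"
      using LIMSEQ_unique[OF lim[OF X_space_lincomb[OF v w]]] unfolding \<eta>_def by blast
  next
    fix w assume w: "w \<in> X_space T"
    show "\<bar>\<zeta> w\<bar> \<le> M * X_norm T w"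
      by (rule LIMSEQ_le_const2[OF tendsto_rabs[OF lim[OF w]]]) (use bound[OF w] in \<open>auto simp: \<eta>_def\<close>)
  qed
qed

text \<open>Weak-* convergence is given on bounded boxes only; the support of
  \<open>dx \<phi>\<close> fits into one of them, and there \<open>dx \<phi>\<close> is an
  admissible \<open>L^1\<close> test function.\<close>

lemma stress_pairing_limit:
  assumes R: "\<And>r. r > 0 \<Longrightarrow> wstar_Linf (lborel_on ({0<..<T} \<times> {-r<..<r})) Rn R"
    and d: "\<And>n. weak_dx (strip T) (Rn n) (d n)" and \<phi>: "\<phi> \<in> C1c (strip T)"
  shows "(\<lambda>n. L2_functional T (\<lambda>q. - d n q) \<phi>) \<longlonglongrightarrow> - Dx_distr (strip T) R \<phi>"
proof -
  have os: "open (strip T)" by (intro open_Times) auto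
  then have Sm: "strip T \<in> sets borel" by auto
  obtain K where K: "compact K" "K \<subseteq> strip T" "\<And>q. q \<in> strip T - K \<Longrightarrow> dx \<phi> q = 0" "continuous_on (strip T) (dx \<phi>)"
    using C1c_plane_obtain[OF \<phi> os] by metis
  have "bounded K" by (rule compact_imp_bounded[OF K(1)])
  then obtain b where b: "\<And>q. q \<in> K \<Longrightarrow> norm q \<le> b" unfolding bounded_iff by blast
  \<comment> \<open>One more than a bound of the support, so that it lies inside the open
    box.\<close>
  define r where "r = \<bar>b\<bar> + 1"
  let ?B = "{0<..<T} \<times> {-r<..<r}"
  have Bm: "?B \<in> sets borel" by (intro borel_open open_Times) auto
  have KB: "K \<subseteq> ?B"
  proof
    fix q assume q: "q \<in> K"
    have "norm (snd q) \<le> \<bar>b\<bar>" using b[OF q] norm_snd_le[of "snd q" "fst q"] by simp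
    then show "q \<in> ?B" using K(2) q by (cases q) (auto simp: r_def abs_le_iff)
  qed
  have ind0: "indicator ?B q * dx \<phi> q = indicator (strip T) q * dx \<phi> q" for q
  proof (cases "q \<in> K")
    case True
    then have "q \<in> ?B" "q \<in> strip T" using K(2) KB by blast+
    then show ?thesis by (simp only: indicator_simps)
  next
    case False
    show ?thesis
    proof (cases "q \<in> strip T")
      case True
      then show ?thesis using K(3)[of q] False by simp
    next
      case False
      then have "q \<notin> ?B" by auto
      with False have "indicator ?B q = (0 :: real)" "indicator (strip T) q = (0 :: real)"
        by (metis indicator_simps(2))+
      then show ?thesis by (simp only:)
    qed
  qed
  have ind: "indicator ?B q * (f q * dx \<phi> q) = indicator (strip T) q * (f q * dx \<phi> q)" for f q
    using ind0[of q] by (simp only: mult.left_commute)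
  have "integrable (lborel_on ?B) (dx \<phi>)"
  proof -
    have "integrable lborel (\<lambda>q. indicator ?B q *\<^sub>R dx \<phi> q)"
      unfolding real_scaleR_def ind0 by (rule compactly_supported_extension(2)[OF K(4,1,2,3)])
    then show ?thesis using Bm by (subst integrable_restrict_space) auto
  qed
  moreover have "r > 0" by (simp add: r_def)
  ultimately have "(\<lambda>n. \<integral>q. Rn n q * dx \<phi> q \<partial>lborel_on ?B) \<longlonglongrightarrow> (\<integral>q. R q * dx \<phi> q \<partial>lborel_on ?B)"
    using R unfolding wstar_Linf_def L1_def by blast
  then have "(\<lambda>n. \<integral>q. Rn n q * dx \<phi> q \<partial>lborel_on (strip T)) \<longlonglongrightarrow> (\<integral>q. R q * dx \<phi> q \<partial>lborel_on (strip T))"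
    unfolding integral_lborel_on[OF Bm] integral_lborel_on[OF Sm] ind .
  moreover have "L2_functional T (\<lambda>q. - d n q) \<phi> = (\<integral>q. Rn n q * dx \<phi> q \<partial>lborel_on (strip T))" for n
    using d[of n] \<phi> unfolding weak_dx_def L2_functional_def by simp
  ultimately show ?thesis
    by (simp add: Dx_distr_def)
qed

theorem theorem3p3:
  fixes u_in :: "real \<Rightarrow> real"
    and ue_in :: "real \<Rightarrow> real \<Rightarrow> real"
    and ue pe :: "real \<Rightarrow> real \<times> real \<Rightarrow> real"
    and u R :: "real \<times> real \<Rightarrow> real"
    and e :: "nat \<Rightarrow> real"
    and c C1 u_lo u_hi T :: real
  assumes u_in: "u_in \<in> Linf lborel" "u_in \<in> BV UNIV" "u_in \<in> L2 lborel"
    and ue_in: "\<And>\<epsilon>. \<epsilon> \<in> {0<..<1} \<Longrightarrow>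
          ue_in \<epsilon> \<in> H2 \<and> ue_in \<epsilon> \<in> L1 lborel \<and>
          continuous_on UNIV (ue_in \<epsilon>) \<and> (ue_in \<epsilon> \<longlongrightarrow> 0) at_infinity"
    and constants: "c > 0" "C1 > 0" "u_lo \<le> u_hi"
    and energy: "\<And>\<epsilon>. \<epsilon> \<in> {0<..<1} \<Longrightarrow> 1/2 * (L2_norm lborel (ue_in \<epsilon>))\<^sup>2 \<le> c"
    and bounds: "AE x in lborel. u_lo \<le> u_in x \<and> u_in x \<le> u_hi"
          "\<And>\<epsilon>. \<epsilon> \<in> {0<..<1} \<Longrightarrow> AE x in lborel. u_lo \<le> ue_in \<epsilon> x \<and> ue_in \<epsilon> x \<le> u_hi"
    and W11: "\<And>\<epsilon>. \<epsilon> \<in> {0<..<1} \<Longrightarrow>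
          L1_norm lborel (ue_in \<epsilon>) + L1_norm lborel (wderiv (ue_in \<epsilon>)) \<le> ennreal C1"
    and flux: "\<And>\<epsilon>. \<epsilon> \<in> {0<..<1} \<Longrightarrow>
          L1_norm lborel (wderiv (\<lambda>x. (ue_in \<epsilon> x)\<^sup>2 / 2 - plastic \<epsilon> (wderiv (ue_in \<epsilon>) x)
             - \<epsilon> * wderiv (ue_in \<epsilon>) x)) \<le> ennreal C1"
    and weak_conv: "\<And>\<psi>. \<psi> \<in> Linf lborel \<Longrightarrow>
          ((\<lambda>\<epsilon>. \<integral>x. ue_in \<epsilon> x * \<psi> x \<partial>lborel) \<longlongrightarrow> (\<integral>x. u_in x * \<psi> x \<partial>lborel)) (at_right 0)"
    and strong_conv: "((\<lambda>\<epsilon>. L2_norm lborel (\<lambda>x. ue_in \<epsilon> x - u_in x)) \<longlongrightarrow> 0) (at_right 0)"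
    and sol: "\<And>\<epsilon>. \<epsilon> \<in> {0<..<1} \<Longrightarrow> viscoplastic_solution \<epsilon> (ue_in \<epsilon>) (ue \<epsilon>) (pe \<epsilon>)"
    and lim: "limit_pair u_in ue pe e u R"
    and T: "T > 0"
  shows "\<exists>dR :: real \<Rightarrow> real \<times> real \<Rightarrow> real.
     (\<forall>\<epsilon>\<in>{0<..<1}.
        weak_dx (strip T) (\<lambda>q. plastic \<epsilon> (pe \<epsilon> q)) (dR \<epsilon>) \<and>
        dR \<epsilon> \<in> L2 (lborel_on (strip T)) \<and>
        L2_functional T (\<lambda>q. - dR \<epsilon> q) \<in> subdiff_zero T (Psi T)) \<and>
     (\<exists>\<sigma> \<zeta>. strict_mono \<sigma> \<and>
        \<zeta> \<in> dual (X_space T) (X_norm T) \<and>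
        wstar_dual (Y_space T) (Y_norm T)
          (\<lambda>n. L2_functional T (\<lambda>q. - dR (e (\<sigma> n)) q)) \<zeta> \<and>
        (\<forall>\<phi>\<in>Cinfc (strip T). \<zeta> \<phi> = - Dx_distr (strip T) R \<phi>) \<and>
        \<zeta> \<in> subdiff_zero T (Psi T))"
proof -
  define M where "M = sqrt (C1 + T * c / 2)"
  have "\<forall>\<epsilon>\<in>{0<..<1}. \<exists>d. weak_dx (strip T) (\<lambda>q. plastic \<epsilon> (pe \<epsilon> q)) d \<and> d \<in> X_space T \<and>
      (\<lambda>q. - d q) \<in> X_space T \<and> L2_functional T (\<lambda>q. - d q) \<in> subdiff_zero T (Psi T) \<and>
      X_norm T (\<lambda>q. - d q) \<le> M"
  proof
    fix \<epsilon> :: real assume \<epsilon>: "\<epsilon> \<in> {0<..<1}"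
    have "L1_norm lborel (wderiv (ue_in \<epsilon>)) \<le> L1_norm lborel (ue_in \<epsilon>) + L1_norm lborel (wderiv (ue_in \<epsilon>))"
      by simp
    also have "\<dots> \<le> ennreal C1" by (rule W11[OF \<epsilon>])
    finally show "\<exists>d. weak_dx (strip T) (\<lambda>q. plastic \<epsilon> (pe \<epsilon> q)) d \<and> d \<in> X_space T \<and>
      (\<lambda>q. - d q) \<in> X_space T \<and> L2_functional T (\<lambda>q. - d q) \<in> subdiff_zero T (Psi T) \<and>
      X_norm T (\<lambda>q. - d q) \<le> M"
      unfolding M_def using ue_in[OF \<epsilon>] energy[OF \<epsilon>] constants \<epsilon>
      by (intro viscoplastic_stress_derivative[OF _ T sol[OF \<epsilon>]]) auto
  qed
  then obtain dR where dR: "\<And>\<epsilon>. \<epsilon> \<in> {0<..<1} \<Longrightarrow> weak_dx (strip T) (\<lambda>q. plastic \<epsilon> (pe \<epsilon> q)) (dR \<epsilon>)"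
    "\<And>\<epsilon>. \<epsilon> \<in> {0<..<1} \<Longrightarrow> dR \<epsilon> \<in> X_space T"
    "\<And>\<epsilon>. \<epsilon> \<in> {0<..<1} \<Longrightarrow> (\<lambda>q. - dR \<epsilon> q) \<in> X_space T"
    "\<And>\<epsilon>. \<epsilon> \<in> {0<..<1} \<Longrightarrow> L2_functional T (\<lambda>q. - dR \<epsilon> q) \<in> subdiff_zero T (Psi T)"
    "\<And>\<epsilon>. \<epsilon> \<in> {0<..<1} \<Longrightarrow> X_norm T (\<lambda>q. - dR \<epsilon> q) \<le> M"
    by (atomize_elim, subst (asm) bchoice_iff) blast
  have e: "e n \<in> {0<..<1}" for n
    using lim unfolding limit_pair_def by blast
  have wstar: "wstar_Linf (lborel_on ({0<..<T} \<times> {-r<..<r})) (\<lambda>n q. plastic (e n) (pe (e n) q)) R"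
    if "r > 0" for r
    using lim T that unfolding limit_pair_def by blast
  define \<eta> where "\<eta> n = L2_functional T (\<lambda>q. - dR (e n) q)" for n
  define \<zeta> where "\<zeta> w = lim (\<lambda>n. \<eta> n w)" for w
  have test: "(\<lambda>n. \<eta> n \<phi>) \<longlonglongrightarrow> - Dx_distr (strip T) R \<phi>" if "\<phi> \<in> C1c (strip T)" for \<phi>
    unfolding \<eta>_def by (rule stress_pairing_limit[OF wstar dR(1)[OF e] that])
  have conv: "convergent (\<lambda>n. L2_functional T (\<lambda>q. - dR (e n) q) \<phi>)" if "\<phi> \<in> C1c (strip T)" for \<phi>
    using test[OF that] unfolding \<eta>_def by (rule convergentI)
  have \<zeta>: "(\<lambda>n. \<eta> n w) \<longlonglongrightarrow> \<zeta> w" if "w \<in> X_space T" for w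
    unfolding \<zeta>_def \<eta>_def
    by (rule dual_limit_from_test_functions(1)[OF T dR(3)[OF e] dR(5)[OF e]]) (use conv that in blast)+
  have \<zeta>_dual: "\<zeta> \<in> dual (X_space T) (X_norm T)"
    unfolding \<zeta>_def[abs_def] \<eta>_def
    by (rule dual_limit_from_test_functions(2)[OF T dR(3)[OF e] dR(5)[OF e]]) (use conv in blast)
  have XY: "Y_space T \<subseteq> X_space T" by (auto simp: Y_space_def)
  have norms: "0 \<le> X_norm T w" "X_norm T w \<le> Y_norm T w" for w
    by (simp_all add: X_norm_eq Y_norm_def enn2real_nonneg)
  have "wstar_dual (Y_space T) (Y_norm T) \<eta> \<zeta>"
    unfolding wstar_dual_def
  proof (intro conjI allI ballI)
    show "\<eta> n \<in> dual (Y_space T) (Y_norm T)" for n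
      unfolding \<eta>_def by (rule dual_restrict[OF L2_functional_dual[OF dR(3)[OF e]] XY norms])
    show "\<zeta> \<in> dual (Y_space T) (Y_norm T)"
      by (rule dual_restrict[OF \<zeta>_dual XY norms])
    show "(\<lambda>n. \<eta> n w) \<longlonglongrightarrow> \<zeta> w" if "w \<in> Y_space T" for w
      using \<zeta> XY that by blast
  qed
  moreover have "\<zeta> \<phi> = - Dx_distr (strip T) R \<phi>" if "\<phi> \<in> Cinfc (strip T)" for \<phi>
  proof -
    have "\<phi> \<in> C1c (strip T)" using that by (simp add: Cinfc_def C1c_def del: Ck_on.simps)
    then show ?thesis
      using LIMSEQ_unique[OF \<zeta>[OF C1c_X_space] test] by blast
  qed
  moreover have "\<zeta> \<in> subdiff_zero T (Psi T)"
    unfolding subdiff_zero_def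
  proof (intro CollectI conjI ballI \<zeta>_dual)
    fix w assume w: "w \<in> X_space T"
    \<comment> \<open>The right side is the same for all \<open>n\<close>, so the inequality
      survives the pointwise limit, also where it is infinite.\<close>
    have "ereal (\<eta> n w) \<le> enn2ereal (Psi T w)" for n
      using dR(4)[OF e[of n]] w unfolding subdiff_zero_def \<eta>_def by blast
    then show "ereal (\<zeta> w) \<le> enn2ereal (Psi T w)"
      by (intro LIMSEQ_le_const2[OF tendsto_ereal[OF \<zeta>[OF w]]]) auto
  qed
  \<comment> \<open>The whole sequence converges, so the identity serves as the subsequence.\<close>
  ultimately have limits: "\<exists>\<sigma> \<zeta>. strict_mono \<sigma> \<and> \<zeta> \<in> dual (X_space T) (X_norm T) \<and>
        wstar_dual (Y_space T) (Y_norm T) (\<lambda>n. L2_functional T (\<lambda>q. - dR (e (\<sigma> n)) q)) \<zeta> \<and>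
        (\<forall>\<phi>\<in>Cinfc (strip T). \<zeta> \<phi> = - Dx_distr (strip T) R \<phi>) \<and> \<zeta> \<in> subdiff_zero T (Psi T)"
    using \<zeta>_dual by (intro exI[of _ id] exI[of _ \<zeta>]) (auto simp: strict_mono_def \<eta>_def[abs_def])
  have "\<forall>\<epsilon>\<in>{0<..<1}. weak_dx (strip T) (\<lambda>q. plastic \<epsilon> (pe \<epsilon> q)) (dR \<epsilon>) \<and>
        dR \<epsilon> \<in> L2 (lborel_on (strip T)) \<and>
        L2_functional T (\<lambda>q. - dR \<epsilon> q) \<in> subdiff_zero T (Psi T)"
    using dR unfolding X_space_def by blast
  with limits show ?thesis by blast
qed

end
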